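(* Let $L>0$, $T>0$, $\Omega=(0,L)$, and assume: (i) $F\in W^1_\infty\bigl((0,T);L_\infty(\Omega)\bigr)$ and $g,g_*\in L_1\bigl((0,T);L_2(\Omega)\bigr)$; (ii) $F_x(x,t)\ge0$ for $0<x<L$ and $0<t<T$; (iii) $1+F(x,t)^2\le C_F$ for $0<x<L$ and $0<t<T$, where $C_F$ is a constant; (iv) $1/2<\alpha<1$. Let $u_{0h}\in\mathbb{S}_h$ and let $u_h:[0,T]\to\mathbb{S}_h$ be the solution of $$\langle u_{ht},v\rangle+\langle \partial_t^{1-\alpha}u_{hx},v_x\rangle-\langle F\,\partial_t^{1-\alpha}u_h,v_x\rangle=\langle g(t),v\rangle+\langle g_*(t),v_x\rangle\quad\text{for all }v\in\mathbb{S}_h,$$ with $u_h(0)=u_{0h}$. Then, for $0<t<T$, $$\|u_h(t)-u_{0h}\|^2\le\frac{t^{1-\alpha}}{(1-\alpha)^2}\int_0^t\Bigl(\tfrac14L^2\|g(s)\|^2+\|g_*(s)\|^2\Bigr)\,ds+\frac{C_F\,t^\alpha}{(1-\alpha)^2(2\alpha-1)}\,\|u_{0h}\|_1^2 .$$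
   Context: $\langle\cdot,\cdot\rangle$ and $\|\cdot\|$ are the inner product and norm of $L_2(\Omega)$; $\|\cdot\|_r$ is the norm of $H^r(\Omega)$. Subscripts $x,t$ denote partial derivatives; $u_{ht}=\partial u_h/\partial t$, $u_{hx}=\partial u_h/\partial x$. The fractional integral is $I^\alpha v(t)=\int_0^t\omega_\alpha(t-s)v(s)\,ds$ with $\omega_\alpha(t)=t^{\alpha-1}/\Gamma(\alpha)$, and the Riemann--Liouville derivative is $\partial_t^{1-\alpha}v=(I^\alpha v)_t$. Functions of $(x,t)$ are viewed as functions of $t$ with values in function spaces on $\Omega$. Given a partition $0=x_0<x_1<\cdots<x_P=L$ of $\Omega$, $\mathbb{S}_h\subseteq H^1_0(\Omega)$ is the space of continuous functions on $[0,L]$ that are linear on each $[x_{p-1},x_p]$ and vanish at $0$ and $L$; $h=\max_p(x_p-x_{p-1})$. The equation is the (slightly generalized) Galerkin discretization of $u_t-\kappa_\alpha\partial_t^{1-\alpha}u_{xx}+\mu_\alpha^{-1}(F\partial_t^{1-\alpha}u)_x=g$ with homogeneous Dirichlet boundary conditions and $\kappa_\alpha=\mu_\alpha=1$. Under (i) the problem has a unique continuous solution $u_h$ with $u_h(0)=u_{0h}$. *)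

theory Defs
  imports "HOL-Analysis.Analysis" "HOL-Probability.Essential_Supremum"
begin

text \<open>
  Functions of \<open>(x, t)\<close> are represented with time as the first argument, \<open>v :: real \<Rightarrow> real \<Rightarrow> real\<close>,
  where \<open>v t\<close> is the function \<open>x \<mapsto> v(x, t)\<close> on \<open>\<Omega> = (0, L)\<close>.  Elements of Lebesgue spaces are
  represented by functions, so the norms below are seminorms on the representatives.
\<close>

section \<open>Function spaces on \<open>(0, L)\<close>\<close>

definition L2_inner :: "real \<Rightarrow> (real \<Rightarrow> real) \<Rightarrow> (real \<Rightarrow> real) \<Rightarrow> real" where
  "L2_inner L f g = (\<integral>x. f x * g x \<partial>lebesgue_on {0<..<L})"

definition L2_space :: "real \<Rightarrow> (real \<Rightarrow> real) set" where
  "L2_space L = {f \<in> borel_measurable (lebesgue_on {0<..<L}).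
      integrable (lebesgue_on {0<..<L}) (\<lambda>x. (f x)\<^sup>2)}"

definition L2_norm :: "real \<Rightarrow> (real \<Rightarrow> real) \<Rightarrow> real" where
  "L2_norm L f = sqrt (L2_inner L f f)"

definition Linf_space :: "real \<Rightarrow> (real \<Rightarrow> real) set" where
  "Linf_space L = {f \<in> borel_measurable (lebesgue_on {0<..<L}).
      \<exists>C. AE x in lebesgue_on {0<..<L}. \<bar>f x\<bar> \<le> C}"

definition Linf_norm :: "real \<Rightarrow> (real \<Rightarrow> real) \<Rightarrow> real" where
  "Linf_norm L f = real_of_ereal (esssup (lebesgue_on {0<..<L}) (\<lambda>x. ereal \<bar>f x\<bar>))"

text \<open>
  The norm of \<open>H\<^sup>1(\<Omega>)\<close>.  It is only applied to continuous piecewise linear functions, whose weak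
  derivative is given by \<^const>\<open>deriv\<close> away from the finitely many nodes.
\<close>

definition H1_norm :: "real \<Rightarrow> (real \<Rightarrow> real) \<Rightarrow> real" where
  "H1_norm L v = sqrt ((L2_norm L v)\<^sup>2 + (L2_norm L (deriv v))\<^sup>2)"

definition is_partition :: "real \<Rightarrow> nat \<Rightarrow> (nat \<Rightarrow> real) \<Rightarrow> bool" where
  "is_partition L P x \<longleftrightarrow> x 0 = 0 \<and> x P = L \<and> (\<forall>p\<in>{1..P}. x (p - 1) < x p)"

text \<open>Values outside \<open>[0, L]\<close> are irrelevant and left unconstrained.\<close>

definition fem_space :: "real \<Rightarrow> nat \<Rightarrow> (nat \<Rightarrow> real) \<Rightarrow> (real \<Rightarrow> real) set" where
  "fem_space L P x = {v. continuous_on {0..L} v \<and> v 0 = 0 \<and> v L = 0 \<and>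
      (\<forall>p\<in>{1..P}. \<exists>a b. \<forall>y\<in>{x (p - 1)..x p}. v y = a + b * y)}"

section \<open>Bochner spaces on \<open>(0, T)\<close>\<close>

text \<open>
  The target space is a set \<open>X\<close> of functions together with a (semi)norm \<open>N\<close>.  The type
  \<^typ>\<open>real \<Rightarrow> real\<close> is not a Banach space, so the library's Bochner integral does not apply; the
  following is its definition transcribed to \<open>(X, N)\<close>.
\<close>

definition X_simple :: "(real \<Rightarrow> real) set \<Rightarrow> real \<Rightarrow> (real \<Rightarrow> real \<Rightarrow> real) \<Rightarrow> bool" where
  "X_simple X T s \<longleftrightarrow> simple_function (lebesgue_on {0<..<T}) s \<and> s ` {0<..<T} \<subseteq> X"

definition X_simple_integral :: "real \<Rightarrow> (real \<Rightarrow> real \<Rightarrow> real) \<Rightarrow> real \<Rightarrow> real" where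
  "X_simple_integral T s =
     (\<lambda>x. \<Sum>y\<in>s ` {0<..<T}. measure (lebesgue_on {0<..<T}) {t\<in>{0<..<T}. s t = y} * y x)"

definition X_measurable ::
  "(real \<Rightarrow> real) set \<Rightarrow> ((real \<Rightarrow> real) \<Rightarrow> real) \<Rightarrow> real \<Rightarrow> (real \<Rightarrow> real \<Rightarrow> real) \<Rightarrow> bool" where
  "X_measurable X N T v \<longleftrightarrow>
     (AE t in lebesgue_on {0<..<T}. v t \<in> X) \<and>
     (\<exists>s. (\<forall>n. X_simple X T (s n)) \<and>
        (AE t in lebesgue_on {0<..<T}. (\<lambda>n::nat. N (\<lambda>x. v t x - s n t x)) \<longlonglongrightarrow> 0))"

definition has_X_integral ::
  "(real \<Rightarrow> real) set \<Rightarrow> ((real \<Rightarrow> real) \<Rightarrow> real) \<Rightarrow> real \<Rightarrow> (real \<Rightarrow> real \<Rightarrow> real) \<Rightarrow> (real \<Rightarrow> real) \<Rightarrow> bool" where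
  "has_X_integral X N T v J \<longleftrightarrow>
     J \<in> X \<and> X_measurable X N T v \<and>
     (\<exists>s. (\<forall>n. X_simple X T (s n)) \<and>
        (\<lambda>n::nat. \<integral>\<^sup>+t. ennreal (N (\<lambda>x. v t x - s n t x)) \<partial>lebesgue_on {0<..<T}) \<longlonglongrightarrow> 0 \<and>
        (\<lambda>n. N (\<lambda>x. J x - X_simple_integral T (s n) x)) \<longlonglongrightarrow> 0)"

definition bochner_L1 ::
  "(real \<Rightarrow> real) set \<Rightarrow> ((real \<Rightarrow> real) \<Rightarrow> real) \<Rightarrow> real \<Rightarrow> (real \<Rightarrow> real \<Rightarrow> real) set" where
  "bochner_L1 X N T =
     {v. X_measurable X N T v \<and> integrable (lebesgue_on {0<..<T}) (\<lambda>t. N (v t))}"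

definition bochner_Linf ::
  "(real \<Rightarrow> real) set \<Rightarrow> ((real \<Rightarrow> real) \<Rightarrow> real) \<Rightarrow> real \<Rightarrow> (real \<Rightarrow> real \<Rightarrow> real) set" where
  "bochner_Linf X N T =
     {v. X_measurable X N T v \<and> (\<exists>C. AE t in lebesgue_on {0<..<T}. N (v t) \<le> C)}"

section \<open>Weak derivatives in time\<close>

text \<open>\<open>\<phi>\<close> is a \<open>C\<^sup>1\<close> function with compact support in \<open>(0, T)\<close> and derivative \<open>\<phi>'\<close>.\<close>

definition test_fun :: "real \<Rightarrow> (real \<Rightarrow> real) \<Rightarrow> (real \<Rightarrow> real) \<Rightarrow> bool" where
  "test_fun T \<phi> \<phi>' \<longleftrightarrow>
     (\<forall>t. (\<phi> has_real_derivative \<phi>' t) (at t)) \<and> continuous_on UNIV \<phi>' \<and>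
     (\<exists>a b. 0 < a \<and> b < T \<and> (\<forall>t. t \<notin> {a..b} \<longrightarrow> \<phi> t = 0))"

definition has_weak_deriv :: "real \<Rightarrow> (real \<Rightarrow> real) \<Rightarrow> (real \<Rightarrow> real) \<Rightarrow> bool" where
  "has_weak_deriv T f f' \<longleftrightarrow>
     integrable (lebesgue_on {0<..<T}) f \<and> integrable (lebesgue_on {0<..<T}) f' \<and>
     (\<forall>\<phi> \<phi>'. test_fun T \<phi> \<phi>' \<longrightarrow>
        (\<integral>t. f t * \<phi>' t \<partial>lebesgue_on {0<..<T}) = - (\<integral>t. f' t * \<phi> t \<partial>lebesgue_on {0<..<T}))"

definition has_weak_deriv_X ::
  "(real \<Rightarrow> real) set \<Rightarrow> ((real \<Rightarrow> real) \<Rightarrow> real) \<Rightarrow> real \<Rightarrow>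
     (real \<Rightarrow> real \<Rightarrow> real) \<Rightarrow> (real \<Rightarrow> real \<Rightarrow> real) \<Rightarrow> bool" where
  "has_weak_deriv_X X N T v v' \<longleftrightarrow>
     (\<forall>\<phi> \<phi>'. test_fun T \<phi> \<phi>' \<longrightarrow>
        (\<exists>J. has_X_integral X N T (\<lambda>t x. \<phi>' t * v t x) J \<and>
             has_X_integral X N T (\<lambda>t x. \<phi> t * v' t x) (\<lambda>x. - J x)))"

definition bochner_W1inf ::
  "(real \<Rightarrow> real) set \<Rightarrow> ((real \<Rightarrow> real) \<Rightarrow> real) \<Rightarrow> real \<Rightarrow> (real \<Rightarrow> real \<Rightarrow> real) set" where
  "bochner_W1inf X N T =
     {v \<in> bochner_Linf X N T. \<exists>v'\<in>bochner_Linf X N T. has_weak_deriv_X X N T v v'}"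

section \<open>Fractional integrals and the Galerkin equation\<close>

definition frac_kernel :: "real \<Rightarrow> real \<Rightarrow> real" where
  "frac_kernel \<alpha> t = t powr (\<alpha> - 1) / Gamma \<alpha>"

definition frac_integral :: "real \<Rightarrow> (real \<Rightarrow> real) \<Rightarrow> real \<Rightarrow> real" where
  "frac_integral \<alpha> v t = (\<integral>s. frac_kernel \<alpha> (t - s) * v s \<partial>lebesgue_on {0<..<t})"

text \<open>
  \<open>u : [0, T] \<rightarrow> S\<^sub>h\<close> is continuous with \<open>u(0) = u\<^sub>0\<close>; \<open>ut\<close> is its time derivative and \<open>z\<close> is the
  Riemann--Liouville derivative of order \<open>1 - \<alpha>\<close>, i.e. the time derivative of the fractional integral
  of order \<open>\<alpha>\<close>.  As \<open>g\<close> and \<open>gs\<close> (the datum \<open>g\<^sub>*\<close>) are only integrable in time, the time derivatives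
  are integrable functions and the equation holds for almost every \<open>t\<close>.  Since \<open>S\<^sub>h\<close> is a
  finite-dimensional space of functions on \<open>[0, L]\<close>, continuity and time derivatives can be taken at
  each fixed \<open>y \<in> [0, L]\<close>.
\<close>

definition galerkin_solution ::
  "real \<Rightarrow> real \<Rightarrow> real \<Rightarrow> nat \<Rightarrow> (nat \<Rightarrow> real) \<Rightarrow>
     (real \<Rightarrow> real \<Rightarrow> real) \<Rightarrow> (real \<Rightarrow> real \<Rightarrow> real) \<Rightarrow> (real \<Rightarrow> real \<Rightarrow> real) \<Rightarrow>
     (real \<Rightarrow> real) \<Rightarrow> (real \<Rightarrow> real \<Rightarrow> real) \<Rightarrow> bool" where
  "galerkin_solution L T \<alpha> P x F g gs u0 u \<longleftrightarrow>
     (\<forall>t\<in>{0..T}. u t \<in> fem_space L P x) \<and>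
     (\<forall>y\<in>{0..L}. continuous_on {0..T} (\<lambda>t. u t y)) \<and>
     (\<forall>y\<in>{0..L}. u 0 y = u0 y) \<and>
     (\<exists>ut z.
        (\<forall>t\<in>{0<..<T}. ut t \<in> fem_space L P x \<and> z t \<in> fem_space L P x) \<and>
        (\<forall>y\<in>{0..L}. has_weak_deriv T (\<lambda>t. u t y) (\<lambda>t. ut t y)) \<and>
        (\<forall>y\<in>{0..L}. has_weak_deriv T (frac_integral \<alpha> (\<lambda>s. u s y)) (\<lambda>t. z t y)) \<and>
        (AE t in lebesgue_on {0<..<T}. \<forall>v\<in>fem_space L P x.
           L2_inner L (ut t) v + L2_inner L (deriv (z t)) (deriv v)
             - L2_inner L (\<lambda>y. F t y * z t y) (deriv v)
           = L2_inner L (g t) v + L2_inner L (gs t) (deriv v)))"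

end

theory Submission
  imports Defs "HOL-Real_Asymp.Real_Asymp"
begin

text \<open>
  Put \<open>w = u - u\<^sub>0\<close> and \<open>z\<^sub>w = I\<^sup>\<alpha> w\<^sub>t\<close>, so that \<open>z = z\<^sub>w + \<omega>\<^sub>\<alpha> u\<^sub>0\<close>.  Testing with \<open>v = z\<^sub>w\<close>, the convection
  term of \<open>z\<^sub>w\<close> has a sign because \<open>F\<^sub>x \<ge> 0\<close>; absorbing \<open>\<parallel>z\<^sub>w\<^sub>x\<parallel>\<^sup>2\<close> with Young's inequality and the Poincare
  inequality with constant \<open>L/2\<close> bounds \<open>\<langle>w\<^sub>t, I\<^sup>\<alpha> w\<^sub>t\<rangle>\<close> pointwise in time by the data and
  \<open>\<omega>\<^sub>\<alpha>\<^sup>2 C\<^sub>F \<parallel>u\<^sub>0\<parallel>\<^sub>1\<^sup>2\<close>.  Conversely, the kernel \<open>\<bar>s - r\<bar>\<^bsup>\<alpha>-1\<^esup>\<close> is a positive superposition of products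
  \<open>1\<^sub>{x<s<y} 1\<^sub>{x<r<y}\<close>; keeping only the windows \<open>(x, y)\<close> that contain \<open>(0, t)\<close> gives
  \<open>w(t)\<^sup>2 \<le> 2 \<Gamma>(\<alpha>) t\<^bsup>1-\<alpha>\<^esup> \<integral> w\<^sub>t I\<^sup>\<alpha> w\<^sub>t\<close> over \<open>(0, t)\<close> at each point of \<open>\<Omega>\<close>.  The constants fit because
  \<open>1 \<le> \<Gamma>(\<alpha>) \<le> 2\<close> and \<open>(1 - \<alpha>)\<^bsup>-2\<^esup> \<ge> 4\<close>.  A priori \<open>w\<^sub>t\<close> is only integrable in time; but \<open>\<omega>\<^sub>\<alpha>\<close> is square
  integrable for \<open>\<alpha> > 1/2\<close>, hence so is \<open>z\<^sub>w = \<omega>\<^sub>\<alpha> * w\<^sub>t\<close>, and then \<open>w\<^sub>t\<close> by the equation and an inverse estimate.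
\<close>

section \<open>Energy of the Riesz kernel\<close>

text \<open>The data are only integrable in time, so the integral in the claim may diverge, and then
  there is nothing to show. If it is finite, g and g_* are square integrable on (0,t), which feeds
  the bootstrap for the time derivative. That derivative has to be square integrable because v(s)
  v(r) |s-r|^(\<alpha>-1) must be absolutely integrable before integrals over time pairs and over
  windows can be exchanged. The inverse estimate in the bootstrap depends on the mesh, but it is
  used only qualitatively and leaves no trace in the constants.

  The lower energy bound is pointwise in space, the upper one is an integral over \<Omega>. They are
  joined by expanding in finitely many nodal values, so joint measurability in (x,t) never has to be
  discussed.

  Constants: Young's inequality with three data terms costs 3/4. Together with the factor 2
  Gamma(\<alpha>) this leaves 3 Gamma(\<alpha>)/2 in front of the data and, as the squared kernel
  carries Gamma(\<alpha>)^(-2), 3/(2 Gamma(\<alpha>)) in front of the initial value.\<close>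

lemma nn_integral_powr_to_inf:
  fixes a e :: real
  assumes "e < -1" "0 < a"
  shows "(\<integral>\<^sup>+x. ennreal (x powr e) * indicator {a..} x \<partial>lborel) = ennreal (- (a powr (e + 1)) / (e + 1))"
proof -
  have "(\<integral>\<^sup>+x. ennreal (indicator {a..} x * x powr e) \<partial>lborel) = ennreal (- (a powr (e + 1)) / (e + 1))"
    by (rule nn_integral_has_integral_lborel)
       (use has_integral_powr_to_inf[OF assms] has_integral_restrict_UNIV[of "{a..}" "\<lambda>x. x powr e"] in
         \<open>auto simp: indicator_def of_bool_def if_distrib[of "\<lambda>z. z * _"] cong: if_cong\<close>)
  then show ?thesis
    by (simp add: ennreal_mult' ennreal_indicator mult.commute)
qed

text \<open>A triangle function is the autocorrelation of an interval, so a convex decreasing kernel is a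
  superposition of products \<open>1\<^sub>{x<s<y} 1\<^sub>{x<r<y}\<close>.\<close>

lemma riesz_kernel_superposition:
  fixes s r \<alpha> :: real
  assumes \<alpha>: "0 < \<alpha>" "\<alpha> < 1" and "s \<noteq> r"
  shows "has_bochner_integral (lborel \<Otimes>\<^sub>M lborel)
    (\<lambda>(x, y). (1 - \<alpha>) * (2 - \<alpha>) * (y - x) powr (\<alpha> - 3) * (indicator {x<..<y} s * indicator {x<..<y} r))
    (\<bar>s - r\<bar> powr (\<alpha> - 1))"
proof (rule has_bochner_integral_nn_integral)
  define m M where "m = min s r" and "M = max s r"
  have mM: "m < M" "\<bar>s - r\<bar> = M - m" using assms by (auto simp: m_def M_def)
  \<comment> \<open>A window (x,y) contains s and r iff x < m and M < y. Integrating y over (M,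
    infinity) divides by 2 - \<alpha>, integrating x over (-infinity, m) then divides by 1 -
    \<alpha>; this explains the normalising factor.\<close>
  have inner: "(\<integral>\<^sup>+y. ennreal ((1 - \<alpha>) * (2 - \<alpha>) * (y - x) powr (\<alpha> - 3) * (indicator {x<..<y} s * indicator {x<..<y} r)) \<partial>lborel)
      = ennreal ((1 - \<alpha>) * (M - x) powr (\<alpha> - 2)) * indicator {..<m} x" (is "?l = ?r") for x
  proof (cases "x < m")
    case True
    have "?l = (\<integral>\<^sup>+y. ennreal ((1 - \<alpha>) * (2 - \<alpha>)) * (ennreal ((y - x) powr (\<alpha> - 3)) * indicator {M..} y) \<partial>lborel)"
      by (rule nn_integral_cong_AE, rule AE_mp[OF AE_lborel_singleton[of M]])
         (use True \<alpha> in \<open>auto simp: indicator_def m_def M_def ennreal_mult'\<close>)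
    also have "\<dots> = ennreal ((1 - \<alpha>) * (2 - \<alpha>)) * (\<integral>\<^sup>+y. ennreal ((y - x) powr (\<alpha> - 3)) * indicator {M..} y \<partial>lborel)"
      by (rule nn_integral_cmult) simp
    also have "(\<integral>\<^sup>+y. ennreal ((y - x) powr (\<alpha> - 3)) * indicator {M..} y \<partial>lborel)
       = (\<integral>\<^sup>+y. ennreal (y powr (\<alpha> - 3)) * indicator {M - x..} y \<partial>lborel)"
      by (subst nn_integral_real_affine[where c=1 and t=x]) (auto intro!: nn_integral_cong simp: indicator_def)
    also have "\<dots> = ennreal (- ((M - x) powr (\<alpha> - 3 + 1)) / (\<alpha> - 3 + 1))"
      by (rule nn_integral_powr_to_inf) (use True mM \<alpha> in auto)
    also have "ennreal ((1 - \<alpha>) * (2 - \<alpha>)) * \<dots> = ennreal ((1 - \<alpha>) * (2 - \<alpha>) * (- ((M - x) powr (\<alpha> - 3 + 1)) / (\<alpha> - 3 + 1)))"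
      using \<alpha> by (intro ennreal_mult[symmetric]) (auto simp: divide_nonneg_neg divide_nonpos_neg)
    also have "(1 - \<alpha>) * (2 - \<alpha>) * (- ((M - x) powr (\<alpha> - 3 + 1)) / (\<alpha> - 3 + 1)) = (1 - \<alpha>) * (M - x) powr (\<alpha> - 2)"
      using \<alpha> by (simp add: divide_simps) (simp add: algebra_simps)
    finally show ?thesis using True by simp
  next
    case False
    then show ?thesis by (auto simp: indicator_def m_def)
  qed
  have "(\<integral>\<^sup>+p. ennreal (case p of (x, y) \<Rightarrow> (1 - \<alpha>) * (2 - \<alpha>) * (y - x) powr (\<alpha> - 3) * (indicator {x<..<y} s * indicator {x<..<y} r)) \<partial>(lborel \<Otimes>\<^sub>M lborel))
     = (\<integral>\<^sup>+x. \<integral>\<^sup>+y. ennreal ((1 - \<alpha>) * (2 - \<alpha>) * (y - x) powr (\<alpha> - 3) * (indicator {x<..<y} s * indicator {x<..<y} r)) \<partial>lborel \<partial>lborel)"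
    by (subst lborel.nn_integral_fst[symmetric]) (simp_all add: indicator_def of_bool_def)
  also have "\<dots> = (\<integral>\<^sup>+x. ennreal (1 - \<alpha>) * (ennreal ((M - x) powr (\<alpha> - 2)) * indicator {..<m} x) \<partial>lborel)"
    unfolding inner using \<alpha> by (simp add: ennreal_mult' mult_ac)
  also have "\<dots> = ennreal (1 - \<alpha>) * (\<integral>\<^sup>+x. ennreal ((M - x) powr (\<alpha> - 2)) * indicator {..<m} x \<partial>lborel)"
    by (rule nn_integral_cmult) simp
  also have "(\<integral>\<^sup>+x. ennreal ((M - x) powr (\<alpha> - 2)) * indicator {..<m} x \<partial>lborel)
      = (\<integral>\<^sup>+x. ennreal (x powr (\<alpha> - 2)) * indicator {M - m<..} x \<partial>lborel)"
    by (subst nn_integral_real_affine[where c="-1" and t=M]) (auto intro!: nn_integral_cong simp: indicator_def)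
  also have "\<dots> = (\<integral>\<^sup>+x. ennreal (x powr (\<alpha> - 2)) * indicator {M - m..} x \<partial>lborel)"
    by (rule nn_integral_cong_AE, rule AE_mp[OF AE_lborel_singleton[of "M - m"]]) (auto simp: indicator_def)
  also have "\<dots> = ennreal (- ((M - m) powr (\<alpha> - 2 + 1)) / (\<alpha> - 2 + 1))"
    by (rule nn_integral_powr_to_inf) (use mM \<alpha> in auto)
  also have "ennreal (1 - \<alpha>) * \<dots> = ennreal ((1 - \<alpha>) * (- ((M - m) powr (\<alpha> - 2 + 1)) / (\<alpha> - 2 + 1)))"
    using \<alpha> by (intro ennreal_mult[symmetric]) (auto simp: divide_nonneg_neg divide_nonpos_neg)
  also have "(1 - \<alpha>) * (- ((M - m) powr (\<alpha> - 2 + 1)) / (\<alpha> - 2 + 1)) = \<bar>s - r\<bar> powr (\<alpha> - 1)"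
    using \<alpha> by (simp add: mM(2) divide_simps) (simp add: algebra_simps)
  finally show "(\<integral>\<^sup>+p. ennreal (case p of (x, y) \<Rightarrow> (1 - \<alpha>) * (2 - \<alpha>) * (y - x) powr (\<alpha> - 3) * (indicator {x<..<y} s * indicator {x<..<y} r)) \<partial>(lborel \<Otimes>\<^sub>M lborel))
     = ennreal (\<bar>s - r\<bar> powr (\<alpha> - 1))" .
qed (use \<alpha> in \<open>auto simp: split_beta' indicator_def of_bool_def\<close>)

text \<open>The superposition formula fails on the diagonal, where the integral over windows
  diverges while \<open>0 powr (\<alpha> - 1)\<close> is 0 by convention. The diagonal therefore has
  to be discarded as a null set.\<close>

lemma AE_pair_neq: "AE p in lborel \<Otimes>\<^sub>M lborel. fst p \<noteq> (snd p :: real)"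
proof (subst lborel_pair.AE_pair_iff[symmetric])
  show "AE x in lborel. AE y in lborel. (x::real) \<noteq> y"
    by (rule AE_I2) (use AE_lborel_singleton in \<open>auto simp: eq_commute\<close>)
qed measurable

text \<open>Exchanging integrals turns the energy into an integral over windows of
  \<open>\<kappa> x y\<close> times the square of the integral of v over (x,y), so any window may be
  dropped. On a window around 0 and t the inner integral is the full integral of v, and the total
  weight of these windows is the superposition formula at the pair (0,t), that is t^(\<alpha>-1).
  Thus \<open>W (0, t)\<close> serves as their indicator and their weight at once.\<close>

lemma riesz_energy_lower_bound:
  fixes v :: "real \<Rightarrow> real" and t \<alpha> :: real
  assumes \<alpha>: "0 < \<alpha>" "\<alpha> < 1" and t: "0 < t"
    and v: "integrable lborel v" "\<And>s. s \<notin> {0<..<t} \<Longrightarrow> v s = 0"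
    and fin: "integrable (lborel \<Otimes>\<^sub>M lborel) (\<lambda>(s, r). v s * v r * \<bar>s - r\<bar> powr (\<alpha> - 1))"
  shows "t powr (\<alpha> - 1) * (\<integral>s. v s \<partial>lborel)\<^sup>2
    \<le> (\<integral>p. (case p of (s, r) \<Rightarrow> v s * v r * \<bar>s - r\<bar> powr (\<alpha> - 1)) \<partial>(lborel \<Otimes>\<^sub>M lborel))"
proof -
  let ?M = "lborel \<Otimes>\<^sub>M lborel :: (real \<times> real) measure"
  define \<kappa> where "\<kappa> = (\<lambda>x y::real. (1 - \<alpha>) * (2 - \<alpha>) * (y - x) powr (\<alpha> - 3))"
  define W where "W = (\<lambda>q::real\<times>real. \<lambda>p. case q of (s,r) \<Rightarrow> (case p of (x, y) \<Rightarrow> \<kappa> x y * (indicat_real {x<..<y} s * indicator {x<..<y} r)))"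
  have \<kappa>0: "\<kappa> x y \<ge> 0" for x y using \<alpha> by (simp add: \<kappa>_def)
  have [measurable]: "v \<in> borel_measurable borel" using v(1) by simp
  have W: "has_bochner_integral ?M (W (s, r)) (\<bar>s - r\<bar> powr (\<alpha> - 1))" if "s \<noteq> r" for s r
    using riesz_kernel_superposition[OF \<alpha> that] by (simp add: W_def \<kappa>_def)
  have W0: "W q p \<ge> 0" for q p using \<kappa>0 by (auto simp: W_def split: prod.splits)
  interpret P: pair_sigma_finite ?M ?M ..
  have Wm[measurable]: "(\<lambda>(q, p). W q p) \<in> borel_measurable (?M \<Otimes>\<^sub>M ?M)"
    unfolding W_def \<kappa>_def split_beta' indicator_def of_bool_def greaterThanLessThan_iff by measurable
  define H where "H = (\<lambda>q p. v (fst q) * v (snd q) * W q p)"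
  have Hm[measurable]: "(\<lambda>(q, p). H q p) \<in> borel_measurable (?M \<Otimes>\<^sub>M ?M)"
    using Wm unfolding H_def split_beta' by measurable
  have H1: "AE q in ?M. integrable ?M (H q) \<and> (\<integral>p. \<bar>H q p\<bar> \<partial>?M) = \<bar>case q of (s, r) \<Rightarrow> v s * v r * \<bar>s - r\<bar> powr (\<alpha> - 1)\<bar>
       \<and> (\<integral>p. H q p \<partial>?M) = (case q of (s, r) \<Rightarrow> v s * v r * \<bar>s - r\<bar> powr (\<alpha> - 1))"
    using AE_pair_neq
  proof eventually_elim
    case (elim q)
    obtain s r where q: "q = (s, r)" by (cases q)
    from W[of s r] elim q have "integrable ?M (W q)" "integral\<^sup>L ?M (W q) = \<bar>s - r\<bar> powr (\<alpha> - 1)"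
      by (auto simp: has_bochner_integral_iff)
    then show ?case by (auto simp: H_def q abs_mult W0)
  qed
  \<comment> \<open>As W is nonnegative, integrating |H| over the windows gives back the absolute
    value of the energy integrand almost everywhere, so integrability in all four variables reduces
    to \<open>fin\<close>.\<close>
  have int: "integrable (?M \<Otimes>\<^sub>M ?M) (\<lambda>(q, p). H q p)"
  proof (rule P.Fubini_integrable)
    have "integrable ?M (\<lambda>q. \<bar>case q of (s, r) \<Rightarrow> v s * v r * \<bar>s - r\<bar> powr (\<alpha> - 1)\<bar>)"
      by (rule integrable_abs[OF fin])
    then show "integrable ?M (\<lambda>q. \<integral>p. norm (case (q, p) of (q, p) \<Rightarrow> H q p) \<partial>?M)"
      by (rule integrable_cong_AE_imp) (use H1 in \<open>auto elim: eventually_mono\<close>)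
  qed (use H1 in \<open>auto elim: eventually_mono\<close>)
  \<comment> \<open>For a fixed window the kernel no longer couples s and r, and the double integral
    factorises into a square.\<close>
  have inner: "(\<integral>q. H q (x, y) \<partial>?M) = \<kappa> x y * (\<integral>s. v s * indicator {x<..<y} s \<partial>lborel)\<^sup>2" for x y
  proof -
    have i: "integrable lborel (\<lambda>s. v s * indicator {x<..<y} s)"
      using v(1) by (intro integrable_real_mult_indicator) auto
    have "(\<integral>q. H q (x, y) \<partial>?M) = (\<integral>q. \<kappa> x y * (case q of (s, r) \<Rightarrow> (v s * indicator {x<..<y} s) * (v r * indicator {x<..<y} r)) \<partial>?M)"
      by (rule Bochner_Integration.integral_cong) (auto simp: H_def W_def)
    also have "\<dots> = \<kappa> x y * (\<integral>q. (case q of (s, r) \<Rightarrow> (v s * indicator {x<..<y} s) * (v r * indicator {x<..<y} r)) \<partial>?M)"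
      by simp
    also have "(\<integral>q. (case q of (s, r) \<Rightarrow> (v s * indicator {x<..<y} s) * (v r * indicator {x<..<y} r)) \<partial>?M)
       = (\<integral>s. \<integral>r. (v s * indicator {x<..<y} s) * (v r * indicator {x<..<y} r) \<partial>lborel \<partial>lborel)"
      by (subst lborel_pair.integral_fst'[symmetric])
         (auto intro!: lborel_pair.Fubini_integrable i simp: abs_mult not_integrable_integral_eq)
    also have "\<dots> = (\<integral>s. v s * indicator {x<..<y} s \<partial>lborel)\<^sup>2"
      by (simp add: power2_eq_square)
    finally show ?thesis .
  qed
  have "(\<integral>q. (case q of (s, r) \<Rightarrow> v s * v r * \<bar>s - r\<bar> powr (\<alpha> - 1)) \<partial>?M) = (\<integral>q. \<integral>p. H q p \<partial>?M \<partial>?M)"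
    by (rule integral_cong_AE) (use H1 in \<open>auto elim: eventually_mono\<close>)
  also have "\<dots> = (\<integral>p. \<integral>q. H q p \<partial>?M \<partial>?M)"
    using P.Fubini_integral[OF int] by simp
  also have "\<dots> \<ge> (\<integral>p. (\<integral>s. v s \<partial>lborel)\<^sup>2 * W (0, t) p \<partial>?M)"
  proof (rule integral_mono)
    show "integrable ?M (\<lambda>p. (\<integral>s. v s \<partial>lborel)\<^sup>2 * W (0, t) p)"
      using W[of 0 t] t by (simp add: has_bochner_integral_iff)
    show "integrable ?M (\<lambda>p. \<integral>q. H q p \<partial>?M)"
      using P.integrable_snd[OF int] by simp
    fix p :: "real \<times> real"
    obtain x y where p: "p = (x, y)" by (cases p)
    show "(\<integral>s. v s \<partial>lborel)\<^sup>2 * W (0, t) p \<le> (\<integral>q. H q p \<partial>?M)"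
    proof (cases "x < 0 \<and> t < y")
      case True
      have "(\<integral>s. v s * indicator {x<..<y} s \<partial>lborel) = (\<integral>s. v s \<partial>lborel)"
      proof (rule Bochner_Integration.integral_cong)
        show "v s * indicator {x<..<y} s = v s" for s
          using v(2)[of s] True by (cases "s \<in> {0<..<t}") auto
      qed simp
      then show ?thesis using True t by (simp add: p inner W_def)
    next
      case False
      then have "W (0, t) p = 0" using t by (auto simp: W_def p)
      then show ?thesis using \<kappa>0 by (simp add: p inner)
    qed
  qed
  also have "(\<integral>p. (\<integral>s. v s \<partial>lborel)\<^sup>2 * W (0, t) p \<partial>?M) = t powr (\<alpha> - 1) * (\<integral>s. v s \<partial>lborel)\<^sup>2"
    using W[of 0 t] t by (simp add: has_bochner_integral_iff)
  finally show ?thesis .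
qed

section \<open>Convolution with the truncated fractional kernel\<close>

lemma has_bochner_integral_powr:
  fixes a b :: real
  assumes "-1 < a" "0 \<le> b"
  shows "has_bochner_integral lborel (\<lambda>x. indicator {0<..<b} x * x powr a) (b powr (a + 1) / (a + 1))"
proof (rule has_bochner_integral_nn_integral)
  have "(\<integral>\<^sup>+x. ennreal (indicator {0..b} x * x powr a) \<partial>lborel) = ennreal (b powr (a + 1) / (a + 1))"
    by (rule nn_integral_has_integral_lborel)
       (use has_integral_powr_from_0[OF assms] has_integral_restrict_UNIV[of "{0..b}" "\<lambda>x. x powr a"] in
         \<open>auto simp: indicator_def of_bool_def if_distrib[of "\<lambda>z. z * _"] cong: if_cong\<close>)
  moreover have "(\<integral>\<^sup>+x. ennreal (indicator {0<..<b} x * x powr a) \<partial>lborel)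
      = (\<integral>\<^sup>+x. ennreal (indicator {0..b} x * x powr a) \<partial>lborel)"
    by (rule nn_integral_cong_AE, rule AE_mp[OF AE_lborel_singleton[of b]], rule AE_mp[OF AE_lborel_singleton[of 0]])
       (auto simp: indicator_def)
  ultimately show "(\<integral>\<^sup>+x. ennreal (indicator {0<..<b} x * x powr a) \<partial>lborel) = ennreal (b powr (a + 1) / (a + 1))"
    by simp
qed (use assms in auto)

text \<open>Taken over the whole line so that translation invariance of \<open>lborel\<close>
  applies directly; causality comes from kernels and densities that vanish on the negative
  half-line. Where the product is not integrable the value is 0, which for integrable factors
  concerns only a null set.\<close>

definition convolution :: "(real \<Rightarrow> real) \<Rightarrow> (real \<Rightarrow> real) \<Rightarrow> real \<Rightarrow> real" where
  "convolution k v s = (\<integral>r. k (s - r) * v r \<partial>lborel)"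

lemma integrable_convolution_pair:
  fixes k v :: "real \<Rightarrow> real"
  assumes "integrable lborel k" "integrable lborel v"
  shows "integrable (lborel \<Otimes>\<^sub>M lborel) (\<lambda>(s, r). k (s - r) * v r)"
proof -
  have [measurable]: "k \<in> borel_measurable borel" "v \<in> borel_measurable borel" using assms by auto
  have 1: "integrable lborel (\<lambda>s. k (s - r))" "(\<integral>s. \<bar>k (s - r)\<bar> \<partial>lborel) = (\<integral>s. \<bar>k s\<bar> \<partial>lborel)" for r
    using lborel_integrable_real_affine[OF assms(1), of 1 "-r"]
      lborel_integral_real_affine[of 1 "\<lambda>s. \<bar>k s\<bar>" "-r"] by simp_all
  have "integrable (lborel \<Otimes>\<^sub>M lborel) (\<lambda>(r, s). k (s - r) * v r)"
    by (rule lborel_pair.Fubini_integrable) (use assms 1 in \<open>auto simp: abs_mult\<close>)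
  from lborel_pair.integrable_product_swap[OF this] show ?thesis by simp
qed

lemma integrable_convolution:
  assumes "integrable lborel k" "integrable lborel v"
  shows "integrable lborel (convolution k v)"
    and "AE s in lborel. integrable lborel (\<lambda>r. k (s - r) * v r)"
  using lborel_pair.integrable_fst'[OF integrable_convolution_pair[OF assms]]
    lborel_pair.AE_integrable_fst'[OF integrable_convolution_pair[OF assms]]
  by (simp_all add: convolution_def[abs_def])

text \<open>Young's inequality for L^2 and L^1: writing |v| as the product of two square roots,
  Cauchy-Schwarz bounds the squared convolution of k and v by the convolution of k^2 and |v| times
  the L^1 norm of v, and that convolution is integrable by Tonelli.\<close>

lemma integrable_convolution_square:
  assumes k[measurable]: "k \<in> borel_measurable borel" and k2: "integrable lborel (\<lambda>s. (k s)\<^sup>2)"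
    and v: "integrable lborel v"
  shows "integrable lborel (\<lambda>s. (convolution k v s)\<^sup>2)"
proof (rule integrableI_bounded)
  have [measurable]: "v \<in> borel_measurable borel" using v by auto
  show "(\<lambda>s. (convolution k v s)\<^sup>2) \<in> borel_measurable lborel"
    unfolding convolution_def by measurable
  let ?V = "\<integral>\<^sup>+r. ennreal \<bar>v r\<bar> \<partial>lborel"
  have bound: "ennreal (norm ((convolution k v s)\<^sup>2)) \<le> (\<integral>\<^sup>+r. ennreal ((k (s - r))\<^sup>2 * \<bar>v r\<bar>) \<partial>lborel) * ?V" for s
  proof -
    have "ennreal (norm ((convolution k v s)\<^sup>2)) = (ennreal \<bar>convolution k v s\<bar>)\<^sup>2"
      by (simp add: ennreal_power)
    also have "\<dots> \<le> (\<integral>\<^sup>+r. ennreal \<bar>k (s - r) * v r\<bar> \<partial>lborel)\<^sup>2"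
    proof (intro power_mono)
      \<comment> \<open>At points where the integrand is not integrable, \<open>convolution\<close>
        is 0 and the bound is trivial; hence it holds for every s.\<close>
      show "ennreal \<bar>convolution k v s\<bar> \<le> (\<integral>\<^sup>+r. ennreal \<bar>k (s - r) * v r\<bar> \<partial>lborel)"
        using integral_norm_bound_ennreal[of lborel "\<lambda>r. k (s - r) * v r"]
        by (cases "integrable lborel (\<lambda>r. k (s - r) * v r)") (auto simp: convolution_def not_integrable_integral_eq)
    qed simp
    also have "(\<integral>\<^sup>+r. ennreal \<bar>k (s - r) * v r\<bar> \<partial>lborel)
        = (\<integral>\<^sup>+r. ennreal (\<bar>k (s - r)\<bar> * sqrt \<bar>v r\<bar>) * ennreal (sqrt \<bar>v r\<bar>) \<partial>lborel)"
      by (rule nn_integral_cong) (simp add: abs_mult mult.assoc flip: ennreal_mult)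
    also have "\<dots>\<^sup>2 \<le> (\<integral>\<^sup>+r. ennreal (\<bar>k (s - r)\<bar> * sqrt \<bar>v r\<bar>) ^ 2 \<partial>lborel) * (\<integral>\<^sup>+r. ennreal (sqrt \<bar>v r\<bar>) ^ 2 \<partial>lborel)"
      by (rule Cauchy_Schwarz_nn_integral) measurable
    finally show ?thesis
      by (simp add: ennreal_power power_mult_distrib)
  qed
  have "(\<integral>\<^sup>+s. ennreal (norm ((convolution k v s)\<^sup>2)) \<partial>lborel)
      \<le> (\<integral>\<^sup>+s. (\<integral>\<^sup>+r. ennreal ((k (s - r))\<^sup>2 * \<bar>v r\<bar>) \<partial>lborel) * ?V \<partial>lborel)"
    by (rule nn_integral_mono) (rule bound)
  also have "\<dots> = (\<integral>\<^sup>+s. \<integral>\<^sup>+r. ennreal ((k (s - r))\<^sup>2 * \<bar>v r\<bar>) \<partial>lborel \<partial>lborel) * ?V"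
    by (rule nn_integral_multc) measurable
  also have "(\<integral>\<^sup>+s. \<integral>\<^sup>+r. ennreal ((k (s - r))\<^sup>2 * \<bar>v r\<bar>) \<partial>lborel \<partial>lborel)
      = (\<integral>\<^sup>+p. ennreal (norm (case p of (s, r) \<Rightarrow> (k (s - r))\<^sup>2 * \<bar>v r\<bar>)) \<partial>(lborel \<Otimes>\<^sub>M lborel))"
    by (subst lborel.nn_integral_fst[symmetric]) (auto simp: abs_mult)
  also have "\<dots> * ?V < \<infinity>"
    using integrable_convolution_pair[OF k2, of "\<lambda>r. \<bar>v r\<bar>"] v
    by (auto simp: integrable_iff_bounded ennreal_mult_less_top)
  finally show "(\<integral>\<^sup>+s. ennreal (norm ((convolution k v s)\<^sup>2)) \<partial>lborel) < \<infinity>" .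
qed

text \<open>Fubini and a shift by r. Since v lives on positive r and k on positive arguments, the
  window (0,t) for s becomes (0,t-r): a primitive of the convolution is v convolved with the
  primitive of k.\<close>

lemma integral_convolution_Ioo:
  assumes k: "integrable lborel k" "\<And>s. s \<le> 0 \<Longrightarrow> k s = 0"
    and v: "integrable lborel v" "\<And>s. s \<le> 0 \<Longrightarrow> v s = 0"
  shows "(\<integral>s. indicator {0<..<t} s * convolution k v s \<partial>lborel)
     = (\<integral>r. v r * (\<integral>s. indicator {0<..<t - r} s * k s \<partial>lborel) \<partial>lborel)"
proof -
  have [measurable]: "k \<in> borel_measurable borel" "v \<in> borel_measurable borel" using assms by auto
  have "integrable (lborel \<Otimes>\<^sub>M lborel) (\<lambda>(s, r). indicator {0<..<t} s * (k (s - r) * v r))"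
    by (rule Bochner_Integration.integrable_bound[OF integrable_convolution_pair[OF k(1) v(1)]])
       (auto simp: indicator_def)
  then have "(\<integral>s. \<integral>r. indicator {0<..<t} s * (k (s - r) * v r) \<partial>lborel \<partial>lborel)
     = (\<integral>r. \<integral>s. indicator {0<..<t} s * (k (s - r) * v r) \<partial>lborel \<partial>lborel)"
    by (rule lborel_pair.Fubini_integral[symmetric])
  also have "\<dots> = (\<integral>r. v r * (\<integral>s. indicator {0<..<t - r} s * k s \<partial>lborel) \<partial>lborel)"
  proof (rule Bochner_Integration.integral_cong)
    fix r
    have "(\<integral>s. indicator {0<..<t} s * (k (s - r) * v r) \<partial>lborel)
        = (\<integral>s. v r * (indicator {0<..<t} s * k (s - r)) \<partial>lborel)"
      by (rule Bochner_Integration.integral_cong) auto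
    also have "\<dots> = v r * (\<integral>s. indicator {0<..<t} s * k (s - r) \<partial>lborel)"
      by simp
    also have "\<dots> = v r * (\<integral>s. indicator {0<..<t} (r + s) * k s \<partial>lborel)"
      by (subst lborel_integral_real_affine[of 1 _ r]) auto
    also have "\<dots> = v r * (\<integral>s. indicator {0<..<t - r} s * k s \<partial>lborel)"
    proof (cases "r \<le> 0")
      case False
      have "indicator {0<..<t} (r + s) * k s = indicator {0<..<t - r} s * k s" for s
        using False k(2)[of s] by (cases "s \<le> 0") (auto simp: indicator_def)
      then show ?thesis by (simp only:)
    qed (simp add: v(2))
    finally show "(\<integral>s. indicator {0<..<t} s * (k (s - r) * v r) \<partial>lborel)
        = v r * (\<integral>s. indicator {0<..<t - r} s * k s \<partial>lborel)" .
  qed simp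
  finally show ?thesis by (simp add: convolution_def)
qed

text \<open>Truncation makes the kernel integrable on the whole line; on \<open>(0, T)\<close> the convolution is unaffected.\<close>

definition trunc_kernel :: "real \<Rightarrow> real \<Rightarrow> real \<Rightarrow> real" where
  "trunc_kernel \<alpha> T s = indicator {0<..<T} s * frac_kernel \<alpha> s"

lemma borel_measurable_frac_kernel [measurable]: "frac_kernel \<alpha> \<in> borel_measurable borel"
  unfolding frac_kernel_def[abs_def] by measurable

lemma trunc_kernel_nonneg: "0 < \<alpha> \<Longrightarrow> 0 \<le> trunc_kernel \<alpha> T s"
  by (auto simp: trunc_kernel_def frac_kernel_def intro!: divide_nonneg_nonneg less_imp_le[OF Gamma_real_pos])

lemma has_bochner_integral_frac_kernel:
  assumes "0 < \<alpha>" "0 \<le> b"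
  shows "has_bochner_integral lborel (\<lambda>s. indicator {0<..<b} s * frac_kernel \<alpha> s) (b powr \<alpha> / (\<alpha> * Gamma \<alpha>))"
  using has_bochner_integral_divide_zero[OF has_bochner_integral_powr[of "\<alpha> - 1" b], of "Gamma \<alpha>"] assms
  by (simp add: frac_kernel_def)

text \<open>Integrability at 0 requires 2\<alpha> - 2 > -1, which is where \<alpha> > 1/2 enters;
  the value is the origin of 1/(2\<alpha> - 1) in the final bound.\<close>

lemma has_bochner_integral_frac_kernel_square:
  assumes "1/2 < \<alpha>" "0 \<le> b"
  shows "has_bochner_integral lborel (\<lambda>s. indicator {0<..<b} s * (frac_kernel \<alpha> s)\<^sup>2)
    (b powr (2 * \<alpha> - 1) / ((2 * \<alpha> - 1) * (Gamma \<alpha>)\<^sup>2))"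
proof -
  have "indicator {0<..<b} s * s powr (2 * \<alpha> - 2) / (Gamma \<alpha>)\<^sup>2 = indicator {0<..<b} s * (frac_kernel \<alpha> s)\<^sup>2" for s
    by (simp add: frac_kernel_def power_divide indicator_def powr_realpow[symmetric] power2_eq_square[of "s powr _"] flip: powr_add)
  then show ?thesis
    using has_bochner_integral_divide_zero[OF has_bochner_integral_powr[of "2 * \<alpha> - 2" b], of "(Gamma \<alpha>)\<^sup>2"] assms
    by simp
qed

lemma integrable_trunc_kernel:
  assumes "0 < \<alpha>" "0 \<le> T"
  shows "integrable lborel (trunc_kernel \<alpha> T)"
  using has_bochner_integral_frac_kernel[OF assms]
  by (simp add: trunc_kernel_def[abs_def] has_bochner_integral_iff)

lemma integrable_trunc_kernel_square:
  assumes "1/2 < \<alpha>" "0 \<le> T"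
  shows "integrable lborel (\<lambda>s. (trunc_kernel \<alpha> T s)\<^sup>2)"
proof -
  have "(trunc_kernel \<alpha> T s)\<^sup>2 = indicator {0<..<T} s * (frac_kernel \<alpha> s)\<^sup>2" for s
    by (simp add: trunc_kernel_def indicator_def)
  then show ?thesis
    using has_bochner_integral_frac_kernel_square[OF assms] by (simp add: has_bochner_integral_iff)
qed

text \<open>On the support of v, |s-r|^(\<alpha>-1) is Gamma(\<alpha>) times the sum of the causal
  kernel at s-r and at r-s, the truncation at T being harmless because |s-r| < t \<le> T. The two
  halves have equal integrals by symmetry, which gives the factor 2. Square integrability of v
  enters through |v(s) v(r)| \<le> v(s)^2 + v(r)^2, which makes the causal integrand
  integrable.\<close>

lemma frac_integral_energy_lower_bound:
  fixes v :: "real \<Rightarrow> real" and t T \<alpha> :: real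
  assumes \<alpha>: "0 < \<alpha>" "\<alpha> < 1" and t: "0 < t" "t \<le> T"
    and v: "integrable lborel v" "\<And>s. s \<notin> {0<..<t} \<Longrightarrow> v s = 0"
    and v2: "integrable lborel (\<lambda>s. (v s)\<^sup>2)"
  shows "integrable lborel (\<lambda>s. v s * convolution (trunc_kernel \<alpha> T) v s)"
    and "(\<integral>s. v s \<partial>lborel)\<^sup>2 \<le> 2 * Gamma \<alpha> * t powr (1 - \<alpha>) * (\<integral>s. v s * convolution (trunc_kernel \<alpha> T) v s \<partial>lborel)"
proof -
  let ?M = "lborel \<Otimes>\<^sub>M lborel :: (real \<times> real) measure"
  let ?k = "trunc_kernel \<alpha> T"
  define h where "h = (\<lambda>s r. v s * (?k (s - r) * v r))"
  have [measurable]: "v \<in> borel_measurable borel" "?k \<in> borel_measurable borel"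
    using v(1) by (auto simp: trunc_kernel_def[abs_def])
  have k: "integrable lborel ?k" using integrable_trunc_kernel \<alpha> t by simp
  \<comment> \<open>The majorant containing v(s)^2 becomes a convolution integrand after swapping s
    and r, at the price of reflecting the kernel.\<close>
  have kr: "integrable lborel (\<lambda>s. ?k (- s))"
    using lborel_integrable_real_affine[OF k, of "-1" 0] by simp
  have i1: "integrable ?M (\<lambda>(s, r). ?k (s - r) * (v r)\<^sup>2)"
    by (rule integrable_convolution_pair[OF k v2])
  have i2: "integrable ?M (\<lambda>(s, r). ?k (s - r) * (v s)\<^sup>2)"
    using lborel_pair.integrable_product_swap[OF integrable_convolution_pair[OF kr v2]] by simp
  have h: "integrable ?M (\<lambda>(s, r). h s r)"
  proof (rule Bochner_Integration.integrable_bound[OF Bochner_Integration.integrable_add[OF i1 i2]])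
    show "AE p in ?M. norm (case p of (s, r) \<Rightarrow> h s r)
        \<le> norm ((case p of (s, r) \<Rightarrow> ?k (s - r) * (v r)\<^sup>2) + (case p of (s, r) \<Rightarrow> ?k (s - r) * (v s)\<^sup>2))"
    proof (rule AE_I2, clarify)
      fix s r
      have "\<bar>v s * v r\<bar> \<le> (v r)\<^sup>2 + (v s)\<^sup>2"
        using sum_squares_bound[of "\<bar>v s\<bar>" "\<bar>v r\<bar>"] mult_nonneg_nonneg[OF abs_ge_zero abs_ge_zero, of "v s" "v r"]
        unfolding abs_mult power2_abs by linarith
      then have "?k (s - r) * \<bar>v s * v r\<bar> \<le> ?k (s - r) * ((v r)\<^sup>2 + (v s)\<^sup>2)"
        using trunc_kernel_nonneg[OF \<alpha>(1)] by (rule mult_left_mono)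
      then show "norm (h s r) \<le> norm (?k (s - r) * (v r)\<^sup>2 + ?k (s - r) * (v s)\<^sup>2)"
        using trunc_kernel_nonneg[OF \<alpha>(1), of T "s - r"]
        by (simp add: h_def abs_mult mult_ac distrib_left)
    qed
  qed (simp add: h_def split_beta')
  have "integrable lborel (\<lambda>s. \<integral>r. h s r \<partial>lborel)"
    using lborel_pair.integrable_fst'[OF h] by simp
  then show "integrable lborel (\<lambda>s. v s * convolution ?k v s)"
    by (simp add: h_def convolution_def)
  have hs: "integrable ?M (\<lambda>(s, r). h r s)"
    using lborel_pair.integrable_product_swap[OF h] by simp
  \<comment> \<open>This holds on the diagonal too: \<open>0 powr (\<alpha> - 1)\<close> is 0, and
    the truncated kernel vanishes at 0.\<close>
  have eq: "v s * v r * \<bar>s - r\<bar> powr (\<alpha> - 1) = Gamma \<alpha> * (h s r + h r s)" for s r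
    using v(2)[of s] v(2)[of r] t Gamma_real_pos[OF \<alpha>(1)]
    by (cases "s \<in> {0<..<t} \<and> r \<in> {0<..<t}"; cases s r rule: linorder_cases)
       (auto simp: h_def trunc_kernel_def frac_kernel_def)
  have E: "(\<lambda>(s, r). v s * v r * \<bar>s - r\<bar> powr (\<alpha> - 1))
      = (\<lambda>p. Gamma \<alpha> * ((case p of (s, r) \<Rightarrow> h s r) + (case p of (s, r) \<Rightarrow> h r s)))"
    by (auto simp: eq)
  have "t powr (\<alpha> - 1) * (\<integral>s. v s \<partial>lborel)\<^sup>2 \<le> (\<integral>p. (case p of (s, r) \<Rightarrow> v s * v r * \<bar>s - r\<bar> powr (\<alpha> - 1)) \<partial>?M)"
    by (rule riesz_energy_lower_bound[OF \<alpha> t(1) v]) (use h hs in \<open>auto simp: E\<close>)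
  also have "\<dots> = Gamma \<alpha> * ((\<integral>p. (case p of (s, r) \<Rightarrow> h s r) \<partial>?M) + (\<integral>p. (case p of (s, r) \<Rightarrow> h r s) \<partial>?M))"
    unfolding E using h hs by simp
  also have "(\<integral>p. (case p of (s, r) \<Rightarrow> h r s) \<partial>?M) = (\<integral>p. (case p of (s, r) \<Rightarrow> h s r) \<partial>?M)"
    using lborel_pair.integral_product_swap[of "\<lambda>(s, r). h s r"] h by simp
  also have "(\<integral>p. (case p of (s, r) \<Rightarrow> h s r) \<partial>?M) = (\<integral>s. v s * convolution ?k v s \<partial>lborel)"
    using lborel_pair.integral_fst'[OF h] by (simp add: h_def convolution_def)
  finally have "t powr (1 - \<alpha>) * (t powr (\<alpha> - 1) * (\<integral>s. v s \<partial>lborel)\<^sup>2)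
     \<le> t powr (1 - \<alpha>) * (Gamma \<alpha> * (2 * (\<integral>s. v s * convolution ?k v s \<partial>lborel)))"
    by (intro mult_left_mono) auto
  then show "(\<integral>s. v s \<partial>lborel)\<^sup>2 \<le> 2 * Gamma \<alpha> * t powr (1 - \<alpha>) * (\<integral>s. v s * convolution (trunc_kernel \<alpha> T) v s \<partial>lborel)"
    unfolding mult.assoc[symmetric] powr_add[symmetric] using t by (simp add: mult_ac)
qed

section \<open>Weak derivatives in time\<close>

text \<open>Norms and weak derivatives are stated on the completed measure, whereas shifts and
  Fubini are carried out for Borel functions on \<open>lborel\<close>. This transfers integrals
  between the two through an a.e. equal Borel function.\<close>

lemma lebesgue_on_Ioo_eq_lborel:
  fixes f g :: "real \<Rightarrow> real"
  assumes f: "f \<in> borel_measurable (lebesgue_on {a<..<b})" and g[measurable]: "g \<in> borel_measurable borel"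
    and eq: "AE s in lborel. s \<in> {a<..<b} \<longrightarrow> f s = g s"
  shows "integrable (lebesgue_on {a<..<b}) f \<longleftrightarrow> integrable lborel (\<lambda>s. indicator {a<..<b} s * g s)"
    and "integral\<^sup>L (lebesgue_on {a<..<b}) f = (\<integral>s. indicator {a<..<b} s * g s \<partial>lborel)"
proof -
  have f': "(\<lambda>s. indicator {a<..<b} s * f s) \<in> borel_measurable lebesgue"
    using f by (simp add: borel_measurable_restrict_space_iff)
  have g': "(\<lambda>s. indicator {a<..<b} s * g s) \<in> borel_measurable lborel" by measurable
  then have g'': "(\<lambda>s. indicator {a<..<b} s * g s) \<in> borel_measurable lebesgue"
    by (rule measurable_completion)
  have AE: "AE s in lebesgue. indicator {a<..<b} s * f s = indicator {a<..<b} s * g s"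
    by (rule AE_completion) (use eq in \<open>auto elim!: eventually_mono simp: indicator_def\<close>)
  show "integrable (lebesgue_on {a<..<b}) f \<longleftrightarrow> integrable lborel (\<lambda>s. indicator {a<..<b} s * g s)"
    using integrable_cong_AE[OF f' g'' AE] by (simp add: integrable_restrict_space integrable_completion)
  show "integral\<^sup>L (lebesgue_on {a<..<b}) f = (\<integral>s. indicator {a<..<b} s * g s \<partial>lborel)"
    using integral_cong_AE[OF f' g'' AE] by (simp add: integral_restrict_space integral_completion)
qed

text \<open>A Borel version keeps products such as k (s - r) * v r measurable in both variables, and
  extension by zero lets convolutions and pairings with test functions run over the whole
  line.\<close>

definition borel_rep :: "real \<Rightarrow> (real \<Rightarrow> real) \<Rightarrow> (real \<Rightarrow> real) \<Rightarrow> bool" where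
  "borel_rep T f f0 \<longleftrightarrow> f \<in> borel_measurable (lebesgue_on {0<..<T}) \<and> integrable lborel f0 \<and>
     (\<forall>s. s \<notin> {0<..<T} \<longrightarrow> f0 s = 0) \<and> (AE s in lborel. s \<in> {0<..<T} \<longrightarrow> f s = f0 s)"

lemma ex_borel_rep:
  assumes "integrable (lebesgue_on {0<..<T}) f"
  shows "\<exists>f0. borel_rep T f f0"
proof -
  have m: "f \<in> borel_measurable (lebesgue_on {0<..<T})" using assms by auto
  then have "(\<lambda>s. indicator {0<..<T} s * f s) \<in> borel_measurable lebesgue"
    by (simp add: borel_measurable_restrict_space_iff)
  then obtain g where g[measurable]: "g \<in> borel_measurable borel" and eq: "AE s in lborel. indicator {0<..<T} s * f s = g s"
    using completion_ex_borel_measurable_real by force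
  have eq': "AE s in lborel. s \<in> {0<..<T} \<longrightarrow> f s = g s"
    using eq by eventually_elim auto
  have "borel_rep T f (\<lambda>s. indicator {0<..<T} s * g s)"
    unfolding borel_rep_def
  proof (intro conjI)
    show "integrable lborel (\<lambda>s. indicator {0<..<T} s * g s)"
      using lebesgue_on_Ioo_eq_lborel(1)[OF m g eq'] assms by simp
  qed (use m eq' in \<open>auto elim!: eventually_mono\<close>)
  then show ?thesis by blast
qed

lemma borel_repD:
  assumes "borel_rep T f f0"
  shows "f \<in> borel_measurable (lebesgue_on {0<..<T})" "integrable lborel f0" "f0 \<in> borel_measurable borel"
    "\<And>s. s \<notin> {0<..<T} \<Longrightarrow> f0 s = 0" "AE s in lborel. s \<in> {0<..<T} \<longrightarrow> f s = f0 s"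
  using assms by (auto simp: borel_rep_def)

lemma borel_rep_integral:
  assumes f: "borel_rep T f f0" and h[measurable]: "h \<in> borel_measurable borel"
  shows "(\<integral>s. f s * h s \<partial>lebesgue_on {0<..<T}) = (\<integral>s. f0 s * h s \<partial>lborel)"
proof -
  note [measurable] = borel_repD(1,3)[OF f]
  have "h \<in> borel_measurable (lebesgue_on {0<..<T})"
    by (intro measurable_restrict_space1 measurable_completion) simp
  then have "(\<integral>s. f s * h s \<partial>lebesgue_on {0<..<T}) = (\<integral>s. indicator {0<..<T} s * (f0 s * h s) \<partial>lborel)"
    by (intro lebesgue_on_Ioo_eq_lborel) (use borel_repD(5)[OF f] in \<open>auto elim!: eventually_mono\<close>)
  also have "\<dots> = (\<integral>s. f0 s * h s \<partial>lborel)"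
    by (rule Bochner_Integration.integral_cong) (use borel_repD(4)[OF f] in \<open>auto simp: indicator_def\<close>)
  finally show ?thesis .
qed

lemma test_funD:
  assumes "test_fun T \<phi> \<phi>'"
  shows "continuous_on A \<phi>" "continuous_on A \<phi>'" "\<phi> \<in> borel_measurable borel" "\<phi>' \<in> borel_measurable borel"
    "s \<notin> {0<..<T} \<Longrightarrow> \<phi> s = 0" "s \<notin> {0<..<T} \<Longrightarrow> \<phi>' s = 0"
    "\<exists>C. \<forall>s. \<bar>\<phi> s\<bar> \<le> C" "\<exists>C. \<forall>s. \<bar>\<phi>' s\<bar> \<le> C"
    "integrable lborel \<phi>" "integrable lborel \<phi>'" 
proof -
  from assms obtain a b where d: "\<And>t. (\<phi> has_real_derivative \<phi>' t) (at t)" and c: "continuous_on UNIV \<phi>'"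
    and ab: "0 < a" "b < T" "\<And>t. t \<notin> {a..b} \<Longrightarrow> \<phi> t = 0" by (auto simp: test_fun_def)
  have c': "continuous_on UNIV \<phi>" using d by (meson DERIV_isCont continuous_at_imp_continuous_on)
  show "continuous_on A \<phi>" "continuous_on A \<phi>'" using c c' continuous_on_subset by blast+
  show m: "\<phi> \<in> borel_measurable borel" "\<phi>' \<in> borel_measurable borel"
    using c c' by (auto intro: borel_measurable_continuous_onI)
  \<comment> \<open>Outside the closed interval [a,b] the function \<phi> vanishes in a
    neighbourhood, so its derivative vanishes as well.\<close>
  have z: "\<phi>' s = 0" if "s \<notin> {a..b}" for s
  proof -
    have "((\<lambda>_. 0) has_real_derivative \<phi>' s) (at s)"
      by (rule has_field_derivative_transform_within_open[OF d, where S = "- {a..b}"])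
         (use ab that in auto)
    then show ?thesis using DERIV_unique DERIV_const by blast
  qed
  show "s \<notin> {0<..<T} \<Longrightarrow> \<phi> s = 0" "s \<notin> {0<..<T} \<Longrightarrow> \<phi>' s = 0" using ab z by auto
  have B: "(\<exists>C. \<forall>s. \<bar>f s\<bar> \<le> C) \<and> integrable lborel f" if "continuous_on UNIV f" "\<And>s. s \<notin> {a..b} \<Longrightarrow> f s = 0" for f :: "real \<Rightarrow> real"
  proof
    have cf: "continuous_on {a..b} f" using that continuous_on_subset by blast
    then have "bounded (f ` {a..b})" by (intro compact_imp_bounded compact_continuous_image) auto
    then obtain C where "\<forall>s\<in>{a..b}. \<bar>f s\<bar> \<le> C" unfolding bounded_iff by auto
    then have "\<bar>f s\<bar> \<le> max C 0" for s using that(2)[of s] by (cases "s \<in> {a..b}") force+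
    then show "\<exists>C. \<forall>s. \<bar>f s\<bar> \<le> C" by blast
    have "indicator {a..b} s * f s = f s" for s using that(2)[of s] by (cases "s \<in> {a..b}") auto
    then have "(\<lambda>s. indicator {a..b} s *\<^sub>R f s) = f" by (simp only: real_scaleR_def)
    then show "integrable lborel f"
      using borel_integrable_atLeastAtMost'[OF cf] by (simp only: set_integrable_def)
  qed
  show "\<exists>C. \<forall>s. \<bar>\<phi> s\<bar> \<le> C" "\<exists>C. \<forall>s. \<bar>\<phi>' s\<bar> \<le> C" "integrable lborel \<phi>" "integrable lborel \<phi>'"
    using B[OF c' ab(3)] B[OF c z] by auto
qed

lemma integrable_mult_bounded:
  fixes f h :: "'a \<Rightarrow> real"
  assumes "integrable M f" "h \<in> borel_measurable M" "\<exists>C. \<forall>s. \<bar>h s\<bar> \<le> C"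
  shows "integrable M (\<lambda>s. f s * h s)"
proof -
  obtain C where C: "\<And>s. \<bar>h s\<bar> \<le> C" using assms by blast
  show ?thesis
    by (rule Bochner_Integration.integrable_bound[OF integrable_mult_right[OF assms(1), of C]])
       (use assms C in \<open>auto simp: abs_mult mult.commute[of "\<bar>f _\<bar>"] intro!: mult_right_mono order_trans[OF C]\<close>)
qed

text \<open>Fubini on the triangle 0 < r < s, then the fundamental theorem for \<phi>' on [r,T],
  where \<phi> T = 0. In this way q only has to be integrable.\<close>

lemma integral_parts_test_fun:
  fixes q :: "real \<Rightarrow> real"
  assumes q: "integrable lborel q" "\<And>s. s \<notin> {0<..<T} \<Longrightarrow> q s = 0" and \<phi>: "test_fun T \<phi> \<phi>'"
  shows "(\<integral>s. (\<integral>r. indicator {0<..<s} r * q r \<partial>lborel) * \<phi>' s \<partial>lborel) = - (\<integral>s. q s * \<phi> s \<partial>lborel)"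
proof -
  note [measurable] = test_funD(3,4)[OF \<phi>]
  have [measurable]: "q \<in> borel_measurable borel" using q by auto
  have "integrable (lborel \<Otimes>\<^sub>M lborel) (\<lambda>(s, r). \<phi>' s * q r)"
    by (rule lborel_pair.Fubini_integrable) (use q test_funD(10)[OF \<phi>] in \<open>auto simp: abs_mult\<close>)
  then have "integrable (lborel \<Otimes>\<^sub>M lborel) (\<lambda>(s, r). indicator {0<..<s} r * q r * \<phi>' s)"
  proof (rule Bochner_Integration.integrable_bound)
    show "(\<lambda>(s, r). indicator {0<..<s} r * q r * \<phi>' s) \<in> borel_measurable (lborel \<Otimes>\<^sub>M lborel)"
      unfolding split_beta' indicator_def of_bool_def greaterThanLessThan_iff by measurable
  qed (auto intro!: AE_I2 simp: indicator_def of_bool_def abs_mult)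
  from lborel_pair.Fubini_integral[OF this]
  have "(\<integral>s. (\<integral>r. indicator {0<..<s} r * q r \<partial>lborel) * \<phi>' s \<partial>lborel)
      = (\<integral>r. \<integral>s. indicator {0<..<s} r * q r * \<phi>' s \<partial>lborel \<partial>lborel)"
    by simp
  also have "\<dots> = (\<integral>r. - (q r * \<phi> r) \<partial>lborel)"
  proof (rule Bochner_Integration.integral_cong)
    fix r
    show "(\<integral>s. indicator {0<..<s} r * q r * \<phi>' s \<partial>lborel) = - (q r * \<phi> r)"
    proof (cases "r \<in> {0<..<T}")
      case r: True
      have "(\<integral>s. indicator {0<..<s} r * q r * \<phi>' s \<partial>lborel) = (\<integral>s. q r * (indicator {r..T} s *\<^sub>R \<phi>' s) \<partial>lborel)"
      proof (rule integral_cong_AE)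
        show "AE s in lborel. indicator {0<..<s} r * q r * \<phi>' s = q r * (indicator {r..T} s *\<^sub>R \<phi>' s)"
          using AE_lborel_singleton[of r]
        proof eventually_elim
          case (elim s)
          then show ?case using r test_funD(6)[OF \<phi>, of s] by (cases "s < T") (auto simp: indicator_def)
        qed
        show "(\<lambda>s. indicator {0<..<s} r * q r * \<phi>' s) \<in> borel_measurable lborel"
          unfolding indicator_def of_bool_def greaterThanLessThan_iff by measurable
      qed measurable
      also have "\<dots> = q r * (\<integral>s. indicator {r..T} s *\<^sub>R \<phi>' s \<partial>lborel)"
        by (rule integral_mult_right_zero)
      also have "(\<integral>s. indicator {r..T} s *\<^sub>R \<phi>' s \<partial>lborel) = \<phi> T - \<phi> r"
        by (rule integral_FTC_atLeastAtMost)
           (use r \<phi> test_funD(2)[OF \<phi>] in \<open>auto simp: test_fun_def has_real_derivative_iff_has_vector_derivative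
              intro: has_vector_derivative_at_within\<close>)
      finally show ?thesis using test_funD(5)[OF \<phi>, of T] by simp
    qed (simp add: q)
  qed simp
  finally show ?thesis by simp
qed

section \<open>Test functions, the fundamental lemma and the du Bois-Reymond lemma\<close>

lemma has_real_derivative_max_0_square:
  "((\<lambda>x::real. (max 0 x)\<^sup>2) has_real_derivative 2 * max 0 x) (at x)"
proof (cases x "0::real" rule: linorder_cases)
  case less
  have "((\<lambda>x::real. 0) has_real_derivative 0) (at x)" by simp
  then show ?thesis
    by (rule has_field_derivative_transform_within_open[where S="{..<0}", THEN DERIV_cong]) (use less in auto)
next
  case greater
  have "((\<lambda>x::real. x\<^sup>2) has_real_derivative 2 * x) (at x)" by (auto intro!: derivative_eq_intros)
  then show ?thesis
    by (rule has_field_derivative_transform_within_open[where S="{0<..}", THEN DERIV_cong]) (use greater in auto)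
next
  case equal
  have "((\<lambda>h::real. (max 0 h)\<^sup>2 / h) \<longlongrightarrow> 0) (at 0)"
  proof (rule Lim_null_comparison)
    show "\<forall>\<^sub>F h in at 0. norm ((max 0 h)\<^sup>2 / h) \<le> \<bar>h :: real\<bar>"
      by (rule always_eventually) (auto simp: max_def power2_eq_square)
    show "((\<lambda>h::real. \<bar>h\<bar>) \<longlongrightarrow> 0) (at 0)" by (intro tendsto_eq_intros) auto
  qed
  then show ?thesis by (simp add: DERIV_def equal)
qed

text \<open>A rational cutoff: test functions need only be C^1, so the squared positive part, which
  has no kink at 0, is regular enough. The quotient stays below 1 and tends to 1 at
  infinity.\<close>

definition bump :: "real \<Rightarrow> real" where
  "bump x = (max 0 x)\<^sup>2 / (1 + (max 0 x)\<^sup>2)"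

lemma bump_bounds: "0 \<le> bump x" "bump x \<le> 1" "x \<le> 0 \<Longrightarrow> bump x = 0"
  by (auto simp: bump_def add_pos_nonneg)

lemma bump_deriv: "(bump has_real_derivative 2 * max 0 x / (1 + (max 0 x)\<^sup>2)\<^sup>2) (at x)"
proof -
  have "1 + (max 0 x)\<^sup>2 \<noteq> 0" by (smt (verit) zero_le_power2)
  then have "((\<lambda>y. y / (1 + y)) has_real_derivative 1 / (1 + (max 0 x)\<^sup>2)\<^sup>2) (at ((max 0 x)\<^sup>2))"
    by (auto intro!: derivative_eq_intros simp: power2_eq_square)
  from DERIV_chain2[OF this has_real_derivative_max_0_square] show ?thesis
    by (simp add: bump_def[abs_def])
qed

text \<open>The shift by -1 moves the ends of the support to \<open>c + 1 / n\<close> and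
  \<open>T - 1 / n\<close>, strictly inside (0,T) even for c = 0. As n grows, the product tends to
  the indicator of (c,T).\<close>

lemma test_fun_bump:
  assumes "0 \<le> c" "0 < n"
  shows "\<exists>\<psi>'. test_fun T (\<lambda>s. bump (n * (s - c) - 1) * bump (n * (T - s) - 1)) \<psi>'"
proof -
  define D where "D = (\<lambda>x::real. 2 * max 0 x / (1 + (max 0 x)\<^sup>2)\<^sup>2)"
  have nz: "1 + (max 0 x)\<^sup>2 \<noteq> 0" for x :: real by (smt (verit) zero_le_power2)
  have bc: "continuous_on UNIV bump"
    using bump_deriv by (meson DERIV_isCont continuous_at_imp_continuous_on)
  have Dc: "continuous_on UNIV D"
    unfolding D_def by (intro continuous_intros) (use nz in auto)
  have bD: "(bump has_real_derivative D x) (at x)" for x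
    using bump_deriv by (simp add: D_def)
  let ?a = "\<lambda>s. n * (s - c) - 1" and ?b = "\<lambda>s. n * (T - s) - 1"
  have a: "((\<lambda>s. bump (?a s)) has_real_derivative D (?a s) * n) (at s)" for s
    by (rule DERIV_chain2[OF bD]) (auto intro!: derivative_eq_intros)
  have b: "((\<lambda>s. bump (?b s)) has_real_derivative D (?b s) * (- n)) (at s)" for s
    by (rule DERIV_chain2[OF bD]) (auto intro!: derivative_eq_intros)
  have "test_fun T (\<lambda>s. bump (?a s) * bump (?b s)) (\<lambda>s. D (?a s) * n * bump (?b s) + D (?b s) * (- n) * bump (?a s))"
    unfolding test_fun_def
  proof (intro conjI allI)
    show "((\<lambda>s. bump (?a s) * bump (?b s)) has_real_derivative
        D (?a s) * n * bump (?b s) + D (?b s) * (- n) * bump (?a s)) (at s)" for s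
      by (rule DERIV_mult[OF a b])
    show "continuous_on UNIV (\<lambda>s. D (?a s) * n * bump (?b s) + D (?b s) * (- n) * bump (?a s))"
      by (intro continuous_intros continuous_on_compose2[OF bc] continuous_on_compose2[OF Dc]) auto
    have "bump (?a s) * bump (?b s) = 0" if "s \<notin> {c + 1 / n..T - 1 / n}" for s
    proof -
      have "?a s \<le> 0 \<or> ?b s \<le> 0" using that assms by (auto simp: field_simps)
      then show ?thesis using bump_bounds(3) by auto
    qed
    then show "\<exists>a b. 0 < a \<and> b < T \<and> (\<forall>s. s \<notin> {a..b} \<longrightarrow> bump (?a s) * bump (?b s) = 0)"
      using assms by (intro exI[of _ "c + 1 / n"] exI[of _ "T - 1 / n"]) (auto intro: add_nonneg_pos)
  qed
  then show ?thesis by blast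
qed

text \<open>The positive and negative parts of q are densities of two finite measures that agree on
  half-lines, hence everywhere; densities are unique almost everywhere.\<close>

lemma AE_eq_0_if_halfline_integrals:
  fixes q :: "real \<Rightarrow> real"
  assumes q: "integrable lborel q" and zero: "\<And>x. (\<integral>s. q s * indicator {x<..} s \<partial>lborel) = 0"
  shows "AE s in lborel. q s = 0"
proof -
  have [measurable]: "q \<in> borel_measurable borel" using q by auto
  define p where "p = (\<lambda>s. max 0 (q s))"
  define m where "m = (\<lambda>s. max 0 (- q s))"
  have pm[measurable]: "p \<in> borel_measurable borel" "m \<in> borel_measurable borel"
    unfolding p_def m_def by measurable
  have int: "integrable lborel p" "integrable lborel m" using q by (auto simp: p_def m_def)
  have e: "emeasure (density lborel f) {x<..} = ennreal (\<integral>s. f s * indicator {x<..} s \<partial>lborel)"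
    if f: "integrable lborel f" "\<And>s. f s \<ge> 0" for f :: "real \<Rightarrow> real" and x
  proof -
    have "(\<integral>\<^sup>+s. ennreal (f s * indicator {x<..} s) \<partial>lborel) = ennreal (\<integral>s. f s * indicator {x<..} s \<partial>lborel)"
      by (rule nn_integral_eq_integral) (use f in \<open>auto intro!: integrable_real_mult_indicator\<close>)
    then show ?thesis using f by (simp add: emeasure_density ennreal_mult' ennreal_indicator)
  qed
  have eq: "(\<integral>s. p s * indicator {x<..} s \<partial>lborel) = (\<integral>s. m s * indicator {x<..} s \<partial>lborel)" for x
  proof -
    have "(\<integral>s. p s * indicator {x<..} s \<partial>lborel) - (\<integral>s. m s * indicator {x<..} s \<partial>lborel)
       = (\<integral>s. p s * indicator {x<..} s - m s * indicator {x<..} s \<partial>lborel)"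
      by (rule Bochner_Integration.integral_diff[symmetric]) (use int in \<open>auto intro!: integrable_real_mult_indicator\<close>)
    also have "\<dots> = (\<integral>s. q s * indicator {x<..} s \<partial>lborel)"
      by (rule Bochner_Integration.integral_cong) (auto simp: p_def m_def indicator_def)
    finally show ?thesis using zero by simp
  qed
  have "density lborel p = density lborel m"
    by (rule measure_eqI_lessThan) (use eq e int in \<open>auto simp: p_def m_def\<close>)
  then have "AE s in lborel. ennreal (p s) = ennreal (m s)"
    by (subst (asm) sigma_finite_measure.density_unique_iff[OF sigma_finite_lborel]) auto
  then show ?thesis by eventually_elim (auto simp: p_def m_def max_def split: if_splits)
qed

text \<open>Dominated convergence along cutoffs tending to the indicator of a half-line within (0,T)
  shows that all half-line integrals of q vanish.\<close>

lemma fundamental_lemma_variations: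
  fixes q :: "real \<Rightarrow> real"
  assumes q: "integrable lborel q" "\<And>s. s \<notin> {0<..<T} \<Longrightarrow> q s = 0"
    and zero: "\<And>\<psi> \<psi>'. test_fun T \<psi> \<psi>' \<Longrightarrow> (\<integral>s. q s * \<psi> s \<partial>lborel) = 0"
  shows "AE s in lborel. q s = 0"
proof (rule AE_eq_0_if_halfline_integrals[OF q(1)])
  fix x :: real
  have [measurable]: "q \<in> borel_measurable borel" using q by auto
  have [measurable]: "bump \<in> borel_measurable borel" unfolding bump_def[abs_def] by measurable
  \<comment> \<open>For negative x the cutoff starts at 0 to stay inside (0,T); q vanishes to the
    left of 0, so nothing is lost.\<close>
  define c where "c = max x 0"
  define \<psi> where "\<psi> = (\<lambda>(n::nat) s. bump (real n * (s - c) - 1) * bump (real n * (T - s) - 1))"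
  have lim1: "(\<lambda>n. bump (real n * a - 1)) \<longlonglongrightarrow> (if 0 < a then 1 else 0)" for a :: real
  proof (cases "0 < a")
    case True
    have "((\<lambda>x::real. x\<^sup>2 / (1 + x\<^sup>2)) \<longlongrightarrow> 1) at_top" by real_asymp
    moreover have "filterlim (\<lambda>n. real n * a - 1) at_top sequentially" using True by real_asymp
    ultimately have "(\<lambda>n. (real n * a - 1)\<^sup>2 / (1 + (real n * a - 1)\<^sup>2)) \<longlonglongrightarrow> 1"
      by (rule filterlim_compose)
    moreover have "\<forall>\<^sub>F n in sequentially. real n * a - 1 \<ge> 0"
      using True by real_asymp
    then have "\<forall>\<^sub>F n in sequentially. (real n * a - 1)\<^sup>2 / (1 + (real n * a - 1)\<^sup>2) = bump (real n * a - 1)"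
      by eventually_elim (auto simp: bump_def)
    ultimately show ?thesis using True by (simp add: tendsto_cong)
  next
    case False
    then have "bump (real n * a - 1) = 0" for n
      by (intro bump_bounds(3)) (smt (verit) mult_nonneg_nonpos of_nat_0_le_iff)
    then show ?thesis using False by simp
  qed
  have "(\<lambda>n. \<integral>s. q s * \<psi> n s \<partial>lborel) \<longlonglongrightarrow> (\<integral>s. q s * indicator {x<..} s \<partial>lborel)"
  proof (rule integral_dominated_convergence[where w="\<lambda>s. norm (q s)"])
    show "AE s in lborel. (\<lambda>n. q s * \<psi> n s) \<longlonglongrightarrow> q s * indicator {x<..} s"
    proof (rule AE_I2)
      fix s
      show "(\<lambda>n. q s * \<psi> n s) \<longlonglongrightarrow> q s * indicator {x<..} s"
      proof (cases "s \<in> {0<..<T}")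
        case True
        have "(\<lambda>n. q s * \<psi> n s) \<longlonglongrightarrow> q s * ((if 0 < s - c then 1 else 0) * (if 0 < T - s then 1 else 0))"
          unfolding \<psi>_def by (intro tendsto_intros lim1)
        also have "q s * ((if 0 < s - c then 1 else 0) * (if 0 < T - s then 1 else 0)) = q s * indicator {x<..} s"
          using True by (auto simp: c_def indicator_def)
        finally show ?thesis .
      qed (simp add: q)
    qed
    show "AE s in lborel. norm (q s * \<psi> n s) \<le> norm (q s)" for n
      using bump_bounds by (auto simp: \<psi>_def abs_mult intro!: mult_left_le mult_le_one)
  qed (use q in \<open>auto simp: \<psi>_def\<close>)
  moreover have "\<forall>\<^sub>F n in sequentially. (\<integral>s. q s * \<psi> n s \<partial>lborel) = 0"
    using eventually_gt_at_top[of 0]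
  proof eventually_elim
    case (elim n)
    then obtain \<psi>' where "test_fun T (\<psi> n) \<psi>'"
      using test_fun_bump[of c "real n" T] by (auto simp: \<psi>_def c_def)
    then show ?case by (rule zero)
  qed
  then have "(\<lambda>n. \<integral>s. q s * \<psi> n s \<partial>lborel) \<longlonglongrightarrow> 0" by (rule tendsto_eventually)
  ultimately show "(\<integral>s. q s * indicator {x<..} s \<partial>lborel) = 0"
    by (rule LIMSEQ_unique)
qed

text \<open>Du Bois-Reymond: after subtracting a multiple of a fixed \<psi>0 of nonzero mean, any
  test function has mean zero and is itself the derivative of a test function. So q pairs with
  \<psi> as a constant does, and the fundamental lemma applies.\<close>

lemma weak_deriv_const:
  fixes q :: "real \<Rightarrow> real"
  assumes T: "0 < T" and q: "integrable lborel q" "\<And>s. s \<notin> {0<..<T} \<Longrightarrow> q s = 0"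
    and zero: "\<And>\<phi> \<phi>'. test_fun T \<phi> \<phi>' \<Longrightarrow> (\<integral>s. q s * \<phi>' s \<partial>lborel) = 0"
  shows "\<exists>c. AE s in lborel. s \<in> {0<..<T} \<longrightarrow> q s = c"
proof -
  have [measurable]: "q \<in> borel_measurable borel" using q by auto
  have int: "integrable lborel (\<lambda>s. q s * \<psi> s)" if "test_fun T \<psi> \<psi>'" for \<psi> \<psi>'
    using integrable_mult_bounded[OF q(1), of \<psi>] test_funD[OF that] by auto
  \<comment> \<open>If every test function had mean zero, the fundamental lemma would make the
    indicator of (0,T) vanish almost everywhere.\<close>
  have "\<exists>\<psi> \<psi>'. test_fun T \<psi> \<psi>' \<and> (\<integral>s. \<psi> s \<partial>lborel) \<noteq> 0"
  proof (rule ccontr)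
    assume *: "\<not> ?thesis"
    have "AE s in lborel. indicat_real {0<..<T} s = 0"
    proof (rule fundamental_lemma_variations[of _ T])
      fix \<psi> \<psi>' assume \<psi>: "test_fun T \<psi> \<psi>'"
      have "indicator {0<..<T} s * \<psi> s = \<psi> s" for s using test_funD(5)[OF \<psi>, of s] by (cases "s \<in> {0<..<T}") auto
      then have "(\<lambda>s. indicator {0<..<T} s * \<psi> s) = \<psi>" by (simp only:)
      then show "(\<integral>s. indicator {0<..<T} s * \<psi> s \<partial>lborel) = 0" using * \<psi> by metis
    next
      show "integrable lborel (indicat_real {0<..<T})" by (rule integrable_real_indicator) (use T in auto)
    qed auto
    then have "AE s in lborel. s \<notin> {0<..<T}" by eventually_elim (auto simp: indicator_def split: if_splits)
    then have "emeasure lborel {0<..<T} = 0" by (subst (asm) AE_iff_measurable[of "{0<..<T}"]) auto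
    then show False using T by simp
  qed
  then obtain \<psi>0 \<psi>0' where \<psi>0: "test_fun T \<psi>0 \<psi>0'" and I0: "(\<integral>s. \<psi>0 s \<partial>lborel) \<noteq> 0" by blast
  define c where "c = (\<integral>s. q s * \<psi>0 s \<partial>lborel) / (\<integral>s. \<psi>0 s \<partial>lborel)"
  have "AE s in lborel. q s - c * indicator {0<..<T} s = 0"
  proof (rule fundamental_lemma_variations[of _ T])
    have "integrable lborel (indicat_real {0<..<T})" by (rule integrable_real_indicator) (use T in auto)
    then show "integrable lborel (\<lambda>s. q s - c * indicator {0<..<T} s)" using q by auto
    show "q s - c * indicator {0<..<T} s = 0" if "s \<notin> {0<..<T}" for s using that q by auto
    fix \<psi> \<psi>' assume \<psi>: "test_fun T \<psi> \<psi>'"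
    define d where "d = (\<integral>s. \<psi> s \<partial>lborel) / (\<integral>s. \<psi>0 s \<partial>lborel)"
    define \<phi>' where "\<phi>' = (\<lambda>s. \<psi> s - d * \<psi>0 s)"
    have cont: "continuous_on A \<phi>'" for A
      unfolding \<phi>'_def by (intro continuous_intros test_funD(1)[OF \<psi>] test_funD(1)[OF \<psi>0])
    have int\<phi>': "integrable lborel \<phi>'" "(\<integral>s. \<phi>' s \<partial>lborel) = 0"
      using test_funD(9)[OF \<psi>] test_funD(9)[OF \<psi>0] I0 by (auto simp: \<phi>'_def d_def)
    obtain F where F: "\<And>s. (F has_vector_derivative \<phi>' s) (at s)"
      using einterval_antiderivative[of "-\<infinity>" "\<infinity>" \<phi>'] cont[of UNIV] by (auto simp: continuous_on_eq_continuous_at)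
    define \<phi> where "\<phi> = (\<lambda>s. F s - F 0)"
    have \<phi>d: "(\<phi> has_real_derivative \<phi>' s) (at s)" for s
      unfolding \<phi>_def using F[of s] by (auto intro!: derivative_eq_intros simp: has_real_derivative_iff_has_vector_derivative)
    obtain a b where ab: "0 < a" "b < T" "\<And>s. s \<notin> {a..b} \<Longrightarrow> \<psi> s = 0" using \<psi> by (auto simp: test_fun_def)
    obtain a0 b0 where ab0: "0 < a0" "b0 < T" "\<And>s. s \<notin> {a0..b0} \<Longrightarrow> \<psi>0 s = 0" using \<psi>0 by (auto simp: test_fun_def)
    \<comment> \<open>\<open>test_fun\<close> does not force a \<le> b, so the common support bounds
      are clamped; 0 \<le> B lets the integral below start at 0 when s lies beyond B.\<close>
    define A B where "A = min a (min a0 T)" and "B = max b (max b0 0)"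
    have AB: "0 < A" "B < T" "A \<le> T" "0 \<le> B"
      using T ab ab0 by (auto simp: A_def B_def)
    have AB0: "\<phi>' s = 0" if "s \<notin> {A..B}" for s
    proof -
      have "s \<notin> {a..b}" "s \<notin> {a0..b0}" using that by (auto simp: A_def B_def)
      then show ?thesis using ab(3) ab0(3) by (simp add: \<phi>'_def)
    qed
    have ftc: "(\<integral>s. indicator {x..y} s *\<^sub>R \<phi>' s \<partial>lborel) = \<phi> y - \<phi> x" if "x \<le> y" for x y
      by (rule integral_FTC_atLeastAtMost)
         (use that \<phi>d cont in \<open>auto simp: has_real_derivative_iff_has_vector_derivative intro: has_vector_derivative_at_within\<close>)
    have \<phi>0: "\<phi> s = 0" if "s \<notin> {A..B}" for s
    proof (cases "s < A")
      case True
      have "\<phi> 0 = 0" by (simp add: \<phi>_def)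
      have z: "\<phi> y = \<phi> x" if "x \<le> y" "y < A" for x y
      proof -
        have "(\<integral>r. indicator {x..y} r *\<^sub>R \<phi>' r \<partial>lborel) = (\<integral>r. 0 \<partial>(lborel :: real measure))"
          by (rule Bochner_Integration.integral_cong) (use that AB0 in \<open>auto simp: indicator_def\<close>)
        then show ?thesis using ftc[OF that(1)] by simp
      qed
      show ?thesis using z[of 0 s] z[of s 0] True AB(1) \<open>\<phi> 0 = 0\<close> by (cases "0 \<le> s") auto
    next
      case False
      then have s: "B < s" "A \<le> s" using that by auto
      have "(\<integral>r. indicator {0..s} r *\<^sub>R \<phi>' r \<partial>lborel) = (\<integral>r. \<phi>' r \<partial>lborel)"
      proof (rule Bochner_Integration.integral_cong)
        fix r show "indicator {0..s} r *\<^sub>R \<phi>' r = \<phi>' r"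
          using s AB(1) AB0[of r] by (cases "r \<in> {A..B}") auto
      qed simp
      then show ?thesis using ftc[of 0 s] s AB int\<phi>' by (simp add: \<phi>_def)
    qed
    have "test_fun T \<phi> \<phi>'" unfolding test_fun_def using \<phi>d cont[of UNIV] AB \<phi>0 by blast
    from zero[OF this] have "(\<integral>s. q s * \<psi> s - d * (q s * \<psi>0 s) \<partial>lborel) = 0"
      by (simp add: \<phi>'_def algebra_simps)
    then have "(\<integral>s. q s * \<psi> s \<partial>lborel) = d * (\<integral>s. q s * \<psi>0 s \<partial>lborel)"
      using int[OF \<psi>] int[OF \<psi>0] by simp
    also have "\<dots> = c * (\<integral>s. \<psi> s \<partial>lborel)" by (simp add: c_def d_def)
    finally have *: "(\<integral>s. q s * \<psi> s \<partial>lborel) = c * (\<integral>s. \<psi> s \<partial>lborel)" .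
    have "(q s - c * indicator {0<..<T} s) * \<psi> s = q s * \<psi> s - c * \<psi> s" for s
      using test_funD(5)[OF \<psi>, of s] by (cases "s \<in> {0<..<T}") (auto simp: algebra_simps)
    then show "(\<integral>s. (q s - c * indicator {0<..<T} s) * \<psi> s \<partial>lborel) = 0"
      using int[OF \<psi>] test_funD(9)[OF \<psi>] * by simp
  qed
  then have "AE s in lborel. s \<in> {0<..<T} \<longrightarrow> q s = c" by eventually_elim auto
  then show ?thesis by blast
qed


lemma continuous_on_integral_Ioo:
  fixes q :: "real \<Rightarrow> real"
  assumes q: "integrable lborel q"
  shows "continuous_on A (\<lambda>t. \<integral>s. indicator {0<..<t} s * q s \<partial>lborel)"
proof -
  have [measurable]: "q \<in> borel_measurable borel" using q by auto
  have "continuous (at t) (\<lambda>t. \<integral>s. indicator {0<..<t} s * q s \<partial>lborel)" for t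
    unfolding continuous_at_sequentially comp_def
  proof (intro allI impI)
    fix X assume X: "X \<longlonglongrightarrow> t"
    show "(\<lambda>n. \<integral>s. indicator {0<..<X n} s * q s \<partial>lborel) \<longlonglongrightarrow> (\<integral>s. indicator {0<..<t} s * q s \<partial>lborel)"
    proof (rule integral_dominated_convergence[where w="\<lambda>s. norm (q s)"])
      show "AE s in lborel. (\<lambda>n. indicator {0<..<X n} s * q s) \<longlonglongrightarrow> indicator {0<..<t} s * q s"
        using AE_lborel_singleton[of t]
      proof eventually_elim
        case (elim s)
        have "\<forall>\<^sub>F n in sequentially. indicator {0<..<X n} s * q s = indicator {0<..<t} s * q s"
        proof (cases "s < t")
          case True
          from order_tendstoD(1)[OF X this] show ?thesis
            by eventually_elim (use True in \<open>auto simp: indicator_def\<close>)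
        next
          case False
          with elim have "t < s" by simp
          from order_tendstoD(2)[OF X this] show ?thesis
            by eventually_elim (use False in \<open>auto simp: indicator_def\<close>)
        qed
        then show ?case by (rule tendsto_eventually)
      qed
    qed (use q in \<open>auto simp: indicator_def\<close>)
  qed
  then show ?thesis by (auto intro: continuous_at_imp_continuous_on)
qed

text \<open>The part of (0,T) where f differs from c is open and negligible, hence empty; continuity
  then reaches the end points.\<close>

lemma continuous_AE_eq_on_Icc:
  fixes f :: "real \<Rightarrow> real"
  assumes "0 < T" and f: "continuous_on {0..T} f" and ae: "AE s in lborel. s \<in> {0<..<T} \<longrightarrow> f s = c"
    and t: "t \<in> {0..T}"
  shows "f t = c"
proof -
  have "f s = c" if s: "s \<in> {0<..<T}" for s
  proof (rule ccontr)
    assume "f s \<noteq> c"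
    define S where "S = {0<..<T} \<inter> f -` (- {c})"
    have "open S" unfolding S_def
      by (rule continuous_open_preimage) (auto intro: continuous_on_subset[OF f])
    moreover have "s \<in> S" using s \<open>f s \<noteq> c\<close> by (simp add: S_def)
    moreover have "negligible S"
    proof -
      have "AE s in lebesgue. s \<notin> S"
        by (rule AE_completion) (use ae in \<open>eventually_elim, auto simp: S_def\<close>)
      moreover have "S \<in> sets lebesgue" using \<open>open S\<close> by auto
      ultimately show ?thesis
        by (simp add: negligible_iff_null_sets AE_iff_null_sets)
    qed
    ultimately show False using open_not_negligible by blast
  qed
  then show ?thesis
    using continuous_constant_on_closure[of "{0<..<T}" f c t] assms by auto
qed

text \<open>The difference of f and the primitive of its weak derivative has zero weak derivative,
  so it is constant almost everywhere. Continuity of f makes this hold everywhere, and t = 0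
  identifies the constant.\<close>

lemma weak_deriv_imp_integral:
  assumes T: "0 < T" and w: "has_weak_deriv T f f'" and f: "continuous_on {0..T} f"
    and rep: "borel_rep T f' f0'" and t: "t \<in> {0..T}"
  shows "f t = f 0 + (\<integral>s. indicator {0<..<t} s * f0' s \<partial>lborel)"
proof -
  define G where "G = (\<lambda>t. \<integral>s. indicator {0<..<t} s * f0' s \<partial>lborel)"
  note R = borel_repD[OF rep]
  have Gc: "continuous_on A G" for A
    unfolding G_def by (rule continuous_on_integral_Ioo[OF R(2)])
  have [measurable]: "G \<in> borel_measurable borel" using Gc borel_measurable_continuous_onI by blast
  obtain f0 where rf: "borel_rep T f f0" using w ex_borel_rep[of T f] by (auto simp: has_weak_deriv_def)
  note RF = borel_repD[OF rf]
  have iG: "integrable lborel (\<lambda>s. indicator {0<..<T} s * G s)"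
    by (rule Bochner_Integration.integrable_bound[OF borel_integrable_atLeastAtMost'[OF Gc, of 0 T, unfolded set_integrable_def]])
       (auto simp: indicator_def)
  have "\<exists>c. AE s in lborel. s \<in> {0<..<T} \<longrightarrow> f0 s - indicator {0<..<T} s * G s = c"
  proof (rule weak_deriv_const[OF T])
    show "integrable lborel (\<lambda>s. f0 s - indicator {0<..<T} s * G s)" using iG RF(2) by simp
    show "f0 s - indicator {0<..<T} s * G s = 0" if "s \<notin> {0<..<T}" for s using that RF(4) by simp
    fix \<phi> \<phi>' assume \<phi>: "test_fun T \<phi> \<phi>'"
    note P = test_funD[OF \<phi>]
    have "(\<integral>s. f0 s * \<phi>' s \<partial>lborel) = (\<integral>s. f s * \<phi>' s \<partial>lebesgue_on {0<..<T})"
      by (rule borel_rep_integral[OF rf P(4), symmetric])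
    also have "\<dots> = - (\<integral>s. f' s * \<phi> s \<partial>lebesgue_on {0<..<T})"
      using w \<phi> by (auto simp: has_weak_deriv_def)
    also have "(\<integral>s. f' s * \<phi> s \<partial>lebesgue_on {0<..<T}) = (\<integral>s. f0' s * \<phi> s \<partial>lborel)"
      by (rule borel_rep_integral[OF rep P(3)])
    also have "- \<dots> = (\<integral>s. G s * \<phi>' s \<partial>lborel)"
      unfolding G_def by (rule integral_parts_test_fun[symmetric, OF R(2,4) \<phi>])
    also have "\<dots> = (\<integral>s. (indicator {0<..<T} s * G s) * \<phi>' s \<partial>lborel)"
      by (rule Bochner_Integration.integral_cong) (use P(6) in \<open>auto simp: indicator_def\<close>)
    finally show "(\<integral>s. (f0 s - indicator {0<..<T} s * G s) * \<phi>' s \<partial>lborel) = 0"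
      using integrable_mult_bounded[OF RF(2) _ P(8)] integrable_mult_bounded[OF iG _ P(8)] P(4)
      by (simp add: left_diff_distrib)
  qed
  then obtain c where c: "AE s in lborel. s \<in> {0<..<T} \<longrightarrow> f0 s - indicator {0<..<T} s * G s = c" ..
  have "AE s in lborel. s \<in> {0<..<T} \<longrightarrow> f s - G s = c"
    using c RF(5) by eventually_elim auto
  then have *: "f t - G t = c" if "t \<in> {0..T}" for t
    by (intro continuous_AE_eq_on_Icc[OF T _ _ that]) (auto intro!: continuous_intros f Gc)
  have "G 0 = 0" by (simp add: G_def)
  with *[of 0] *[OF t] T show ?thesis by (simp add: G_def)
qed

text \<open>A primitive of q has weak derivative q, so the difference of f' and q pairs to zero with
  all test functions. It serves to read off the Riemann--Liouville derivative from an explicit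
  primitive.\<close>

lemma weak_deriv_unique:
  assumes q: "integrable lborel q" "\<And>s. s \<notin> {0<..<T} \<Longrightarrow> q s = 0"
    and f: "\<And>t. t \<in> {0<..<T} \<Longrightarrow> f t = (\<integral>s. indicator {0<..<t} s * q s \<partial>lborel)"
    and w: "has_weak_deriv T f f'" and rep: "borel_rep T f' f0'"
  shows "AE s in lborel. s \<in> {0<..<T} \<longrightarrow> f' s = q s"
proof -
  note R = borel_repD[OF rep]
  define G where "G = (\<lambda>t. \<integral>s. indicator {0<..<t} s * q s \<partial>lborel)"
  have [measurable]: "G \<in> borel_measurable borel"
    unfolding G_def using continuous_on_integral_Ioo[OF q(1)] borel_measurable_continuous_onI by blast
  have "AE s in lborel. f0' s - q s = 0"
  proof (rule fundamental_lemma_variations[of _ T])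
    show "integrable lborel (\<lambda>s. f0' s - q s)" using R q by simp
    show "f0' s - q s = 0" if "s \<notin> {0<..<T}" for s using that R q by simp
    fix \<phi> \<phi>' assume \<phi>: "test_fun T \<phi> \<phi>'"
    note P = test_funD[OF \<phi>]
    note [measurable] = P(3,4)
    have "(\<integral>s. f0' s * \<phi> s \<partial>lborel) = (\<integral>s. f' s * \<phi> s \<partial>lebesgue_on {0<..<T})"
      by (rule borel_rep_integral[OF rep P(3), symmetric])
    also have "\<dots> = - (\<integral>s. f s * \<phi>' s \<partial>lebesgue_on {0<..<T})"
      using w \<phi> by (auto simp: has_weak_deriv_def)
    also have "(\<integral>s. f s * \<phi>' s \<partial>lebesgue_on {0<..<T}) = (\<integral>s. G s * \<phi>' s \<partial>lebesgue_on {0<..<T})"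
      by (rule Bochner_Integration.integral_cong) (use f in \<open>auto simp: G_def\<close>)
    also have "\<dots> = (\<integral>s. indicator {0<..<T} s * (G s * \<phi>' s) \<partial>lborel)"
      by (rule lebesgue_on_Ioo_eq_lborel) (auto intro!: measurable_restrict_space1 measurable_completion)
    also have "\<dots> = (\<integral>s. G s * \<phi>' s \<partial>lborel)"
      by (rule Bochner_Integration.integral_cong) (use P(6) in \<open>auto simp: indicator_def\<close>)
    also have "- \<dots> = (\<integral>s. q s * \<phi> s \<partial>lborel)"
      unfolding G_def using integral_parts_test_fun[OF q \<phi>] by simp
    finally show "(\<integral>s. (f0' s - q s) * \<phi> s \<partial>lborel) = 0"
      using integrable_mult_bounded[OF R(2) _ P(7)] integrable_mult_bounded[OF q(1) _ P(7)] P(3)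
      by (simp add: left_diff_distrib)
  qed
  then show ?thesis using R(5) by eventually_elim auto
qed

text \<open>The integrated form of the rule that the Riemann--Liouville derivative of u is
  I^\<alpha> of u_t plus u(0) times the kernel. Fubini brings the fractional integral of the
  primitive of v to the form of an integral of v(r) K(t-r) with K the primitive of the kernel, and
  the integral of the convolution has the same form.\<close>

lemma frac_integral_eq_integral:
  assumes \<alpha>: "0 < \<alpha>" and v: "integrable lborel v" "\<And>s. s \<notin> {0<..<T} \<Longrightarrow> v s = 0"
    and u: "\<And>t. t \<in> {0..<T} \<Longrightarrow> u t = u0 + (\<integral>s. indicator {0<..<t} s * v s \<partial>lborel)" and t: "t \<in> {0<..<T}"
  shows "frac_integral \<alpha> u t = (\<integral>s. indicator {0<..<t} s * (convolution (trunc_kernel \<alpha> T) v s + u0 * trunc_kernel \<alpha> T s) \<partial>lborel)"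
proof -
  let ?k = "trunc_kernel \<alpha> T"
  have k: "integrable lborel ?k" using integrable_trunc_kernel \<alpha> t by simp
  have [measurable]: "v \<in> borel_measurable borel" "?k \<in> borel_measurable borel" using v k by auto
  have k0: "?k s = 0" if "s \<le> 0" for s using that by (simp add: trunc_kernel_def)
  define V where "V = (\<lambda>t. \<integral>s. indicator {0<..<t} s * v s \<partial>lborel)"
  have [measurable]: "V \<in> borel_measurable borel"
    unfolding V_def using continuous_on_integral_Ioo[OF v(1)] borel_measurable_continuous_onI by blast
  have kt: "integrable lborel (\<lambda>s. indicator {0<..<t} s * ?k (t - s))"
    "(\<integral>s. indicator {0<..<t} s * ?k (t - s) \<partial>lborel) = (\<integral>s. indicator {0<..<t} s * ?k s \<partial>lborel)"
  proof -
    have "integrable lborel (\<lambda>s. ?k (t - s))" using lborel_integrable_real_affine[OF k, of "-1" t] by simp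
    then show "integrable lborel (\<lambda>s. indicator {0<..<t} s * ?k (t - s))"
      by (intro integrable_mult_indicator[where 'b=real, simplified]) auto
    show "(\<integral>s. indicator {0<..<t} s * ?k (t - s) \<partial>lborel) = (\<integral>s. indicator {0<..<t} s * ?k s \<partial>lborel)"
      by (subst lborel_integral_real_affine[where c="-1" and t=t])
         (auto intro!: Bochner_Integration.integral_cong simp: indicator_def)
  qed
  have "frac_integral \<alpha> u t = (\<integral>s. ?k (t - s) * (u0 + V s) \<partial>lebesgue_on {0<..<t})"
    unfolding frac_integral_def
    by (rule Bochner_Integration.integral_cong) (use t in \<open>auto simp: V_def u trunc_kernel_def\<close>)
  also have "\<dots> = (\<integral>s. indicator {0<..<t} s * (?k (t - s) * (u0 + V s)) \<partial>lborel)"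
    by (rule lebesgue_on_Ioo_eq_lborel) (auto intro!: measurable_restrict_space1 measurable_completion)
  also have "\<dots> = (\<integral>s. indicator {0<..<t} s * ?k (t - s) * u0 + indicator {0<..<t} s * ?k (t - s) * V s \<partial>lborel)"
    by (simp add: algebra_simps)
  also have "\<dots> = (\<integral>s. indicator {0<..<t} s * ?k (t - s) * u0 \<partial>lborel) + (\<integral>s. indicator {0<..<t} s * ?k (t - s) * V s \<partial>lborel)"
  proof (rule Bochner_Integration.integral_add)
    have "\<bar>V s\<bar> \<le> (\<integral>r. \<bar>v r\<bar> \<partial>lborel)" for s
    proof -
      have "\<bar>V s\<bar> \<le> (\<integral>r. \<bar>indicator {0<..<s} r * v r\<bar> \<partial>lborel)"
        unfolding V_def by (rule integral_abs_bound)
      also have "\<dots> \<le> (\<integral>r. \<bar>v r\<bar> \<partial>lborel)"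
        by (rule integral_mono)
           (use v integrable_mult_indicator[of "{0<..<s}" lborel "\<lambda>r. \<bar>v r\<bar>"] in \<open>auto simp: abs_mult indicator_def\<close>)
      finally show ?thesis .
    qed
    then show "integrable lborel (\<lambda>s. indicator {0<..<t} s * ?k (t - s) * V s)"
      by (intro integrable_mult_bounded kt(1)) auto
  qed (use kt in auto)
  also have "(\<integral>s. indicator {0<..<t} s * ?k (t - s) * V s \<partial>lborel)
     = (\<integral>s. \<integral>r. indicator {0<..<t} s * ?k (t - s) * (indicator {0<..<s} r * v r) \<partial>lborel \<partial>lborel)"
    by (simp add: V_def)
  also have "\<dots> = (\<integral>r. \<integral>s. indicator {0<..<t} s * ?k (t - s) * (indicator {0<..<s} r * v r) \<partial>lborel \<partial>lborel)"
  proof (rule lborel_pair.Fubini_integral[symmetric])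
    have "integrable (lborel \<Otimes>\<^sub>M lborel) (\<lambda>(s, r). (indicator {0<..<t} s * ?k (t - s)) * v r)"
      by (rule lborel_pair.Fubini_integrable) (use kt v integrable_abs[OF kt(1)] in \<open>auto simp: abs_mult\<close>)
    then show "integrable (lborel \<Otimes>\<^sub>M lborel) (\<lambda>(s, r). indicator {0<..<t} s * ?k (t - s) * (indicator {0<..<s} r * v r))"
    proof (rule Bochner_Integration.integrable_bound)
      show "(\<lambda>(s, r). indicator {0<..<t} s * ?k (t - s) * (indicator {0<..<s} r * v r)) \<in> borel_measurable (lborel \<Otimes>\<^sub>M lborel)"
        unfolding split_beta' indicator_def of_bool_def greaterThanLessThan_iff by measurable
    qed (auto intro!: AE_I2 simp: indicator_def of_bool_def abs_mult)
  qed
  also have "\<dots> = (\<integral>r. v r * (\<integral>s. indicator {0<..<t - r} s * ?k s \<partial>lborel) \<partial>lborel)"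
  proof (rule Bochner_Integration.integral_cong)
    fix r
    have "(\<integral>s. indicator {0<..<t} s * ?k (t - s) * (indicator {0<..<s} r * v r) \<partial>lborel)
       = (\<integral>s. v r * (indicator {0<..<t} s * indicator {0<..<s} r * ?k (t - s)) \<partial>lborel)"
      by (rule Bochner_Integration.integral_cong) auto
    also have "\<dots> = v r * (\<integral>s. indicator {0<..<t} s * indicator {0<..<s} r * ?k (t - s) \<partial>lborel)"
      by (rule integral_mult_right_zero)
    also have "(\<integral>s. indicator {0<..<t} s * indicator {0<..<s} r * ?k (t - s) \<partial>lborel)
       = (\<integral>s. indicator {0<..<t} (t - s) * indicator {0<..<t - s} r * ?k s \<partial>lborel)"
      by (subst lborel_integral_real_affine[where c="-1" and t=t]) auto
    also have "v r * \<dots> = v r * (\<integral>s. indicator {0<..<t - r} s * ?k s \<partial>lborel)"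
    proof (cases "r \<in> {0<..<T}")
      case True
      have "(\<lambda>s. indicator {0<..<t} (t - s) * indicator {0<..<t - s} r * ?k s) = (\<lambda>s. indicator {0<..<t - r} s * ?k s)"
        using True by (auto simp: fun_eq_iff indicator_def)
      then show ?thesis by simp
    qed (simp add: v)
    finally show "(\<integral>s. indicator {0<..<t} s * ?k (t - s) * (indicator {0<..<s} r * v r) \<partial>lborel)
       = v r * (\<integral>s. indicator {0<..<t - r} s * ?k s \<partial>lborel)" .
  qed simp
  also have "\<dots> = (\<integral>s. indicator {0<..<t} s * convolution ?k v s \<partial>lborel)"
    by (rule integral_convolution_Ioo[symmetric]) (use k k0 v in auto)
  also have "(\<integral>s. indicator {0<..<t} s * ?k (t - s) * u0 \<partial>lborel) = (\<integral>s. indicator {0<..<t} s * (u0 * ?k s) \<partial>lborel)"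
    using kt(2) by (simp add: mult.left_commute)
  also have "(\<integral>s. indicator {0<..<t} s * (u0 * ?k s) \<partial>lborel) + (\<integral>s. indicator {0<..<t} s * convolution ?k v s \<partial>lborel)
    = (\<integral>s. indicator {0<..<t} s * (u0 * ?k s) + indicator {0<..<t} s * convolution ?k v s \<partial>lborel)"
    by (rule Bochner_Integration.integral_add[symmetric])
       (use k integrable_convolution[OF k v(1)] in \<open>auto intro!: integrable_mult_indicator[where 'b=real, simplified]\<close>)
  finally show ?thesis by (simp add: algebra_simps)
qed

section \<open>Square integrable functions and finite elements on an interval\<close>

lemma finite_measure_Ioo: "finite_measure (lebesgue_on {0<..<L::real})"
  by (rule finite_measure_lebesgue_on) auto

lemma L2_spaceD:
  assumes "f \<in> L2_space L"
  shows "f \<in> borel_measurable (lebesgue_on {0<..<L})" "integrable (lebesgue_on {0<..<L}) (\<lambda>x. (f x)\<^sup>2)"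
  using assms by (auto simp: L2_space_def)

lemma L2_mult_integrable:
  assumes f: "f \<in> L2_space L" and g: "g \<in> L2_space L"
  shows "integrable (lebesgue_on {0<..<L}) (\<lambda>x. f x * g x)"
proof (rule Bochner_Integration.integrable_bound[OF Bochner_Integration.integrable_add[OF L2_spaceD(2)[OF f] L2_spaceD(2)[OF g]]])
  show "AE x in lebesgue_on {0<..<L}. norm (f x * g x) \<le> norm ((f x)\<^sup>2 + (g x)\<^sup>2)"
  proof (rule AE_I2)
    fix x show "norm (f x * g x) \<le> norm ((f x)\<^sup>2 + (g x)\<^sup>2)"
      using sum_squares_bound[of "\<bar>f x\<bar>" "\<bar>g x\<bar>"] mult_nonneg_nonneg[OF abs_ge_zero abs_ge_zero, of "f x" "g x"]
      unfolding real_norm_def abs_mult power2_abs by linarith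
  qed
qed (use L2_spaceD(1)[OF f] L2_spaceD(1)[OF g] in auto)

lemma L2_lincomb:
  assumes f: "f \<in> L2_space L" and g: "g \<in> L2_space L"
  shows "(\<lambda>x. a * f x + b * g x) \<in> L2_space L"
proof -
  note [measurable] = L2_spaceD(1)[OF f] L2_spaceD(1)[OF g]
  have "(a * f x + b * g x)\<^sup>2 = a\<^sup>2 * (f x)\<^sup>2 + 2 * a * b * (f x * g x) + b\<^sup>2 * (g x)\<^sup>2" for x
    by (simp add: power2_eq_square algebra_simps)
  then show ?thesis
    using L2_mult_integrable[OF f g] L2_spaceD(2)[OF f] L2_spaceD(2)[OF g] by (simp add: L2_space_def)
qed

lemma L2_inner_lincomb:
  assumes "f \<in> L2_space L" "g \<in> L2_space L" "h \<in> L2_space L"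
  shows "L2_inner L (\<lambda>x. a * f x + b * g x) h = a * L2_inner L f h + b * L2_inner L g h"
  using L2_mult_integrable[OF assms(1,3)] L2_mult_integrable[OF assms(2,3)]
  by (simp add: L2_inner_def distrib_right mult.assoc)

lemma L2_inner_commute: "L2_inner L f g = L2_inner L g f"
  by (simp add: L2_inner_def mult.commute)

lemma L2_inner_nonneg: "0 \<le> L2_inner L f f"
  by (simp add: L2_inner_def)

lemma L2_norm_nonneg: "0 \<le> L2_norm L f"
  by (simp add: L2_norm_def L2_inner_nonneg)

lemma L2_norm_power2: "(L2_norm L f)\<^sup>2 = L2_inner L f f"
  by (simp add: L2_norm_def L2_inner_nonneg)

text \<open>The discriminant argument. On representatives \<open>L2_inner\<close> is only
  semidefinite, so A = 0 needs its own case.\<close>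

lemma L2_Cauchy_Schwarz:
  assumes f: "f \<in> L2_space L" and g: "g \<in> L2_space L"
  shows "\<bar>L2_inner L f g\<bar> \<le> L2_norm L f * L2_norm L g"
proof -
  have q: "0 \<le> a\<^sup>2 * L2_inner L f f + 2 * a * b * L2_inner L f g + b\<^sup>2 * L2_inner L g g" for a b
  proof -
    have "0 \<le> L2_inner L (\<lambda>x. a * f x + b * g x) (\<lambda>x. a * f x + b * g x)" by (rule L2_inner_nonneg)
    also have "\<dots> = a * L2_inner L f (\<lambda>x. a * f x + b * g x) + b * L2_inner L g (\<lambda>x. a * f x + b * g x)"
      by (intro L2_inner_lincomb L2_lincomb f g)
    also have "\<dots> = a * (a * L2_inner L f f + b * L2_inner L g f) + b * (a * L2_inner L f g + b * L2_inner L g g)"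
      using L2_inner_lincomb[OF f g f] L2_inner_lincomb[OF f g g] by (simp add: L2_inner_commute)
    finally show ?thesis by (simp add: L2_inner_commute[of L g f] power2_eq_square algebra_simps)
  qed
  define A B D where "A = L2_inner L f f" and "B = L2_inner L g g" and "D = L2_inner L f g"
  have AB: "0 \<le> A" "0 \<le> B" by (auto simp: A_def B_def L2_inner_nonneg)
  have "D\<^sup>2 \<le> A * B"
  proof (cases "A = 0")
    case True
    have "0 \<le> 2 * a * D + B" for a using q[of a 1] True by (simp add: A_def B_def D_def)
    \<comment> \<open>If D were nonzero, this choice of a would give the value -1 to 2aD +
      B.\<close>
    from this[of "- (B + 1) / (2 * D)"] have "D = 0" by (cases "D = 0") (simp_all add: field_simps)
    then show ?thesis using True by simp
  next
    case False
    have "0 \<le> D\<^sup>2 * A - 2 * A * D\<^sup>2 + A\<^sup>2 * B"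
      using q[of "- D" A] by (simp add: A_def B_def D_def power2_eq_square algebra_simps)
    then have "A * D\<^sup>2 \<le> A * (A * B)" by (simp add: power2_eq_square algebra_simps)
    then show ?thesis using False AB by simp
  qed
  then have "sqrt (D\<^sup>2) \<le> sqrt (A * B)" by (rule real_sqrt_le_mono)
  then show ?thesis by (simp add: A_def B_def D_def L2_norm_def real_sqrt_mult)
qed

lemma L2_inner_cong:
  "(\<And>x. x \<in> {0<..<L} \<Longrightarrow> f x = f' x) \<Longrightarrow> (\<And>x. x \<in> {0<..<L} \<Longrightarrow> g x = g' x) \<Longrightarrow> L2_inner L f g = L2_inner L f' g'"
  unfolding L2_inner_def by (rule Bochner_Integration.integral_cong) auto

text \<open>Intended for N the set of mesh nodes, where a piecewise linear function may have a kink
  and nothing is known about \<open>deriv\<close>.\<close>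

lemma L2_inner_cong_finite:
  assumes N: "finite N" and m: "f \<in> borel_measurable (lebesgue_on {0<..<L})" "f' \<in> borel_measurable (lebesgue_on {0<..<L})"
    "g \<in> borel_measurable (lebesgue_on {0<..<L})" "g' \<in> borel_measurable (lebesgue_on {0<..<L})"
    and "\<And>x. x \<in> {0<..<L} - N \<Longrightarrow> f x = f' x" "\<And>x. x \<in> {0<..<L} - N \<Longrightarrow> g x = g' x"
  shows "L2_inner L f g = L2_inner L f' g'"
  unfolding L2_inner_def
proof (rule integral_cong_AE)
  have "AE x in lebesgue. x \<notin> N"
    by (rule AE_completion) (use AE_lborel_singleton N in \<open>auto intro!: AE_not_in countable_imp_null_set_lborel countable_finite\<close>)
  then show "AE x in lebesgue_on {0<..<L}. f x * g x = f' x * g' x"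
    by (subst AE_restrict_space_iff) (use assms in \<open>auto elim!: eventually_mono\<close>)
qed (use m in auto)

lemma Linf_imp_L2: "f \<in> Linf_space L \<Longrightarrow> f \<in> L2_space L"
proof -
  assume f: "f \<in> Linf_space L"
  then obtain C where m: "f \<in> borel_measurable (lebesgue_on {0<..<L})" and C: "AE x in lebesgue_on {0<..<L}. \<bar>f x\<bar> \<le> C"
    by (auto simp: Linf_space_def)
  interpret finite_measure "lebesgue_on {0<..<L}" by (rule finite_measure_Ioo)
  have "integrable (lebesgue_on {0<..<L}) (\<lambda>x. (f x)\<^sup>2)"
  proof (rule integrable_const_bound[where B="C\<^sup>2"])
    show "AE x in lebesgue_on {0<..<L}. norm ((f x)\<^sup>2) \<le> C\<^sup>2"
      using C by eventually_elim (use power_mono[of "\<bar>f _\<bar>" C 2] in simp)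
  qed (use m in auto)
  then show ?thesis using m by (simp add: L2_space_def)
qed

lemma Linf_mult: "f \<in> Linf_space L \<Longrightarrow> g \<in> Linf_space L \<Longrightarrow> (\<lambda>x. f x * g x) \<in> Linf_space L"
proof -
  assume f: "f \<in> Linf_space L" and g: "g \<in> Linf_space L"
  then obtain C D where C: "AE x in lebesgue_on {0<..<L}. \<bar>f x\<bar> \<le> C" and D: "AE x in lebesgue_on {0<..<L}. \<bar>g x\<bar> \<le> D"
    by (auto simp: Linf_space_def)
  have "AE x in lebesgue_on {0<..<L}. \<bar>f x * g x\<bar> \<le> C * D"
    using C D
  proof eventually_elim
    case (elim x)
    then show ?case by (auto simp: abs_mult intro!: mult_mono order_trans[OF abs_ge_zero elim(1)])
  qed
  then show ?thesis using f g by (auto simp: Linf_space_def)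
qed

lemma Linf_bounded:
  assumes "f \<in> borel_measurable (lebesgue_on {0<..<L})" "\<And>x. x \<in> {0<..<L} \<Longrightarrow> \<bar>f x\<bar> \<le> C"
  shows "f \<in> Linf_space L"
  using assms by (auto simp: Linf_space_def intro!: exI[of _ C] AE_I2)

lemma continuous_measurable_Ioo:
  fixes f :: "real \<Rightarrow> real"
  shows "continuous_on {0<..<L} f \<Longrightarrow> f \<in> borel_measurable (lebesgue_on {0<..<L})"
  by (rule continuous_imp_measurable_on_sets_lebesgue) auto

text \<open>Passage to the gauge integral, for which the fundamental theorem of calculus with
  finitely many exceptional points is available.\<close>

lemma integral_indicator_Ioo:
  fixes f :: "real \<Rightarrow> real"
  assumes f: "integrable (lebesgue_on {0<..<L}) f" and ab: "0 \<le> a" "b \<le> L"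
  shows "(\<integral>x. indicator {a<..<b} x * f x \<partial>lebesgue_on {0<..<L}) = integral {a..b} f"
    and "f integrable_on {a..b}"
proof -
  have i: "integrable lebesgue (\<lambda>x. indicator {0<..<L} x *\<^sub>R f x)" using f by (simp add: integrable_restrict_space)
  have "integrable lebesgue (\<lambda>x. indicator {a<..<b} x *\<^sub>R (indicator {0<..<L} x *\<^sub>R f x))"
    by (rule integrable_mult_indicator[OF _ i]) auto
  also have "(\<lambda>x. indicator {a<..<b} x *\<^sub>R (indicator {0<..<L} x *\<^sub>R f x)) = (\<lambda>x. indicator {a<..<b} x *\<^sub>R f x)"
    using ab by (auto simp: indicator_def fun_eq_iff)
  finally have s: "set_integrable lebesgue {a<..<b} f" by (simp add: set_integrable_def)
  have "(\<integral>x. indicator {a<..<b} x * f x \<partial>lebesgue_on {0<..<L}) = (\<integral>x. indicator {0<..<L} x *\<^sub>R (indicator {a<..<b} x * f x) \<partial>lebesgue)"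
    by (rule integral_restrict_space) auto
  also have "(\<lambda>x. indicator {0<..<L} x *\<^sub>R (indicator {a<..<b} x * f x)) = (\<lambda>x. indicator {a<..<b} x *\<^sub>R f x)"
    using ab by (auto simp: indicator_def fun_eq_iff)
  also have "(\<integral>x. indicator {a<..<b} x *\<^sub>R f x \<partial>lebesgue) = integral {a<..<b} f"
    using set_lebesgue_integral_eq_integral(2)[OF s] by (simp add: set_lebesgue_integral_def)
  also have "\<dots> = integral {a..b} f" by (simp add: integral_open_interval_real)
  finally show "(\<integral>x. indicator {a<..<b} x * f x \<partial>lebesgue_on {0<..<L}) = integral {a..b} f" .
  show "f integrable_on {a..b}"
    using s by (metis absolutely_integrable_on_Icc_iff_Ioo set_lebesgue_integral_eq_integral(1))
qed

section \<open>Piecewise linear functions on a mesh\<close>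

locale fem_mesh =
  fixes L :: real and P :: nat and x :: "nat \<Rightarrow> real"
  assumes L: "0 < L" and part: "is_partition L P x"
begin

lemma nodes_less: "p \<in> {1..P} \<Longrightarrow> x (p - 1) < x p"
  and nodes_ends: "x 0 = 0" "x P = L"
  using part by (auto simp: is_partition_def)

lemma nodes_mono: "i \<le> j \<Longrightarrow> j \<le> P \<Longrightarrow> x i \<le> x j"
proof (induction j)
  case (Suc j)
  then show ?case using nodes_less[of "Suc j"] by (cases "i = Suc j") auto
qed simp

lemma nodes_in: "p \<le> P \<Longrightarrow> x p \<in> {0..L}"
  using nodes_mono[of 0 p] nodes_mono[of p P] by (simp add: nodes_ends)

text \<open>The least index whose node is at or beyond y; closing elements only on the right makes
  them cover (0,L] without overlap.\<close>

lemma ex_element: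
  assumes "y \<in> {0<..L}"
  shows "\<exists>p\<in>{1..P}. y \<in> {x (p - 1)<..x p}"
proof -
  define p where "p = (LEAST p. y \<le> x p)"
  have 1: "y \<le> x P" using assms nodes_ends by simp
  have p: "y \<le> x p" "p \<le> P" unfolding p_def using 1 by (auto intro: LeastI Least_le)
  have "p \<noteq> 0"
  proof
    assume "p = 0"
    then have "y \<le> 0" using p(1) nodes_ends(1) by simp
    then show False using assms by simp
  qed
  then have "\<not> y \<le> x (p - 1)" unfolding p_def using not_less_Least[of "p - 1" "\<lambda>p. y \<le> x p"] by (simp add: p_def)
  then show ?thesis using p \<open>p \<noteq> 0\<close> by (intro bexI[of _ p]) auto
qed

abbreviation nodes where "nodes \<equiv> x ` {0..P}"

lemma ex_element_open:
  assumes "y \<in> {0<..<L} - nodes"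
  shows "\<exists>p\<in>{1..P}. y \<in> {x (p - 1)<..<x p}"
proof -
  obtain p where p: "p \<in> {1..P}" "y \<in> {x (p - 1)<..x p}" using ex_element[of y] assms by auto
  then have "y \<noteq> x p" using assms by auto
  then show ?thesis using p by (intro bexI[of _ p]) auto
qed

abbreviation S where "S \<equiv> fem_space L P x"

lemma fem_continuous: "v \<in> S \<Longrightarrow> continuous_on {0..L} v"
  and fem_0: "v \<in> S \<Longrightarrow> v 0 = 0" "v \<in> S \<Longrightarrow> v L = 0"
  by (auto simp: fem_space_def)

lemma fem_element:
  assumes "v \<in> S" "p \<in> {1..P}" "y \<in> {x (p - 1)..x p}"
  shows "v y = v (x (p - 1)) * ((x p - y) / (x p - x (p - 1))) + v (x p) * ((y - x (p - 1)) / (x p - x (p - 1)))"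
proof -
  obtain a b where ab: "\<forall>y\<in>{x (p - 1)..x p}. v y = a + b * y" using assms unfolding fem_space_def by blast
  have "v (x (p - 1)) * (x p - y) + v (x p) * (y - x (p - 1)) = v y * (x p - x (p - 1))"
    using nodes_less[OF assms(2)] assms(3) ab by (simp add: algebra_simps)
  then show ?thesis
    using nodes_less[OF assms(2)] by (simp add: nonzero_eq_divide_eq flip: add_divide_distrib)
qed

lemma fem_deriv:
  assumes "v \<in> S" "p \<in> {1..P}" "y \<in> {x (p - 1)<..<x p}"
  shows "(v has_real_derivative (v (x p) - v (x (p - 1))) / (x p - x (p - 1))) (at y)"
    and "deriv v y = (v (x p) - v (x (p - 1))) / (x p - x (p - 1))"
proof -
  obtain a b where ab: "\<forall>y\<in>{x (p - 1)..x p}. v y = a + b * y" using assms unfolding fem_space_def by blast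
  have "v (x p) - v (x (p - 1)) = b * (x p - x (p - 1))"
    using ab nodes_less[OF assms(2)] by (simp add: algebra_simps)
  then have b: "b = (v (x p) - v (x (p - 1))) / (x p - x (p - 1))"
    using nodes_less[OF assms(2)] by (simp add: nonzero_eq_divide_eq)
  have "((\<lambda>y. a + b * y) has_real_derivative b) (at y)"
    by (auto intro!: derivative_eq_intros)
  then show "(v has_real_derivative (v (x p) - v (x (p - 1))) / (x p - x (p - 1))) (at y)"
    unfolding b[symmetric]
    by (rule has_field_derivative_transform_within_open[where S="{x (p - 1)<..<x p}"])
       (use assms ab in auto)
  then show "deriv v y = (v (x p) - v (x (p - 1))) / (x p - x (p - 1))" by (rule DERIV_imp_deriv)
qed

lemma fem_has_deriv: "v \<in> S \<Longrightarrow> y \<in> {0<..<L} - nodes \<Longrightarrow> (v has_real_derivative deriv v y) (at y)"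
  using ex_element_open[of y] fem_deriv by metis

lemma fem_lincomb:
  assumes "u \<in> S" "v \<in> S"
  shows "(\<lambda>y. a * u y + b * v y) \<in> S"
proof -
  have "\<exists>c d. \<forall>y\<in>{x (p - 1)..x p}. a * u y + b * v y = c + d * y" if p: "p \<in> {1..P}" for p
  proof -
    obtain c d c' d' where "\<forall>y\<in>{x (p - 1)..x p}. u y = c + d * y" "\<forall>y\<in>{x (p - 1)..x p}. v y = c' + d' * y"
      using assms p by (fastforce simp: fem_space_def)
    then show ?thesis
      by (intro exI[of _ "a * c + b * c'"] exI[of _ "a * d + b * d'"]) (auto simp: algebra_simps)
  qed
  then show ?thesis using assms by (auto simp: fem_space_def intro!: continuous_intros)
qed

lemma fem_Linf: "v \<in> S \<Longrightarrow> v \<in> Linf_space L"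
proof -
  assume v: "v \<in> S"
  have "bounded (v ` {0..L})" by (intro compact_imp_bounded compact_continuous_image fem_continuous v) auto
  then obtain C where "\<forall>y\<in>{0..L}. \<bar>v y\<bar> \<le> C" unfolding bounded_iff by auto
  then show ?thesis
    by (intro Linf_bounded[of _ _ C] continuous_measurable_Ioo continuous_on_subset[OF fem_continuous[OF v]]) auto
qed

text \<open>Off the nodes the derivative equals the step function D. At the nodes
  \<open>deriv\<close> is uncontrolled, so measurability is inherited from D by changing it on a
  finite set.\<close>

lemma fem_deriv_Linf: "v \<in> S \<Longrightarrow> deriv v \<in> Linf_space L"
proof -
  assume v: "v \<in> S"
  define d where "d = (\<lambda>p. (v (x p) - v (x (p - 1))) / (x p - x (p - 1)))"
  define D where "D = (\<lambda>y. \<Sum>p\<in>{1..P}. indicator {x (p - 1)<..<x p} y * d p)"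
  have eq: "D y = deriv v y" if y: "y \<in> {0<..<L} - nodes" for y
  proof -
    obtain p where p: "p \<in> {1..P}" "y \<in> {x (p - 1)<..<x p}" using ex_element_open[OF y] by blast
    have "D y = (\<Sum>q\<in>{1..P}. if q = p then d p else 0)"
      unfolding D_def
    proof (rule sum.cong)
      fix q assume q: "q \<in> {1..P}"
      have "y \<notin> {x (q - 1)<..<x q}" if "q \<noteq> p"
      proof (cases "q < p")
        case True
        then have "x q \<le> x (p - 1)" using p by (intro nodes_mono) auto
        then show ?thesis using p by simp
      next
        case False
        then have "x p \<le> x (q - 1)" using q that by (intro nodes_mono) auto
        then show ?thesis using p by simp
      qed
      then show "indicator {x (q - 1)<..<x q} y * d q = (if q = p then d p else 0)" using p by auto
    qed simp
    also have "\<dots> = d p" using p by simp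
    finally show ?thesis using fem_deriv[OF v p] by (simp add: d_def)
  qed
  have Dm: "D \<in> borel_measurable (lebesgue_on {0<..<L})"
    unfolding D_def by (intro measurable_restrict_space1 measurable_completion) measurable
  have single: "{z} \<in> sets (lebesgue_on {0<..<L})" if "z \<in> {0<..<L}" for z
    using that by (simp add: sets_restrict_space_iff)
  have m: "deriv v \<in> borel_measurable (lebesgue_on {0<..<L})"
    by (rule measurable_discrete_difference[OF Dm, where X="nodes \<inter> {0<..<L}"])
       (use eq single in \<open>auto intro: countable_finite\<close>)
  have "AE y in lebesgue_on {0<..<L}. \<bar>deriv v y\<bar> \<le> (\<Sum>p\<in>{1..P}. \<bar>d p\<bar>)"
  proof (subst AE_restrict_space_iff)
    have "AE y in lebesgue. y \<notin> nodes"
      by (rule AE_completion) (auto intro!: AE_not_in countable_imp_null_set_lborel countable_finite)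
    then show "AE y in lebesgue. y \<in> {0<..<L} \<longrightarrow> \<bar>deriv v y\<bar> \<le> (\<Sum>p\<in>{1..P}. \<bar>d p\<bar>)"
    proof eventually_elim
      case (elim y)
      have "\<bar>D y\<bar> \<le> (\<Sum>p\<in>{1..P}. \<bar>d p\<bar>)" unfolding D_def
        by (rule order_trans[OF sum_abs]) (auto intro!: sum_mono simp: indicator_def)
      then show ?case using eq[of y] elim by auto
    qed
  qed simp
  then show ?thesis using m by (auto simp: Linf_space_def)
qed

end

lemma L2_norm_mono:
  assumes "f \<in> L2_space L" "g \<in> L2_space L" "AE x in lebesgue_on {0<..<L}. \<bar>f x\<bar> \<le> \<bar>g x\<bar>"
  shows "L2_norm L f \<le> L2_norm L g"
proof -
  have "L2_inner L f f \<le> L2_inner L g g"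
    unfolding L2_inner_def
  proof (rule integral_mono_AE)
    show "AE x in lebesgue_on {0<..<L}. f x * f x \<le> g x * g x"
      using assms(3) by eventually_elim (use abs_le_square_iff in \<open>auto simp: power2_eq_square\<close>)
  qed (use L2_mult_integrable assms in auto)
  then show ?thesis by (simp add: L2_norm_def)
qed

lemma L2_norm_cmult: "L2_norm L (\<lambda>x. c * f x) = \<bar>c\<bar> * L2_norm L f"
proof -
  have "L2_inner L (\<lambda>x. c * f x) (\<lambda>x. c * f x) = (\<integral>x. c\<^sup>2 * (f x * f x) \<partial>lebesgue_on {0<..<L})"
    unfolding L2_inner_def by (rule Bochner_Integration.integral_cong) (auto simp: power2_eq_square)
  also have "\<dots> = c\<^sup>2 * L2_inner L f f" by (simp add: L2_inner_def)
  finally show ?thesis by (simp add: L2_norm_def real_sqrt_mult)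
qed

lemma L2_norm_const: "0 \<le> L \<Longrightarrow> L2_norm L (\<lambda>_. c) = \<bar>c\<bar> * sqrt L"
  using L2_norm_cmult[of L c "\<lambda>_. 1"] by (simp add: L2_norm_def L2_inner_def measure_restrict_space)

lemma Linf_const: "(\<lambda>_. c) \<in> Linf_space L"
  by (rule Linf_bounded[of _ _ "\<bar>c\<bar>"]) auto

lemma L2_const: "(\<lambda>_. c) \<in> L2_space L"
  by (rule Linf_imp_L2[OF Linf_const])

lemma L2_abs: "f \<in> L2_space L \<Longrightarrow> (\<lambda>x. \<bar>f x\<bar>) \<in> L2_space L"
  by (auto simp: L2_space_def)

lemma L2_norm_abs: "L2_norm L (\<lambda>x. \<bar>f x\<bar>) = L2_norm L f"
  by (simp add: L2_norm_def L2_inner_def flip: abs_mult)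

lemma L2_integrable: "f \<in> L2_space L \<Longrightarrow> integrable (lebesgue_on {0<..<L}) f"
  using L2_mult_integrable[OF _ L2_const, of f L 1] by simp

lemma Linf_L2_mult:
  assumes F: "F \<in> Linf_space L" and f: "f \<in> L2_space L"
  shows "(\<lambda>x. F x * f x) \<in> L2_space L"
proof -
  obtain C where m: "F \<in> borel_measurable (lebesgue_on {0<..<L})" and C: "AE x in lebesgue_on {0<..<L}. \<bar>F x\<bar> \<le> C"
    using F by (auto simp: Linf_space_def)
  note [measurable] = m L2_spaceD(1)[OF f]
  have "integrable (lebesgue_on {0<..<L}) (\<lambda>x. (F x * f x)\<^sup>2)"
  proof (rule Bochner_Integration.integrable_bound[OF integrable_mult_right[OF L2_spaceD(2)[OF f], of "C\<^sup>2"]])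
    show "AE x in lebesgue_on {0<..<L}. norm ((F x * f x)\<^sup>2) \<le> norm (C\<^sup>2 * (f x)\<^sup>2)"
      using C
    proof eventually_elim
      case (elim x)
      then have "(F x)\<^sup>2 \<le> C\<^sup>2" using power_mono[of "\<bar>F x\<bar>" C 2] by simp
      then show ?case by (simp add: power_mult_distrib mult_right_mono)
    qed
  qed measurable
  then show ?thesis by (simp add: L2_space_def)
qed

context fem_mesh begin

lemma fem_L2: "v \<in> S \<Longrightarrow> v \<in> L2_space L"
  and fem_deriv_L2: "v \<in> S \<Longrightarrow> deriv v \<in> L2_space L"
  by (auto intro: Linf_imp_L2 fem_Linf fem_deriv_Linf)

lemma fem_FTC:
  assumes v: "v \<in> S" and ab: "0 \<le> a" "a \<le> b" "b \<le> L"
  shows "(\<integral>y. indicator {a<..<b} y * deriv v y \<partial>lebesgue_on {0<..<L}) = v b - v a"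
proof -
  have "(deriv v has_integral (v b - v a)) {a..b}"
  proof (rule fundamental_theorem_of_calculus_interior_strong)
    show "(v has_vector_derivative deriv v y) (at y)" if "y \<in> {a<..<b} - nodes" for y
      using fem_has_deriv[OF v, of y] that ab by (simp add: has_real_derivative_iff_has_vector_derivative)
    show "continuous_on {a..b} v" by (rule continuous_on_subset[OF fem_continuous[OF v]]) (use ab in auto)
  qed (use ab in auto)
  then show ?thesis
    using integral_indicator_Ioo(1)[OF L2_integrable[OF fem_deriv_L2[OF v]] ab(1,3)] by (simp add: integral_unique)
qed

text \<open>Integrating from both ends of \<open>(0, L)\<close> and averaging gives the factor \<open>1/2\<close>.\<close>

lemma fem_sup_bound:
  assumes v: "v \<in> S" and y: "y \<in> {0..L}"
  shows "\<bar>v y\<bar> \<le> sqrt L / 2 * L2_norm L (deriv v)"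
proof -
  let ?M = "lebesgue_on {0<..<L}"
  have d: "deriv v \<in> L2_space L" by (rule fem_deriv_L2[OF v])
  have i: "integrable ?M (\<lambda>r. indicator A r * \<bar>deriv v r\<bar>)" if "A \<in> sets borel" for A
  proof (rule Bochner_Integration.integrable_bound[OF L2_integrable[OF d]])
    have "indicat_real A \<in> borel_measurable ?M"
      using that by (intro measurable_restrict_space1 measurable_completion) simp
    then show "(\<lambda>r. indicator A r * \<bar>deriv v r\<bar>) \<in> borel_measurable ?M"
      using L2_spaceD(1)[OF d] by measurable
  qed (auto simp: indicator_def)
  have b: "\<bar>v b - v a\<bar> \<le> (\<integral>r. indicator {a<..<b} r * \<bar>deriv v r\<bar> \<partial>?M)" if "0 \<le> a" "a \<le> b" "b \<le> L" for a b
    using integral_abs_bound[of ?M "\<lambda>r. indicator {a<..<b} r * deriv v r"] fem_FTC[OF v that] by (simp add: abs_mult)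
  have "2 * \<bar>v y\<bar> \<le> (\<integral>r. indicator {0<..<y} r * \<bar>deriv v r\<bar> \<partial>?M) + (\<integral>r. indicator {y<..<L} r * \<bar>deriv v r\<bar> \<partial>?M)"
    using b[of 0 y] b[of y L] y fem_0[OF v] by simp
  also have "\<dots> = (\<integral>r. indicator {0<..<y} r * \<bar>deriv v r\<bar> + indicator {y<..<L} r * \<bar>deriv v r\<bar> \<partial>?M)"
    by (rule Bochner_Integration.integral_add[symmetric]) (auto intro: i)
  also have "\<dots> \<le> (\<integral>r. 1 * \<bar>deriv v r\<bar> \<partial>?M)"
  proof (rule integral_mono)
    show "integrable ?M (\<lambda>r. indicator {0<..<y} r * \<bar>deriv v r\<bar> + indicator {y<..<L} r * \<bar>deriv v r\<bar>)"
      by (intro Bochner_Integration.integrable_add i) auto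
  qed (use L2_integrable[OF L2_abs[OF d]] in \<open>auto simp: indicator_def\<close>)
  also have "\<dots> \<le> L2_norm L (\<lambda>_. 1) * L2_norm L (\<lambda>r. \<bar>deriv v r\<bar>)"
    using L2_Cauchy_Schwarz[OF L2_const L2_abs[OF d], of 1] by (simp add: L2_inner_def)
  also have "\<dots> = sqrt L * L2_norm L (deriv v)" using L by (simp add: L2_norm_const L2_norm_abs)
  finally show ?thesis by simp
qed

text \<open>The sup bound integrated over an interval of length L; its factor L/2 is the source of
  L^2/4 in the final bound.\<close>

lemma fem_poincare:
  assumes v: "v \<in> S"
  shows "L2_norm L v \<le> L / 2 * L2_norm L (deriv v)"
proof -
  have "L2_norm L v \<le> L2_norm L (\<lambda>_. sqrt L / 2 * L2_norm L (deriv v))"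
    by (rule L2_norm_mono) (use fem_L2 L2_const v fem_sup_bound[OF v] in \<open>auto intro!: AE_I2 order_trans[OF _ abs_ge_self]\<close>)
  also have "\<dots> = L / 2 * L2_norm L (deriv v)"
    using L by (simp add: L2_norm_const abs_mult L2_norm_nonneg)
  finally show ?thesis .
qed

text \<open>The integrand F z z_x is half the derivative of F z^2 minus half of F_x z^2. The
  boundary values of F z^2 vanish and the remaining term has the right sign.\<close>

lemma monotone_convection:
  fixes F :: "real \<Rightarrow> real"
  assumes z: "z \<in> S" and F: "F \<in> Linf_space L" and M: "\<And>y. y \<in> {0<..<L} \<Longrightarrow> \<bar>F y\<bar> \<le> M"
    and mono: "\<And>y. y \<in> {0<..<L} \<Longrightarrow> F differentiable (at y) \<and> deriv F y \<ge> 0"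
  shows "L2_inner L (\<lambda>y. F y * z y) (deriv z) \<le> 0"
proof -
  \<comment> \<open>Nothing is known about F at 0 and L. Setting G to 0 there makes it continuous,
    since F is bounded and z tends to 0.\<close>
  define G where "G = (\<lambda>y. if y \<in> {0<..<L} then F y * (z y)\<^sup>2 else 0)"
  define h where "h = (\<lambda>y. F y * z y * deriv z y)"
  have dF: "(F has_real_derivative deriv F y) (at y)" if "y \<in> {0<..<L}" for y
    using mono[OF that] by (simp add: DERIV_deriv_iff_real_differentiable)
  have "continuous (at y within {0..L}) G" if y: "y \<in> {0..L}" for y
  proof (cases "y \<in> {0<..<L}")
    case True
    have "isCont z y"
      using fem_continuous[OF z] True by (metis continuous_on_interior interior_atLeastAtMost_real)
    then have "isCont (\<lambda>y. F y * (z y)\<^sup>2) y"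
      using DERIV_isCont[OF dF[OF True]] by (intro continuous_intros)
    moreover have "\<forall>\<^sub>F r in nhds y. G r = F r * (z r)\<^sup>2"
      using eventually_nhds_in_open[of "{0<..<L}" y] True by (auto simp: G_def elim!: eventually_mono)
    ultimately have "isCont G y" using isCont_cong[of G "\<lambda>r. F r * (z r)\<^sup>2" y] by simp
    then show ?thesis by (rule continuous_at_imp_continuous_within)
  next
    case False
    then have y': "y = 0 \<or> y = L" using y by auto
    then have zy: "z y = 0" and Gy: "G y = 0" using fem_0[OF z] by (auto simp: G_def)
    have "(G \<longlongrightarrow> 0) (at y within {0..L})"
    proof (rule Lim_null_comparison)
      show "\<forall>\<^sub>F r in at y within {0..L}. norm (G r) \<le> M * (z r)\<^sup>2"
        unfolding eventually_at_filter
      proof (rule always_eventually, intro allI impI)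
        fix r assume r: "r \<noteq> y" "r \<in> {0..L}"
        show "norm (G r) \<le> M * (z r)\<^sup>2"
        proof (cases "r \<in> {0<..<L}")
          case True
          then show ?thesis using M[OF True] by (auto simp: G_def abs_mult intro!: mult_right_mono)
        next
          case False
          then have "z r = 0" using r fem_0[OF z] by (cases "r = 0") auto
          then show ?thesis by (simp add: G_def)
        qed
      qed
      have "(z \<longlongrightarrow> z y) (at y within {0..L})"
        using fem_continuous[OF z] y by (simp add: continuous_on_def)
      then have "((\<lambda>r. M * (z r)\<^sup>2) \<longlongrightarrow> M * (z y)\<^sup>2) (at y within {0..L})" by (intro tendsto_intros)
      then show "((\<lambda>r. M * (z r)\<^sup>2) \<longlongrightarrow> 0) (at y within {0..L})" by (simp add: zy)
    qed
    then show ?thesis by (simp add: continuous_within Gy)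
  qed
  then have contG: "continuous_on {0..L} G" by (simp add: continuous_on_eq_continuous_within)
  have "((\<lambda>y. deriv F y * (z y)\<^sup>2 + 2 * h y) has_integral (G L - G 0)) {0..L}"
  proof (rule fundamental_theorem_of_calculus_interior_strong[OF _ _ _ contG])
    fix y assume y: "y \<in> {0<..<L} - nodes"
    have "((\<lambda>y. F y * (z y)\<^sup>2) has_real_derivative (deriv F y * (z y)\<^sup>2 + 2 * h y)) (at y)"
      by (rule DERIV_cong[OF DERIV_mult[OF dF DERIV_power[OF fem_has_deriv[OF z y], of 2]]])
         (use y in \<open>auto simp: h_def\<close>)
    then have "(G has_real_derivative (deriv F y * (z y)\<^sup>2 + 2 * h y)) (at y)"
      by (rule has_field_derivative_transform_within_open[where S="{0<..<L}"]) (use y in \<open>auto simp: G_def\<close>)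
    then show "(G has_vector_derivative (deriv F y * (z y)\<^sup>2 + 2 * h y)) (at y)"
      by (simp add: has_real_derivative_iff_has_vector_derivative)
  qed (use L in auto)
  moreover have "integrable (lebesgue_on {0<..<L}) h"
    unfolding h_def by (intro L2_integrable Linf_imp_L2 Linf_mult F fem_Linf fem_deriv_Linf z)
  then have "h integrable_on {0..L}" "(\<integral>y. indicator {0<..<L} y * h y \<partial>lebesgue_on {0<..<L}) = integral {0..L} h"
    using integral_indicator_Ioo[of L h 0 L] by auto
  then have "(h has_integral (L2_inner L (\<lambda>y. F y * z y) (deriv z))) {0..L}"
    by (subst (asm) Bochner_Integration.integral_cong[of _ _ _ h])
       (auto simp: has_integral_iff L2_inner_def h_def)
  ultimately have "((\<lambda>y. deriv F y * (z y)\<^sup>2 + 2 * h y - 2 * h y) has_integral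
      (G L - G 0 - 2 * (L2_inner L (\<lambda>y. F y * z y) (deriv z)))) {0..L}"
    by (intro has_integral_diff has_integral_mult_right)
  then have "0 \<le> G L - G 0 - 2 * (L2_inner L (\<lambda>y. F y * z y) (deriv z))"
  proof (rule has_integral_nonneg)
    fix y assume y: "y \<in> {0..L}"
    show "0 \<le> deriv F y * (z y)\<^sup>2 + 2 * h y - 2 * h y"
    proof (cases "y \<in> {0<..<L}")
      case False
      then have "z y = 0" using y fem_0[OF z] by (cases "y = 0") auto
      then show ?thesis by simp
    qed (use mono in auto)
  qed
  then show ?thesis by (simp add: G_def)
qed

end

section \<open>Inverse estimate and nodal expansion\<close>

lemma integral_affine_square_lower_bound:
  fixes a b c d :: real
  assumes "c \<le> d"
  shows "b\<^sup>2 * (d - c) ^ 3 / 12 \<le> integral {c..d} (\<lambda>y. (a + b * y)\<^sup>2)"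
proof -
  have "((\<lambda>y. (a + b * y)\<^sup>2) has_integral (a\<^sup>2 * d + a * b * d\<^sup>2 + b\<^sup>2 * d ^ 3 / 3) - (a\<^sup>2 * c + a * b * c\<^sup>2 + b\<^sup>2 * c ^ 3 / 3)) {c..d}"
    using assms
    by (intro fundamental_theorem_of_calculus)
       (auto intro!: derivative_eq_intros simp: power2_eq_square algebra_simps
          simp flip: has_real_derivative_iff_has_vector_derivative)
  \<comment> \<open>The exact value is the mean-free part of the affine function plus the squared
    midpoint value; the second part is dropped.\<close>
  moreover have "(a\<^sup>2 * d + a * b * d\<^sup>2 + b\<^sup>2 * d ^ 3 / 3) - (a\<^sup>2 * c + a * b * c\<^sup>2 + b\<^sup>2 * c ^ 3 / 3)
     = b\<^sup>2 * (d - c) ^ 3 / 12 + (d - c) * (a + b * ((c + d) / 2))\<^sup>2"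
    by (simp add: power2_eq_square power3_eq_cube field_simps)
  ultimately show ?thesis using assms by (simp add: integral_unique)
qed

context fem_mesh begin

text \<open>On an element the oscillation of v alone contributes b^2 l^3 / 12 to the squared norm,
  with b the slope and l the length, so the norm controls every slope. Slopes then control the
  function through \<open>fem_sup_bound\<close>. The constant depends on the mesh.\<close>

lemma fem_inverse_estimate:
  "\<exists>C\<ge>0. \<forall>v\<in>S. (\<forall>y\<in>{0..L}. \<bar>v y\<bar> \<le> C * L2_norm L v) \<and> L2_norm L (deriv v) \<le> C * L2_norm L v"
proof -
  define \<kappa> where "\<kappa> = (\<lambda>p. sqrt (12 / (x p - x (p - 1)) ^ 3))"
  define K where "K = (\<Sum>p\<in>{1..P}. \<kappa> p)"
  have \<kappa>0: "0 \<le> \<kappa> p" if "p \<in> {1..P}" for p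
    using nodes_less[OF that] by (simp add: \<kappa>_def)
  have K0: "0 \<le> K" unfolding K_def by (intro sum_nonneg \<kappa>0)
  have slope: "\<bar>deriv v y\<bar> \<le> K * L2_norm L v" if v: "v \<in> S" and y: "y \<in> {0<..<L} - nodes" for v y
  proof -
    obtain p where p: "p \<in> {1..P}" "y \<in> {x (p - 1)<..<x p}" using ex_element_open[OF y] by blast
    obtain a b where ab: "\<forall>y\<in>{x (p - 1)..x p}. v y = a + b * y" using v p unfolding fem_space_def by blast
    have "((\<lambda>y. a + b * y) has_real_derivative b) (at y)" by (auto intro!: derivative_eq_intros)
    then have "(v has_real_derivative b) (at y)"
      by (rule has_field_derivative_transform_within_open[where S="{x (p - 1)<..<x p}"]) (use p ab in auto)
    then have d: "deriv v y = b" by (rule DERIV_imp_deriv)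
    have l: "0 < x p - x (p - 1)" using nodes_less[OF p(1)] by simp
    have e: "0 \<le> x (p - 1)" "x p \<le> L" using nodes_in[of p] nodes_in[of "p - 1"] p by auto
    have v2: "integrable (lebesgue_on {0<..<L}) (\<lambda>y. (v y)\<^sup>2)" using fem_L2[OF v] L2_spaceD by blast
    have "b\<^sup>2 * (x p - x (p - 1)) ^ 3 / 12 \<le> integral {x (p - 1)..x p} (\<lambda>y. (a + b * y)\<^sup>2)"
      by (rule integral_affine_square_lower_bound) (use l in simp)
    also have "\<dots> = integral {x (p - 1)..x p} (\<lambda>y. (v y)\<^sup>2)" by (rule integral_cong) (use ab in auto)
    also have "\<dots> = (\<integral>y. indicator {x (p - 1)<..<x p} y * (v y)\<^sup>2 \<partial>lebesgue_on {0<..<L})"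
      by (rule integral_indicator_Ioo(1)[OF v2 e, symmetric])
    also have "\<dots> \<le> (\<integral>y. (v y)\<^sup>2 \<partial>lebesgue_on {0<..<L})"
    proof (rule integral_mono')
      show "indicator {x (p - 1)<..<x p} y * (v y)\<^sup>2 \<le> (v y)\<^sup>2" for y by (auto simp: indicator_def)
    qed (use v2 in auto)
    also have "\<dots> = (L2_norm L v)\<^sup>2" unfolding L2_norm_power2 L2_inner_def by (simp add: power2_eq_square)
    finally have "b\<^sup>2 \<le> (12 / (x p - x (p - 1)) ^ 3) * (L2_norm L v)\<^sup>2"
      using l by (simp add: field_simps)
    then have "sqrt (b\<^sup>2) \<le> sqrt ((12 / (x p - x (p - 1)) ^ 3) * (L2_norm L v)\<^sup>2)" by (rule real_sqrt_le_mono)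
    then have "\<bar>b\<bar> \<le> \<kappa> p * L2_norm L v"
      unfolding \<kappa>_def real_sqrt_mult real_sqrt_abs by (simp add: L2_norm_nonneg)
    also have "\<dots> \<le> K * L2_norm L v"
      unfolding K_def by (intro mult_right_mono member_le_sum L2_norm_nonneg) (use p \<kappa>0 in auto)
    finally show ?thesis by (simp add: d)
  qed
  have d: "L2_norm L (deriv v) \<le> sqrt L * K * L2_norm L v" if v: "v \<in> S" for v
  proof -
    have "AE y in lebesgue_on {0<..<L}. \<bar>deriv v y\<bar> \<le> \<bar>K * L2_norm L v\<bar>"
    proof (subst AE_restrict_space_iff)
      have "AE y in lebesgue. y \<notin> nodes"
        by (rule AE_completion) (auto intro!: AE_not_in countable_imp_null_set_lborel countable_finite)
      then show "AE y in lebesgue. y \<in> {0<..<L} \<longrightarrow> \<bar>deriv v y\<bar> \<le> \<bar>K * L2_norm L v\<bar>"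
        by eventually_elim (use slope[OF v] in \<open>fastforce intro: order_trans[OF _ abs_ge_self]\<close>)
    qed simp
    then have "L2_norm L (deriv v) \<le> L2_norm L (\<lambda>_. K * L2_norm L v)"
      by (intro L2_norm_mono fem_deriv_L2[OF v] L2_const)
    then show ?thesis using L K0 by (simp add: L2_norm_const L2_norm_nonneg abs_mult mult_ac)
  qed
  define C where "C = max (sqrt L * K) (sqrt L / 2 * (sqrt L * K))"
  have 1: "L2_norm L (deriv v) \<le> C * L2_norm L v" if v: "v \<in> S" for v
    by (rule order_trans[OF d[OF v]], intro mult_right_mono L2_norm_nonneg) (auto simp: C_def)
  have 2: "\<bar>v y\<bar> \<le> C * L2_norm L v" if v: "v \<in> S" and y: "y \<in> {0..L}" for v y
  proof -
    have "sqrt L / 2 * L2_norm L (deriv v) \<le> sqrt L / 2 * (sqrt L * K * L2_norm L v)"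
      using L by (intro mult_left_mono d v) auto
    also have "\<dots> \<le> C * L2_norm L v"
      unfolding C_def by (subst mult.assoc[symmetric], intro mult_right_mono L2_norm_nonneg) auto
    finally show ?thesis using fem_sup_bound[OF v y] by linarith
  qed
  have "0 \<le> C" using L K0 by (simp add: C_def le_max_iff_disj)
  with 1 2 show ?thesis by blast
qed

text \<open>Each hat function is split into its two halves: on element \<open>p\<close> the index \<open>(p, True)\<close> stands for the
  half rising towards the right node, \<open>(p, False)\<close> for the half falling from the left node.\<close>

definition fem_basis :: "nat \<times> bool \<Rightarrow> real \<Rightarrow> real" where
  "fem_basis = (\<lambda>(p, b) y. indicator {x (p - 1)<..x p} y *
     (if b then (y - x (p - 1)) / (x p - x (p - 1)) else (x p - y) / (x p - x (p - 1))))"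

definition fem_node :: "nat \<times> bool \<Rightarrow> real" where
  "fem_node = (\<lambda>(p, b). if b then x p else x (p - 1))"

abbreviation fem_index :: "(nat \<times> bool) set" where
  "fem_index \<equiv> {1..P} \<times> UNIV"

lemma fem_node_in: "i \<in> fem_index \<Longrightarrow> fem_node i \<in> {0..L}"
  using nodes_in by (force simp: fem_node_def split: prod.splits if_splits)

lemma fem_basis_bounds: "i \<in> fem_index \<Longrightarrow> \<bar>fem_basis i y\<bar> \<le> 1"
proof -
  assume i: "i \<in> fem_index"
  obtain p b where [simp]: "i = (p, b)" by (cases i)
  have "x (p - 1) < x p" using nodes_less i by auto
  then show ?thesis by (auto simp: fem_basis_def indicator_def abs_le_iff field_simps)
qed

lemma fem_basis_Linf: "i \<in> fem_index \<Longrightarrow> fem_basis i \<in> Linf_space L"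
proof (rule Linf_bounded[of _ _ 1])
  have "fem_basis i \<in> borel_measurable borel"
    unfolding fem_basis_def split_beta' by measurable
  then show "fem_basis i \<in> borel_measurable (lebesgue_on {0<..<L})"
    by (intro measurable_restrict_space1 measurable_completion) simp
qed (use fem_basis_bounds in blast)

text \<open>The half-open elements let exactly one p contribute at each y, nodes included, although
  an interior node is listed twice by \<open>fem_node\<close>.\<close>

lemma fem_expansion:
  assumes v: "v \<in> S" and y: "y \<in> {0<..L}"
  shows "v y = (\<Sum>i\<in>fem_index. v (fem_node i) * fem_basis i y)"
proof -
  obtain p where p: "p \<in> {1..P}" "y \<in> {x (p - 1)<..x p}" using ex_element[OF y] by blast
  have z: "indicator {x (q - 1)<..x q} y = (if q = p then 1 else (0::real))" if q: "q \<in> {1..P}" for q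
  proof -
    have "y \<notin> {x (q - 1)<..x q}" if "q \<noteq> p"
    proof (cases "q < p")
      case True
      then have "x q \<le> x (p - 1)" using p by (intro nodes_mono) auto
      then show ?thesis using p by simp
    next
      case False
      then have "x p \<le> x (q - 1)" using q that by (intro nodes_mono) auto
      then show ?thesis using p by simp
    qed
    then show ?thesis using p by auto
  qed
  have "(\<Sum>i\<in>fem_index. v (fem_node i) * fem_basis i y)
      = (\<Sum>q\<in>{1..P}. \<Sum>b\<in>UNIV. v (fem_node (q, b)) * fem_basis (q, b) y)"
    by (simp add: sum.cartesian_product)
  also have "\<dots> = (\<Sum>q\<in>{1..P}. if q = p then v y else 0)"
  proof (rule sum.cong)
    fix q assume q: "q \<in> {1..P}"
    show "(\<Sum>b\<in>UNIV. v (fem_node (q, b)) * fem_basis (q, b) y) = (if q = p then v y else 0)"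
      using fem_element[OF v q, of y] p z[OF q] by (auto simp: UNIV_bool fem_node_def fem_basis_def)
  qed simp
  also have "\<dots> = v y" using p by simp
  finally show ?thesis by simp
qed

text \<open>Bounds a spatial norm by finitely many point values, whose dependence on time is known
  to be square integrable.\<close>

lemma L2_norm_le_nodal_sum:
  assumes v: "v \<in> S"
  shows "L2_norm L v \<le> sqrt L * (\<Sum>i\<in>fem_index. \<bar>v (fem_node i)\<bar>)"
proof -
  have "L2_norm L v \<le> L2_norm L (\<lambda>_. (\<Sum>i\<in>fem_index. \<bar>v (fem_node i)\<bar>))"
  proof (rule L2_norm_mono[OF fem_L2[OF v] L2_const], rule AE_I2)
    fix y assume "y \<in> space (lebesgue_on {0<..<L})"
    then have y: "y \<in> {0<..L}" by auto
    have "\<bar>v y\<bar> \<le> (\<Sum>i\<in>fem_index. \<bar>v (fem_node i) * fem_basis i y\<bar>)"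
      unfolding fem_expansion[OF v y] by (rule sum_abs)
    also have "\<dots> \<le> (\<Sum>i\<in>fem_index. \<bar>v (fem_node i)\<bar>)"
      by (rule sum_mono) (use fem_basis_bounds in \<open>auto simp: abs_mult intro!: mult_left_le\<close>)
    finally show "\<bar>v y\<bar> \<le> \<bar>\<Sum>i\<in>fem_index. \<bar>v (fem_node i)\<bar>\<bar>" by linarith
  qed
  then show ?thesis using L by (simp add: L2_norm_const sum_nonneg mult.commute)
qed

section \<open>The Galerkin equation at a fixed time\<close>

definition galerkin_eq :: "(real \<Rightarrow> real) \<Rightarrow> (real \<Rightarrow> real) \<Rightarrow> (real \<Rightarrow> real) \<Rightarrow> (real \<Rightarrow> real) \<Rightarrow> (real \<Rightarrow> real) \<Rightarrow> bool" where
  "galerkin_eq F g gs v z \<longleftrightarrow> (\<forall>\<phi>\<in>S. L2_inner L v \<phi> + L2_inner L (deriv z) (deriv \<phi>)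
      - L2_inner L (\<lambda>y. F y * z y) (deriv \<phi>) = L2_inner L g \<phi> + L2_inner L gs (deriv \<phi>))"

text \<open>Test with v itself and remove all derivatives by the inverse estimate. C is chosen
  before F and the data, so one constant serves all times.\<close>

lemma galerkin_stability:
  "\<exists>C. \<forall>F g gs v z. F \<in> Linf_space L \<longrightarrow> (\<forall>y\<in>{0<..<L}. \<bar>F y\<bar> \<le> M) \<longrightarrow> g \<in> L2_space L \<longrightarrow> gs \<in> L2_space L \<longrightarrow>
     v \<in> S \<longrightarrow> z \<in> S \<longrightarrow> galerkin_eq F g gs v z \<longrightarrow> L2_norm L v \<le> C * (L2_norm L z + L2_norm L g + L2_norm L gs)"
proof -
  obtain C where C: "C \<ge> 0" "\<And>v. v \<in> S \<Longrightarrow> L2_norm L (deriv v) \<le> C * L2_norm L v"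
    using fem_inverse_estimate by blast
  define D where "D = max 1 (max C (C * C + \<bar>M\<bar> * C))"
  have "L2_norm L v \<le> D * (L2_norm L z + L2_norm L g + L2_norm L gs)"
    if F: "F \<in> Linf_space L" "\<forall>y\<in>{0<..<L}. \<bar>F y\<bar> \<le> M" and g: "g \<in> L2_space L" "gs \<in> L2_space L"
     and v: "v \<in> S" and z: "z \<in> S" and eq: "galerkin_eq F g gs v z" for F g gs v z
  proof -
    define n where "n = L2_norm L v"
    have n0: "0 \<le> n" by (simp add: n_def L2_norm_nonneg)
    have Fz: "(\<lambda>y. F y * z y) \<in> L2_space L" by (intro Linf_L2_mult F fem_L2 z)
    have "L2_norm L (\<lambda>y. F y * z y) \<le> L2_norm L (\<lambda>y. M * z y)"
    proof (rule L2_norm_mono[OF Fz Linf_L2_mult[OF Linf_const fem_L2[OF z]]], rule AE_I2)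
      fix y assume "y \<in> space (lebesgue_on {0<..<L})"
      then have "\<bar>F y\<bar> \<le> M" using F(2) by simp
      then have "\<bar>F y\<bar> \<le> \<bar>M\<bar>" by simp
      then show "\<bar>F y * z y\<bar> \<le> \<bar>M * z y\<bar>" by (simp add: abs_mult mult_right_mono)
    qed
    then have nFz: "L2_norm L (\<lambda>y. F y * z y) \<le> \<bar>M\<bar> * L2_norm L z" by (simp add: L2_norm_cmult)
    have cs: "\<bar>L2_inner L f (deriv v)\<bar> \<le> K * (C * n)" if "f \<in> L2_space L" "L2_norm L f \<le> K" for f K
    proof -
      have "\<bar>L2_inner L f (deriv v)\<bar> \<le> L2_norm L f * L2_norm L (deriv v)"
        by (rule L2_Cauchy_Schwarz[OF that(1) fem_deriv_L2[OF v]])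
      also have "\<dots> \<le> K * (C * n)"
        using that L2_norm_nonneg order_trans by (intro mult_mono) (auto simp: n_def C v intro: order_trans[OF L2_norm_nonneg])
      finally show ?thesis .
    qed
    have "n * n = L2_inner L v v" using L2_norm_power2[of L v] by (simp add: n_def power2_eq_square)
    also have "\<dots> = L2_inner L g v + L2_inner L gs (deriv v) - L2_inner L (deriv z) (deriv v) + L2_inner L (\<lambda>y. F y * z y) (deriv v)"
      using bspec[OF eq[unfolded galerkin_eq_def] v] by linarith
    also have "\<dots> \<le> L2_norm L g * n + L2_norm L gs * (C * n) + C * L2_norm L z * (C * n) + \<bar>M\<bar> * L2_norm L z * (C * n)"
      using L2_Cauchy_Schwarz[OF g(1) fem_L2[OF v]] cs[OF g(2) order_refl] cs[OF fem_deriv_L2[OF z] C(2)[OF z]] cs[OF Fz nFz]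
      by (simp add: n_def)
    also have "\<dots> = (1 * L2_norm L g + C * L2_norm L gs + (C * C + \<bar>M\<bar> * C) * L2_norm L z) * n"
      by (simp add: algebra_simps)
    also have "\<dots> \<le> (D * L2_norm L g + D * L2_norm L gs + D * L2_norm L z) * n"
      by (intro mult_right_mono add_mono n0 L2_norm_nonneg) (auto simp: D_def)
    also have "\<dots> = D * (L2_norm L z + L2_norm L g + L2_norm L gs) * n" by (simp add: algebra_simps)
    finally show ?thesis
      using n0 by (cases "n = 0") (auto simp: D_def L2_norm_nonneg n_def[symmetric])
  qed
  then show ?thesis by blast
qed

text \<open>Here \<kappa> stands for the kernel at the given time. Diffusion and convection of
  \<open>\<kappa> * u0\<close> are merged into one datum q = F u0 - u0_x, so with X the norm of w_x
  three terms linear in X compete with X^2.\<close>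

lemma galerkin_energy_bound:
  assumes F: "\<And>y. y \<in> {0<..<L} \<Longrightarrow> F differentiable (at y) \<and> deriv F y \<ge> 0"
    and CF: "\<And>y. y \<in> {0<..<L} \<Longrightarrow> 1 + (F y)\<^sup>2 \<le> C"
    and Finf: "F \<in> Linf_space L"
    and g: "g \<in> L2_space L" "gs \<in> L2_space L"
    and S: "v \<in> S" "z \<in> S" "w \<in> S" "u0 \<in> S" and z: "\<And>y. y \<in> {0..L} \<Longrightarrow> z y = w y + \<kappa> * u0 y"
    and eq: "galerkin_eq F g gs v z"
  shows "L2_inner L v w \<le> 3/4 * (L\<^sup>2 / 4 * (L2_norm L g)\<^sup>2 + (L2_norm L gs)\<^sup>2 + \<kappa>\<^sup>2 * (C * (H1_norm L u0)\<^sup>2))"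
proof -
  define X where "X = L2_norm L (deriv w)"
  have X0: "0 \<le> X" by (simp add: X_def L2_norm_nonneg)
  have dw: "deriv w \<in> L2_space L" and du: "deriv u0 \<in> L2_space L" and dz: "deriv z \<in> L2_space L"
    using S by (auto intro: fem_deriv_L2)
  have Fw: "(\<lambda>y. F y * w y) \<in> L2_space L" and Fu: "(\<lambda>y. F y * u0 y) \<in> L2_space L"
    by (rule Linf_L2_mult[OF Finf fem_L2[OF S(3)]], rule Linf_L2_mult[OF Finf fem_L2[OF S(4)]])
  \<comment> \<open>With C at least 1, the bound on the square of F yields |F| \<le> C, the
    boundedness required by \<open>monotone_convection\<close>.\<close>
  have C1: "1 \<le> C" using CF[of "L / 2"] L by (smt (verit) field_sum_of_halves greaterThanLessThan_iff zero_le_power2)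
  have "\<bar>F y\<bar> \<le> C" if "y \<in> {0<..<L}" for y
  proof -
    have "C * 1 \<le> C * C" using C1 by (intro mult_left_mono) auto
    then have "(F y)\<^sup>2 \<le> C * C" using CF[OF that] by linarith
    then show ?thesis using C1 abs_le_square_iff[of "F y" C] by (simp add: power2_eq_square)
  qed
  then have conv: "L2_inner L (\<lambda>y. F y * w y) (deriv w) \<le> 0"
    by (rule monotone_convection[OF S(3) Finf _ F])
  have dzeq: "L2_inner L (deriv z) (deriv w) = X\<^sup>2 + \<kappa> * L2_inner L (deriv u0) (deriv w)"
  proof -
    have "L2_inner L (deriv z) (deriv w) = L2_inner L (\<lambda>y. 1 * deriv w y + \<kappa> * deriv u0 y) (deriv w)"
    proof (rule L2_inner_cong_finite[where N=nodes])
      fix y assume y: "y \<in> {0<..<L} - nodes"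
      have "((\<lambda>y. w y + \<kappa> * u0 y) has_real_derivative (1 * deriv w y + \<kappa> * deriv u0 y)) (at y)"
        using fem_has_deriv[OF S(3) y] fem_has_deriv[OF S(4) y] by (auto intro!: derivative_eq_intros)
      then have "(z has_real_derivative (1 * deriv w y + \<kappa> * deriv u0 y)) (at y)"
        by (rule has_field_derivative_transform_within_open[where S="{0<..<L}"]) (use y z in auto)
      then show "deriv z y = 1 * deriv w y + \<kappa> * deriv u0 y" by (rule DERIV_imp_deriv)
    qed (use L2_spaceD(1)[OF dz] L2_spaceD(1)[OF dw] L2_spaceD(1)[OF du] in auto)
    then show ?thesis using L2_inner_lincomb[OF dw du dw, of 1 \<kappa>] by (simp add: X_def L2_norm_power2)
  qed
  have Fzeq: "L2_inner L (\<lambda>y. F y * z y) (deriv w)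
      = L2_inner L (\<lambda>y. F y * w y) (deriv w) + \<kappa> * L2_inner L (\<lambda>y. F y * u0 y) (deriv w)"
  proof -
    have "L2_inner L (\<lambda>y. F y * z y) (deriv w) = L2_inner L (\<lambda>y. 1 * (F y * w y) + \<kappa> * (F y * u0 y)) (deriv w)"
      by (rule L2_inner_cong) (use z in \<open>auto simp: algebra_simps\<close>)
    then show ?thesis using L2_inner_lincomb[OF Fw Fu dw, of 1 \<kappa>] by simp
  qed
  define q where "q = (\<lambda>y. 1 * (F y * u0 y) + (-1) * deriv u0 y)"
  have q: "q \<in> L2_space L" unfolding q_def by (rule L2_lincomb[OF Fu du])
  have qn: "(L2_norm L q)\<^sup>2 \<le> C * (H1_norm L u0)\<^sup>2"
  proof -
    have u2: "integrable (lebesgue_on {0<..<L}) (\<lambda>y. u0 y * u0 y)" "integrable (lebesgue_on {0<..<L}) (\<lambda>y. deriv u0 y * deriv u0 y)"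
      using fem_L2[OF S(4)] du L2_mult_integrable by auto
    have "(L2_norm L q)\<^sup>2 \<le> (\<integral>y. C * (u0 y * u0 y + deriv u0 y * deriv u0 y) \<partial>lebesgue_on {0<..<L})"
      unfolding L2_norm_power2 L2_inner_def
    proof (rule integral_mono)
      fix y assume "y \<in> space (lebesgue_on {0<..<L})"
      then have y: "y \<in> {0<..<L}" by simp
      \<comment> \<open>Lagrange's identity, the two-dimensional Cauchy-Schwarz inequality with its
        remainder; it produces both 1 + F^2 and the integrand of the H^1 norm.\<close>
      have "q y * q y + (u0 y + F y * deriv u0 y)\<^sup>2 = (1 + (F y)\<^sup>2) * (u0 y * u0 y + deriv u0 y * deriv u0 y)"
        by (simp add: q_def power2_eq_square algebra_simps)
      also have "\<dots> \<le> C * (u0 y * u0 y + deriv u0 y * deriv u0 y)"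
        by (intro mult_right_mono CF[OF y] add_nonneg_nonneg) auto
      finally show "q y * q y \<le> C * (u0 y * u0 y + deriv u0 y * deriv u0 y)"
        using zero_le_power2[of "u0 y + F y * deriv u0 y"] by linarith
    qed (use u2 L2_mult_integrable[OF q q] in auto)
    also have "\<dots> = C * (H1_norm L u0)\<^sup>2"
      using u2 by (simp add: H1_norm_def L2_norm_power2 L2_inner_def)
    finally show ?thesis .
  qed
  have qw: "L2_inner L q (deriv w) = L2_inner L (\<lambda>y. F y * u0 y) (deriv w) - L2_inner L (deriv u0) (deriv w)"
    unfolding q_def using L2_inner_lincomb[OF Fu du dw, of 1 "-1"] by simp
  define a b c where "a = L / 2 * L2_norm L g" and "b = L2_norm L gs" and "c = \<bar>\<kappa>\<bar> * L2_norm L q"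
  have "\<kappa> * L2_inner L q (deriv w) \<le> \<bar>\<kappa>\<bar> * \<bar>L2_inner L q (deriv w)\<bar>"
    using abs_ge_self[of "\<kappa> * L2_inner L q (deriv w)"] by (simp add: abs_mult)
  also have "\<dots> \<le> \<bar>\<kappa>\<bar> * (L2_norm L q * X)"
    unfolding X_def by (intro mult_left_mono L2_Cauchy_Schwarz q dw) auto
  finally have 1: "\<kappa> * L2_inner L q (deriv w) \<le> c * X" by (simp add: c_def)
  have "\<bar>L2_inner L g w\<bar> \<le> L2_norm L g * L2_norm L w" by (rule L2_Cauchy_Schwarz[OF g(1) fem_L2[OF S(3)]])
  also have "\<dots> \<le> L2_norm L g * (L / 2 * X)" unfolding X_def by (intro mult_left_mono fem_poincare S L2_norm_nonneg)
  finally have "\<bar>L2_inner L g w\<bar> \<le> a * X" by (simp add: a_def mult_ac)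
  then have 2: "L2_inner L g w \<le> a * X" by linarith
  have 3: "L2_inner L gs (deriv w) \<le> b * X"
    using L2_Cauchy_Schwarz[OF g(2) dw] by (simp add: X_def b_def)
  have "L2_inner L v w = L2_inner L g w + L2_inner L gs (deriv w) - L2_inner L (deriv z) (deriv w) + L2_inner L (\<lambda>y. F y * z y) (deriv w)"
    using bspec[OF eq[unfolded galerkin_eq_def] S(3)] by linarith
  also have "\<dots> = L2_inner L g w + L2_inner L gs (deriv w) - X\<^sup>2 + L2_inner L (\<lambda>y. F y * w y) (deriv w) + \<kappa> * L2_inner L q (deriv w)"
    by (simp add: dzeq Fzeq qw algebra_simps)
  also have "\<dots> \<le> a * X + b * X - X\<^sup>2 + 0 + c * X" using 1 2 3 conv by linarith
  \<comment> \<open>Maximising over X gives 1/4 of the squared sum; the square of a sum of three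
    terms is at most 3 times the sum of squares, whence 3/4.\<close>
  also have "\<dots> \<le> (a + b + c)\<^sup>2 / 4"
    using zero_le_power2[of "X - (a + b + c) / 2"] by (simp add: power2_eq_square field_simps)
  also have "\<dots> \<le> 3 / 4 * (a\<^sup>2 + b\<^sup>2 + c\<^sup>2)"
    using zero_le_power2[of "a - b"] zero_le_power2[of "b - c"] zero_le_power2[of "a - c"]
    by (simp add: power2_eq_square field_simps)
  also have "\<dots> \<le> 3 / 4 * (L\<^sup>2 / 4 * (L2_norm L g)\<^sup>2 + (L2_norm L gs)\<^sup>2 + \<kappa>\<^sup>2 * (C * (H1_norm L u0)\<^sup>2))"
    using mult_left_mono[OF qn zero_le_power2[of \<kappa>]] by (simp add: a_def b_def c_def power_mult_distrib power_divide)
  finally show ?thesis .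
qed

end

section \<open>The Riemann--Liouville derivative of a weakly differentiable function\<close>

lemma integrable_lebesgue_on_subinterval:
  fixes f :: "real \<Rightarrow> real"
  assumes "integrable (lebesgue_on {0<..<T}) f" "t \<le> T"
  shows "integrable (lebesgue_on {0<..<t}) f"
proof -
  have "integrable lebesgue (\<lambda>s. indicator {0<..<t} s *\<^sub>R (indicator {0<..<T} s *\<^sub>R f s))"
    by (rule integrable_mult_indicator) (use assms(1) in \<open>auto simp: integrable_restrict_space\<close>)
  moreover have "(\<lambda>s. indicator {0<..<t} s *\<^sub>R (indicator {0<..<T} s *\<^sub>R f s)) = (\<lambda>s. indicator {0<..<t} s *\<^sub>R f s)"
    using assms(2) by (auto simp: indicator_def fun_eq_iff)
  ultimately show ?thesis by (simp add: integrable_restrict_space)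
qed

lemma measurable_lebesgue_on_subinterval:
  "f \<in> borel_measurable (lebesgue_on {0<..<T}) \<Longrightarrow> t \<le> T \<Longrightarrow> f \<in> borel_measurable (lebesgue_on {0<..<t::real})"
  by (erule measurable_restrict_mono) auto

lemma L2_space_subinterval:
  assumes "f \<in> L2_space T" "t \<le> T"
  shows "f \<in> L2_space t"
  using measurable_lebesgue_on_subinterval[OF L2_spaceD(1)[OF assms(1)] assms(2)]
    integrable_lebesgue_on_subinterval[OF L2_spaceD(2)[OF assms(1)] assms(2)]
  unfolding L2_space_def by blast

lemma L2_space_AE_eq_lborel:
  assumes f: "f \<in> borel_measurable (lebesgue_on {0<..<T})" and g[measurable]: "g \<in> borel_measurable borel"
    and eq: "AE s in lborel. s \<in> {0<..<T} \<longrightarrow> f s = g s" and g2: "integrable lborel (\<lambda>s. (g s)\<^sup>2)"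
  shows "f \<in> L2_space T"
proof -
  have "integrable lborel (\<lambda>s. indicator {0<..<T} s * (g s)\<^sup>2)"
    using integrable_mult_indicator[OF _ g2, of "{0<..<T}"] by simp
  moreover have "integrable (lebesgue_on {0<..<T}) (\<lambda>s. (f s)\<^sup>2) \<longleftrightarrow> integrable lborel (\<lambda>s. indicator {0<..<T} s * (g s)\<^sup>2)"
    by (rule lebesgue_on_Ioo_eq_lborel) (use f eq in \<open>auto elim!: eventually_mono\<close>)
  ultimately show ?thesis using f by (simp add: L2_space_def)
qed

context
  fixes T \<alpha> :: real and u ut z :: "real \<Rightarrow> real"
  assumes T: "0 < T" and \<alpha>: "1/2 < \<alpha>" "\<alpha> < 1"
    and u: "continuous_on {0..T} u" and wu: "has_weak_deriv T u ut"
    and wz: "has_weak_deriv T (frac_integral \<alpha> u) z"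
begin

text \<open>This is applied at a fixed point of \<Omega>. Continuity of u makes it the primitive of
  v, its fractional integral is then a primitive of the right-hand side, and uniqueness of weak
  derivatives identifies z.\<close>

lemma frac_deriv_representation:
  "\<exists>v. borel_rep T ut v \<and> (\<forall>t\<in>{0..T}. u t = u 0 + (\<integral>s. indicator {0<..<t} s * v s \<partial>lborel)) \<and>
     (AE s in lborel. s \<in> {0<..<T} \<longrightarrow> z s = convolution (trunc_kernel \<alpha> T) v s + u 0 * frac_kernel \<alpha> s)"
proof -
  let ?k = "trunc_kernel \<alpha> T"
  obtain v where v: "borel_rep T ut v" using wu ex_borel_rep[of T ut] by (auto simp: has_weak_deriv_def)
  obtain z0 where z0: "borel_rep T z z0" using wz ex_borel_rep[of T z] by (auto simp: has_weak_deriv_def)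
  note V = borel_repD[OF v]
  have rep: "u t = u 0 + (\<integral>s. indicator {0<..<t} s * v s \<partial>lborel)" if "t \<in> {0..T}" for t
    by (rule weak_deriv_imp_integral[OF T wu u v that])
  have k: "integrable lborel ?k" using integrable_trunc_kernel \<alpha> T by simp
  define q where "q = (\<lambda>s. indicator {0<..<T} s * (convolution ?k v s + u 0 * ?k s))"
  have "AE s in lborel. s \<in> {0<..<T} \<longrightarrow> z s = q s"
  proof (rule weak_deriv_unique[OF _ _ _ wz z0])
    have "integrable lborel (\<lambda>s. convolution ?k v s + u 0 * ?k s)"
      using integrable_convolution[OF k V(2)] k by simp
    then show "integrable lborel q"
      unfolding q_def using integrable_mult_indicator[of "{0<..<T}" lborel "\<lambda>s. convolution ?k v s + u 0 * ?k s"] by simp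
    fix t assume t: "t \<in> {0<..<T}"
    have "frac_integral \<alpha> u t = (\<integral>s. indicator {0<..<t} s * (convolution ?k v s + u 0 * ?k s) \<partial>lborel)"
    proof (rule frac_integral_eq_integral[OF _ V(2,4) _ t])
      show "u t = u 0 + (\<integral>s. indicator {0<..<t} s * v s \<partial>lborel)" if "t \<in> {0..<T}" for t
        by (rule rep) (use that in auto)
    qed (use \<alpha> in auto)
    also have "\<dots> = (\<integral>s. indicator {0<..<t} s * q s \<partial>lborel)"
      by (rule Bochner_Integration.integral_cong) (use t in \<open>auto simp: q_def indicator_def\<close>)
    finally show "frac_integral \<alpha> u t = (\<integral>s. indicator {0<..<t} s * q s \<partial>lborel)" .
  qed (simp add: q_def)
  then have "AE s in lborel. s \<in> {0<..<T} \<longrightarrow> z s = convolution ?k v s + u 0 * frac_kernel \<alpha> s"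
    by eventually_elim (auto simp: q_def trunc_kernel_def)
  then show ?thesis using v rep by blast
qed

text \<open>The convolution of an integrable function with a square integrable kernel: regularity of
  z is gained while \<open>ut\<close> is only known to be integrable.\<close>

lemma frac_deriv_L2: "(\<lambda>s. z s - frac_kernel \<alpha> s * u 0) \<in> L2_space T" "z \<in> L2_space T"
proof -
  let ?k = "trunc_kernel \<alpha> T"
  obtain v where v: "borel_rep T ut v"
    and z: "AE s in lborel. s \<in> {0<..<T} \<longrightarrow> z s = convolution ?k v s + u 0 * frac_kernel \<alpha> s"
    using frac_deriv_representation by blast
  note V = borel_repD[OF v]
  have k: "integrable lborel ?k" and k2: "integrable lborel (\<lambda>s. (?k s)\<^sup>2)"
    using integrable_trunc_kernel integrable_trunc_kernel_square \<alpha> T by simp_all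
  have km: "?k \<in> borel_measurable borel" using k by simp
  have cm: "convolution ?k v \<in> borel_measurable borel" using integrable_convolution[OF k V(2)] by auto
  have zm: "z \<in> borel_measurable (lebesgue_on {0<..<T})" using wz by (auto simp: has_weak_deriv_def)
  have fm: "frac_kernel \<alpha> \<in> borel_measurable (lebesgue_on {0<..<T})"
    by (intro measurable_restrict_space1 measurable_completion) simp
  show 1: "(\<lambda>s. z s - frac_kernel \<alpha> s * u 0) \<in> L2_space T"
    by (rule L2_space_AE_eq_lborel[OF _ cm _ integrable_convolution_square[OF km k2 V(2)]])
       (use z zm fm in \<open>auto elim!: eventually_mono\<close>)
  have 2: "frac_kernel \<alpha> \<in> L2_space T"
    by (rule L2_space_AE_eq_lborel[OF fm km _ k2]) (auto simp: trunc_kernel_def)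
  have "(\<lambda>s. 1 * (z s - frac_kernel \<alpha> s * u 0) + u 0 * frac_kernel \<alpha> s) \<in> L2_space T"
    by (rule L2_lincomb[OF 1 2])
  then show "z \<in> L2_space T" by simp
qed

text \<open>Square integrability of \<open>ut\<close> is assumed on (0,t) only, so the energy bound
  is applied to v cut off at t. By causality the cutoff does not change the convolution on
  (0,t).\<close>

lemma frac_deriv_energy:
  assumes t: "t \<in> {0<..<T}" and ut: "ut \<in> L2_space t"
  shows "(u t - u 0)\<^sup>2 \<le> 2 * Gamma \<alpha> * t powr (1 - \<alpha>) * (\<integral>s. ut s * (z s - frac_kernel \<alpha> s * u 0) \<partial>lebesgue_on {0<..<t})"
proof -
  let ?k = "trunc_kernel \<alpha> T"
  obtain v where v: "borel_rep T ut v" and uv: "\<And>t. t \<in> {0..T} \<Longrightarrow> u t = u 0 + (\<integral>s. indicator {0<..<t} s * v s \<partial>lborel)"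
    and z: "AE s in lborel. s \<in> {0<..<T} \<longrightarrow> z s = convolution ?k v s + u 0 * frac_kernel \<alpha> s"
    using frac_deriv_representation by blast
  note V = borel_repD[OF v]
  have k: "integrable lborel ?k" using integrable_trunc_kernel \<alpha> T by simp
  have cm[measurable]: "convolution ?k v \<in> borel_measurable borel" using integrable_convolution[OF k V(2)] by auto
  note [measurable] = V(3)
  define w where "w = (\<lambda>s. indicator {0<..<t} s * v s)"
  have iw: "integrable lborel w" unfolding w_def using integrable_mult_indicator[OF _ V(2), of "{0<..<t}"] by simp
  have "integrable lborel (\<lambda>s. indicator {0<..<t} s * (v s)\<^sup>2)"
    using ut t V(5) by (subst lebesgue_on_Ioo_eq_lborel(1)[where f="\<lambda>s. (ut s)\<^sup>2", symmetric])
      (auto simp: L2_space_def elim!: eventually_mono)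
  moreover have "(w s)\<^sup>2 = indicator {0<..<t} s * (v s)\<^sup>2" for s by (simp add: w_def indicator_def)
  ultimately have w2: "integrable lborel (\<lambda>s. (w s)\<^sup>2)" by simp
  have "(\<integral>s. w s \<partial>lborel)\<^sup>2 \<le> 2 * Gamma \<alpha> * t powr (1 - \<alpha>) * (\<integral>s. w s * convolution ?k w s \<partial>lborel)"
    by (rule frac_integral_energy_lower_bound(2)) (use \<alpha> t iw w2 in \<open>auto simp: w_def\<close>)
  also have "(\<integral>s. w s \<partial>lborel) = u t - u 0" using uv[of t] t by (simp add: w_def)
  also have "(\<integral>s. w s * convolution ?k w s \<partial>lborel) = (\<integral>s. indicator {0<..<t} s * (v s * convolution ?k v s) \<partial>lborel)"
  proof (rule Bochner_Integration.integral_cong)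
    fix s
    \<comment> \<open>For r \<ge> t > s the argument s - r is negative, where the truncated kernel
      vanishes.\<close>
    have "convolution ?k w s = convolution ?k v s" if s: "s \<in> {0<..<t}"
      unfolding convolution_def
    proof (rule Bochner_Integration.integral_cong)
      fix r show "?k (s - r) * w r = ?k (s - r) * v r"
        using s t V(4)[of r] by (cases "r \<in> {0<..<t}"; cases "r \<le> 0") (auto simp: w_def trunc_kernel_def indicator_def)
    qed simp
    then show "w s * convolution ?k w s = indicator {0<..<t} s * (v s * convolution ?k v s)"
      by (cases "s \<in> {0<..<t}") (auto simp: w_def)
  qed simp
  also have "\<dots> = (\<integral>s. ut s * (z s - frac_kernel \<alpha> s * u 0) \<partial>lebesgue_on {0<..<t})"
  proof (rule lebesgue_on_Ioo_eq_lborel(2)[symmetric])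
    have "(\<lambda>s. z s - frac_kernel \<alpha> s * u 0) \<in> L2_space t"
      by (rule L2_space_subinterval[OF frac_deriv_L2(1)]) (use t in auto)
    then show "(\<lambda>s. ut s * (z s - frac_kernel \<alpha> s * u 0)) \<in> borel_measurable (lebesgue_on {0<..<t})"
      using ut by (auto simp: L2_space_def)
    show "AE s in lborel. s \<in> {0<..<t} \<longrightarrow> ut s * (z s - frac_kernel \<alpha> s * u 0) = v s * convolution ?k v s"
      using z V(5) by eventually_elim (use t in auto)
  qed measurable
  finally show ?thesis .
qed

end

section \<open>Bounds for the Gamma function on [1/2,1]\<close>

lemma Gamma_real_convex_combination:
  fixes a b l :: real
  assumes "0 < a" "0 < b" "0 \<le> l" "l \<le> 1"
  shows "ln (Gamma ((1 - l) * a + l * b)) \<le> (1 - l) * ln (Gamma a) + l * ln (Gamma b)"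
  using convex_onD[OF log_convex_Gamma_real, of l a b] assms by simp

text \<open>Log-convexity and Gamma(1) = Gamma(2) = 1. The point 1 lies between a and 2, so Gamma(a)
  cannot be below 1. The point a + 1 lies between 1 and 2, so a Gamma(a) = Gamma(a+1) \<le> 1, and a
  \<ge> 1/2 gives the upper bound.\<close>

lemma Gamma_real_bounds:
  fixes a :: real
  assumes "1/2 \<le> a" "a \<le> 1"
  shows "1 \<le> Gamma a" "Gamma a \<le> 2"
proof -
  have pos: "0 < Gamma a" "0 < Gamma (a + 1)" using assms by (auto intro: Gamma_real_pos)
  have G2: "Gamma (2::real) = 1" using Gamma_numeral[of "num.Bit0 num.One", where 'a=real] by simp
  \<comment> \<open>The weight that represents 1 as a convex combination of a and 2.\<close>
  define l where "l = (1 - a) / (2 - a)"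
  have "l * (2 - a) = 1 - a" using assms by (simp add: l_def)
  then have "(1 - l) * a + l * 2 = 1" by (simp add: algebra_simps)
  moreover have "0 \<le> l" "l < 1" using assms by (auto simp: l_def)
  ultimately have l: "0 \<le> l" "l \<le> 1" "(1 - l) * a + l * 2 = 1" "l < 1" by auto
  have "0 \<le> (1 - l) * ln (Gamma a)"
    using Gamma_real_convex_combination[of a 2 l, unfolded l(3)] l(1,2) assms by (simp add: G2)
  then have "0 \<le> ln (Gamma a)" using l by (simp add: zero_le_mult_iff)
  then show "1 \<le> Gamma a" using pos by simp
  have "ln (Gamma (a + 1)) \<le> 0"
    using Gamma_real_convex_combination[of 1 2 a] assms by (simp add: G2 algebra_simps)
  then have "Gamma (a + 1) \<le> 1" using pos by simp
  then have "a * Gamma a \<le> 1" using Gamma_plus1[of a] assms by (auto simp: nonpos_Ints_def)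
  moreover have "1/2 * Gamma a \<le> a * Gamma a" using assms pos by (intro mult_right_mono) auto
  ultimately show "Gamma a \<le> 2" by simp
qed

section \<open>The error bound\<close>

lemma L2_sum:
  assumes "finite I" "\<And>i. i \<in> I \<Longrightarrow> f i \<in> L2_space L"
  shows "(\<lambda>x. \<Sum>i\<in>I. f i x) \<in> L2_space L"
  using assms
proof (induction I rule: finite_induct)
  case (insert i I)
  then have "(\<lambda>x. 1 * f i x + 1 * (\<Sum>i\<in>I. f i x)) \<in> L2_space L"
    by (intro L2_lincomb) auto
  then show ?case using insert by simp
qed (use L2_const[of 0] in simp)

lemma L2_space_bound:
  assumes m: "f \<in> borel_measurable (lebesgue_on {0<..<L})" and g: "g \<in> L2_space L"
    and le: "AE x in lebesgue_on {0<..<L}. \<bar>f x\<bar> \<le> g x"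
  shows "f \<in> L2_space L"
proof -
  have "integrable (lebesgue_on {0<..<L}) (\<lambda>x. (f x)\<^sup>2)"
  proof (rule Bochner_Integration.integrable_bound[OF L2_spaceD(2)[OF g]])
    show "AE x in lebesgue_on {0<..<L}. norm ((f x)\<^sup>2) \<le> norm ((g x)\<^sup>2)"
      using le
    proof eventually_elim
      case (elim x)
      then show ?case using power_mono[OF elim, of 2] by simp
    qed
  qed (use m in measurable)
  then show ?thesis using m by (simp add: L2_space_def)
qed

lemma AE_lebesgue_on_subinterval:
  assumes "AE s in lebesgue_on {0<..<T}. Q s" "t \<le> (T::real)"
  shows "AE s in lebesgue_on {0<..<t}. Q s"
proof -
  have "AE s in lebesgue. s \<in> {0<..<T} \<longrightarrow> Q s" using assms(1) by (subst (asm) AE_restrict_space_iff) auto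
  then have "AE s in lebesgue. s \<in> {0<..<t} \<longrightarrow> Q s" by eventually_elim (use assms(2) in auto)
  then show ?thesis by (subst AE_restrict_space_iff) auto
qed

lemma integral_frac_kernel_square:
  assumes "1/2 < \<alpha>" "0 \<le> t"
  shows "integrable (lebesgue_on {0<..<t}) (\<lambda>s. (frac_kernel \<alpha> s)\<^sup>2)"
    and "(\<integral>s. (frac_kernel \<alpha> s)\<^sup>2 \<partial>lebesgue_on {0<..<t}) = t powr (2 * \<alpha> - 1) / ((2 * \<alpha> - 1) * (Gamma \<alpha>)\<^sup>2)"
proof -
  have m: "(\<lambda>s. (frac_kernel \<alpha> s)\<^sup>2) \<in> borel_measurable (lebesgue_on {0<..<t})"
    by (intro measurable_restrict_space1 measurable_completion) simp
  show "integrable (lebesgue_on {0<..<t}) (\<lambda>s. (frac_kernel \<alpha> s)\<^sup>2)"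
    "(\<integral>s. (frac_kernel \<alpha> s)\<^sup>2 \<partial>lebesgue_on {0<..<t}) = t powr (2 * \<alpha> - 1) / ((2 * \<alpha> - 1) * (Gamma \<alpha>)\<^sup>2)"
    using has_bochner_integral_frac_kernel_square[OF assms]
      lebesgue_on_Ioo_eq_lborel[OF m, of "\<lambda>s. (frac_kernel \<alpha> s)\<^sup>2"]
    by (auto simp: has_bochner_integral_iff)
qed

context fem_mesh begin

lemma L2_inner_nodal:
  assumes "v \<in> S" "w \<in> S"
  shows "L2_inner L v w = (\<Sum>i\<in>fem_index. \<Sum>j\<in>fem_index. v (fem_node i) * w (fem_node j) * L2_inner L (fem_basis i) (fem_basis j))"
proof -
  have b: "integrable (lebesgue_on {0<..<L}) (\<lambda>y. fem_basis i y * fem_basis j y)" if "i \<in> fem_index" "j \<in> fem_index" for i j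
    using that by (intro L2_mult_integrable Linf_imp_L2 fem_basis_Linf)
  have "L2_inner L v w = (\<integral>y. (\<Sum>i\<in>fem_index. \<Sum>j\<in>fem_index. v (fem_node i) * w (fem_node j) * (fem_basis i y * fem_basis j y)) \<partial>lebesgue_on {0<..<L})"
    unfolding L2_inner_def
    by (rule Bochner_Integration.integral_cong)
       (use assms in \<open>auto simp: fem_expansion[of v] fem_expansion[of w] sum_product mult_ac\<close>)
  also have "\<dots> = (\<Sum>i\<in>fem_index. \<Sum>j\<in>fem_index. v (fem_node i) * w (fem_node j) * L2_inner L (fem_basis i) (fem_basis j))"
    unfolding L2_inner_def using b by (simp add: Bochner_Integration.integral_sum)
  finally show ?thesis .
qed

text \<open>Both iterated integrals equal the same finite sum of time integrals of nodal products
  times entries of a mass matrix, so no measurability on the product of time and space is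
  involved.\<close>

lemma integral_L2_inner_swap:
  assumes v: "\<And>s. s \<in> {0<..<t} \<Longrightarrow> v s \<in> S" and w: "\<And>s. s \<in> {0<..<t} \<Longrightarrow> w s \<in> S"
    and v2: "\<And>y. y \<in> {0..L} \<Longrightarrow> (\<lambda>s. v s y) \<in> L2_space t" and w2: "\<And>y. y \<in> {0..L} \<Longrightarrow> (\<lambda>s. w s y) \<in> L2_space t"
  shows "integrable (lebesgue_on {0<..<t}) (\<lambda>s. L2_inner L (v s) (w s))"
    and "integrable (lebesgue_on {0<..<L}) (\<lambda>y. \<integral>s. v s y * w s y \<partial>lebesgue_on {0<..<t})"
    and "(\<integral>y. (\<integral>s. v s y * w s y \<partial>lebesgue_on {0<..<t}) \<partial>lebesgue_on {0<..<L})
      = (\<integral>s. L2_inner L (v s) (w s) \<partial>lebesgue_on {0<..<t})"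
proof -
  let ?M = "lebesgue_on {0<..<t}"
  define a where "a = (\<lambda>i j. \<integral>s. v s (fem_node i) * w s (fem_node j) \<partial>?M)"
  have vw: "integrable ?M (\<lambda>s. v s (fem_node i) * w s (fem_node j))" if "i \<in> fem_index" "j \<in> fem_index" for i j
    using that by (intro L2_mult_integrable v2 w2 fem_node_in)
  have b: "integrable (lebesgue_on {0<..<L}) (\<lambda>y. fem_basis i y * fem_basis j y)" if "i \<in> fem_index" "j \<in> fem_index" for i j
    using that by (intro L2_mult_integrable Linf_imp_L2 fem_basis_Linf)
  have inner: "L2_inner L (v s) (w s) = (\<Sum>i\<in>fem_index. \<Sum>j\<in>fem_index. v s (fem_node i) * w s (fem_node j) * L2_inner L (fem_basis i) (fem_basis j))"
    if "s \<in> {0<..<t}" for s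
    using that by (intro L2_inner_nodal v w)
  have i: "integrable ?M (\<lambda>s. \<Sum>i\<in>fem_index. \<Sum>j\<in>fem_index. v s (fem_node i) * w s (fem_node j) * L2_inner L (fem_basis i) (fem_basis j))"
    by (intro Bochner_Integration.integrable_sum integrable_mult_left vw)
  then show "integrable ?M (\<lambda>s. L2_inner L (v s) (w s))"
    by (subst Bochner_Integration.integrable_cong[OF refl inner]) auto
  have I: "(\<integral>s. L2_inner L (v s) (w s) \<partial>?M) = (\<Sum>i\<in>fem_index. \<Sum>j\<in>fem_index. a i j * L2_inner L (fem_basis i) (fem_basis j))"
    by (subst Bochner_Integration.integral_cong[OF refl inner]) (auto simp: a_def vw Bochner_Integration.integral_sum)
  have outer: "(\<integral>s. v s y * w s y \<partial>?M) = (\<Sum>i\<in>fem_index. \<Sum>j\<in>fem_index. a i j * (fem_basis i y * fem_basis j y))"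
    if y: "y \<in> {0<..<L}" for y
  proof -
    have "(\<integral>s. v s y * w s y \<partial>?M) = (\<integral>s. (\<Sum>i\<in>fem_index. \<Sum>j\<in>fem_index. v s (fem_node i) * w s (fem_node j) * (fem_basis i y * fem_basis j y)) \<partial>?M)"
    proof (rule Bochner_Integration.integral_cong)
      fix s assume "s \<in> space ?M"
      then have "v s \<in> S" "w s \<in> S" using v w by auto
      then show "v s y * w s y = (\<Sum>i\<in>fem_index. \<Sum>j\<in>fem_index. v s (fem_node i) * w s (fem_node j) * (fem_basis i y * fem_basis j y))"
        using y by (auto simp: fem_expansion[of "v s" y] fem_expansion[of "w s" y] sum_product mult_ac)
    qed simp
    also have "\<dots> = (\<Sum>i\<in>fem_index. \<Sum>j\<in>fem_index. a i j * (fem_basis i y * fem_basis j y))"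
      by (simp add: a_def vw Bochner_Integration.integral_sum)
    finally show ?thesis .
  qed
  have o: "integrable (lebesgue_on {0<..<L}) (\<lambda>y. \<Sum>i\<in>fem_index. \<Sum>j\<in>fem_index. a i j * (fem_basis i y * fem_basis j y))"
    by (intro Bochner_Integration.integrable_sum integrable_mult_right b)
  then show "integrable (lebesgue_on {0<..<L}) (\<lambda>y. \<integral>s. v s y * w s y \<partial>?M)"
    by (subst Bochner_Integration.integrable_cong[OF refl outer]) auto
  have "(\<integral>y. (\<integral>s. v s y * w s y \<partial>?M) \<partial>lebesgue_on {0<..<L})
      = (\<integral>y. (\<Sum>i\<in>fem_index. \<Sum>j\<in>fem_index. a i j * (fem_basis i y * fem_basis j y)) \<partial>lebesgue_on {0<..<L})"
    by (rule Bochner_Integration.integral_cong[OF refl]) (auto simp: outer)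
  also have "\<dots> = (\<Sum>i\<in>fem_index. \<Sum>j\<in>fem_index. a i j * L2_inner L (fem_basis i) (fem_basis j))"
    using b by (simp add: L2_inner_def Bochner_Integration.integral_sum)
  finally show "(\<integral>y. (\<integral>s. v s y * w s y \<partial>?M) \<partial>lebesgue_on {0<..<L}) = (\<integral>s. L2_inner L (v s) (w s) \<partial>?M)"
    by (simp add: I)
qed

end

theorem theorem3p2:
  fixes L T \<alpha> C\<^sub>F :: real
    and P :: nat and x :: "nat \<Rightarrow> real"
    and F g gs u :: "real \<Rightarrow> real \<Rightarrow> real"
    and u0 :: "real \<Rightarrow> real" and t :: real
  assumes "0 < L" and "0 < T"
    and part: "is_partition L P x"
    and F_reg: "F \<in> bochner_W1inf (Linf_space L) (Linf_norm L) T"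
    and g_reg: "g \<in> bochner_L1 (L2_space L) (L2_norm L) T"
    and gs_reg: "gs \<in> bochner_L1 (L2_space L) (L2_norm L) T"
    and F_mono: "\<forall>t\<in>{0<..<T}. \<forall>y\<in>{0<..<L}. F t differentiable (at y) \<and> deriv (F t) y \<ge> 0"
    and F_bound: "\<forall>t\<in>{0<..<T}. \<forall>y\<in>{0<..<L}. 1 + (F t y)\<^sup>2 \<le> C\<^sub>F"
    and alpha: "1/2 < \<alpha>" "\<alpha> < 1"
    and u0: "u0 \<in> fem_space L P x"
    and sol: "galerkin_solution L T \<alpha> P x F g gs u0 u"
    and t: "0 < t" "t < T"
  shows "ennreal ((L2_norm L (\<lambda>y. u t y - u0 y))\<^sup>2)
    \<le> ennreal (t powr (1 - \<alpha>) / (1 - \<alpha>)\<^sup>2) *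
        (\<integral>\<^sup>+s. ennreal (1/4 * L\<^sup>2 * (L2_norm L (g s))\<^sup>2 + (L2_norm L (gs s))\<^sup>2) \<partial>lebesgue_on {0<..<t})
      + ennreal (C\<^sub>F * t powr \<alpha> / ((1 - \<alpha>)\<^sup>2 * (2 * \<alpha> - 1)) * (H1_norm L u0)\<^sup>2)"
proof -
  interpret fem_mesh L P x by unfold_locales fact+
  let ?M = "lebesgue_on {0<..<t}"
  define G where "G = (\<lambda>s. 1/4 * L\<^sup>2 * (L2_norm L (g s))\<^sup>2 + (L2_norm L (gs s))\<^sup>2)"
  have G0: "0 \<le> G s" for s by (simp add: G_def)
  have gm: "(\<lambda>s. L2_norm L (g s)) \<in> borel_measurable ?M" "(\<lambda>s. L2_norm L (gs s)) \<in> borel_measurable ?M"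
    using g_reg gs_reg t by (auto simp: bochner_L1_def intro!: measurable_lebesgue_on_subinterval[of _ T t])
  then have Gm: "G \<in> borel_measurable ?M" unfolding G_def by measurable
  have c1: "0 < t powr (1 - \<alpha>) / (1 - \<alpha>)\<^sup>2" using t alpha by simp
  show ?thesis
  \<comment> \<open>An infinite data integral makes the right-hand side infinite, its coefficient
    being positive. A finite one makes the spatial norms of g and gs square integrable on
    (0,t).\<close>
  proof (cases "(\<integral>\<^sup>+s. ennreal (G s) \<partial>?M) = \<infinity>")
    case True
    have "ennreal (t powr (1 - \<alpha>) / (1 - \<alpha>)\<^sup>2) \<noteq> 0"
      using c1 by (simp only: ennreal_eq_0_iff not_le)
    then have "ennreal (t powr (1 - \<alpha>) / (1 - \<alpha>)\<^sup>2) * (\<integral>\<^sup>+s. ennreal (G s) \<partial>?M) = top"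
      unfolding True by (simp only: infinity_ennreal_def ennreal_mult_top if_False)
    then show ?thesis unfolding G_def by (simp only:) simp
  next
    case False
    then have Gi: "integrable ?M G"
      using Gm G0 by (auto simp: integrable_iff_bounded less_top)
    have gL2: "(\<lambda>s. L2_norm L (g s)) \<in> L2_space t"
    proof -
      have "integrable ?M (\<lambda>s. 4 / L\<^sup>2 * G s)" using Gi by simp
      then have "integrable ?M (\<lambda>s. (L2_norm L (g s))\<^sup>2)"
        by (rule Bochner_Integration.integrable_bound) (use gm \<open>0 < L\<close> in \<open>auto simp: G_def field_simps\<close>)
      then show ?thesis using gm by (simp add: L2_space_def)
    qed
    have gsL2: "(\<lambda>s. L2_norm L (gs s)) \<in> L2_space t"
    proof -
      have "integrable ?M (\<lambda>s. (L2_norm L (gs s))\<^sup>2)"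
        by (rule Bochner_Integration.integrable_bound[OF Gi]) (use gm in \<open>auto simp: G_def\<close>)
      then show ?thesis using gm by (simp add: L2_space_def)
    qed
    from sol obtain ut z where uS: "\<And>t. t \<in> {0..T} \<Longrightarrow> u t \<in> S"
      and uc: "\<And>y. y \<in> {0..L} \<Longrightarrow> continuous_on {0..T} (\<lambda>t. u t y)"
      and ui: "\<And>y. y \<in> {0..L} \<Longrightarrow> u 0 y = u0 y"
      and utS: "\<And>t. t \<in> {0<..<T} \<Longrightarrow> ut t \<in> S" and zS: "\<And>t. t \<in> {0<..<T} \<Longrightarrow> z t \<in> S"
      and wu: "\<And>y. y \<in> {0..L} \<Longrightarrow> has_weak_deriv T (\<lambda>t. u t y) (\<lambda>t. ut t y)"
      and wz: "\<And>y. y \<in> {0..L} \<Longrightarrow> has_weak_deriv T (frac_integral \<alpha> (\<lambda>s. u s y)) (\<lambda>t. z t y)"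
      and eq: "AE t in lebesgue_on {0<..<T}. galerkin_eq (F t) (g t) (gs t) (ut t) (z t)"
      unfolding galerkin_solution_def galerkin_eq_def by blast
    \<comment> \<open>From here on \<open>w\<close> is the z_w of the overview, and the difference
      u(t) - u0 is called \<open>D\<close>.\<close>
    define w where "w = (\<lambda>s y. 1 * z s y + (- frac_kernel \<alpha> s) * u0 y)"
    have wS: "w s \<in> S" if "s \<in> {0<..<T}" for s
      unfolding w_def by (rule fem_lincomb[OF zS[OF that] u0])
    have w_eq: "w s y = z s y - frac_kernel \<alpha> s * u 0 y" if "y \<in> {0..L}" for s y
      using ui[OF that] by (simp add: w_def)
    have wL2: "(\<lambda>s. w s y) \<in> L2_space t" and zL2: "(\<lambda>s. z s y) \<in> L2_space t" if y: "y \<in> {0..L}" for y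
      using L2_space_subinterval[OF frac_deriv_L2(1)[OF \<open>0 < T\<close> alpha uc[OF y] wu[OF y] wz[OF y]], of t]
        L2_space_subinterval[OF frac_deriv_L2(2)[OF \<open>0 < T\<close> alpha uc[OF y] wu[OF y] wz[OF y]], of t] t
      by (simp_all add: w_eq[OF y])
    have data: "AE s in ?M. galerkin_eq (F s) (g s) (gs s) (ut s) (z s) \<and> g s \<in> L2_space L \<and> gs s \<in> L2_space L"
    proof (rule AE_lebesgue_on_subinterval)
      have "AE s in lebesgue_on {0<..<T}. g s \<in> L2_space L" "AE s in lebesgue_on {0<..<T}. gs s \<in> L2_space L"
        using g_reg gs_reg by (auto simp: bochner_L1_def X_measurable_def)
      with eq show "AE s in lebesgue_on {0<..<T}. galerkin_eq (F s) (g s) (gs s) (ut s) (z s) \<and> g s \<in> L2_space L \<and> gs s \<in> L2_space L"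
        by eventually_elim auto
    qed (use t in simp)
    have C1: "1 \<le> C\<^sub>F"
    proof -
      have "t \<in> {0<..<T}" "L / 2 \<in> {0<..<L}" using t \<open>0 < L\<close> by auto
      with F_bound have "1 + (F t (L / 2))\<^sup>2 \<le> C\<^sub>F" by blast
      then show ?thesis using zero_le_power2[of "F t (L / 2)"] by linarith
    qed
    have FC: "\<bar>F s y\<bar> \<le> C\<^sub>F" if "s \<in> {0<..<T}" "y \<in> {0<..<L}" for s y
    proof -
      have "C\<^sub>F * 1 \<le> C\<^sub>F * C\<^sub>F" using C1 by (intro mult_left_mono) auto
      then have "(F s y)\<^sup>2 \<le> C\<^sub>F * C\<^sub>F" using bspec[OF bspec[OF F_bound that(1)] that(2)] by linarith
      then show ?thesis using C1 abs_le_square_iff[of "F s y" "C\<^sub>F"] by (simp add: power2_eq_square)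
    qed
    have FL: "F s \<in> Linf_space L" if s: "s \<in> {0<..<T}" for s
    proof (rule Linf_bounded[OF continuous_measurable_Ioo FC[OF s]])
      show "continuous_on {0<..<L} (F s)"
        using F_mono s by (intro continuous_at_imp_continuous_on ballI differentiable_imp_continuous_within) auto
    qed
    obtain C0 where C0: "\<And>F g gs v z. F \<in> Linf_space L \<Longrightarrow> (\<forall>y\<in>{0<..<L}. \<bar>F y\<bar> \<le> C\<^sub>F) \<Longrightarrow> g \<in> L2_space L \<Longrightarrow> gs \<in> L2_space L \<Longrightarrow>
     v \<in> S \<Longrightarrow> z \<in> S \<Longrightarrow> galerkin_eq F g gs v z \<Longrightarrow> L2_norm L v \<le> C0 * (L2_norm L z + L2_norm L g + L2_norm L gs)"
      using galerkin_stability[of "C\<^sub>F"] by metis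
    obtain K where K: "K \<ge> 0" "\<And>v y. v \<in> S \<Longrightarrow> y \<in> {0..L} \<Longrightarrow> \<bar>v y\<bar> \<le> K * L2_norm L v"
      using fem_inverse_estimate by blast
    \<comment> \<open>A square integrable majorant in time for \<open>ut\<close> at every point of
      \<Omega>, composed of the inverse estimate, the stability bound and the nodal bound for z; it
      is grouped in pairs to fit \<open>L2_lincomb\<close>.\<close>
    define \<rho> where "\<rho> = (\<lambda>s. (K * \<bar>C0\<bar>) * (1 * (sqrt L * (\<Sum>i\<in>fem_index. \<bar>z s (fem_node i)\<bar>)) + 1 * L2_norm L (g s)) + (K * \<bar>C0\<bar>) * L2_norm L (gs s))"
    have "(\<lambda>s. \<Sum>i\<in>fem_index. \<bar>z s (fem_node i)\<bar>) \<in> L2_space t"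
      by (intro L2_sum L2_abs zL2 fem_node_in) auto
    then have "(\<lambda>s. sqrt L * (\<Sum>i\<in>fem_index. \<bar>z s (fem_node i)\<bar>)) \<in> L2_space t"
      by (intro Linf_L2_mult[OF Linf_const])
    then have \<rho>: "\<rho> \<in> L2_space t"
      unfolding \<rho>_def by (intro L2_lincomb gL2 gsL2)
    have utL2: "(\<lambda>s. ut s y) \<in> L2_space t" if y: "y \<in> {0..L}" for y
    proof (rule L2_space_bound[OF _ \<rho>])
      show "(\<lambda>s. ut s y) \<in> borel_measurable ?M"
        using wu[OF y] t by (auto simp: has_weak_deriv_def intro!: measurable_lebesgue_on_subinterval[of _ T t])
      show "AE s in ?M. \<bar>ut s y\<bar> \<le> \<rho> s"
        using data AE_space
      proof eventually_elim
        case (elim s)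
        then have s: "s \<in> {0<..<T}" using t by simp
        have "\<bar>ut s y\<bar> \<le> K * L2_norm L (ut s)" by (rule K(2)[OF utS[OF s] y])
        also have "\<dots> \<le> K * (C0 * (L2_norm L (z s) + L2_norm L (g s) + L2_norm L (gs s)))"
          by (intro mult_left_mono C0[OF FL[OF s] _ _ _ utS[OF s] zS[OF s]] K) (use elim FC s in auto)
        also have "\<dots> \<le> K * (\<bar>C0\<bar> * (sqrt L * (\<Sum>i\<in>fem_index. \<bar>z s (fem_node i)\<bar>) + L2_norm L (g s) + L2_norm L (gs s)))"
          by (intro mult_left_mono mult_mono add_mono L2_norm_le_nodal_sum zS s K add_nonneg_nonneg L2_norm_nonneg) auto
        also have "\<dots> = \<rho> s" by (simp add: \<rho>_def algebra_simps)
        finally show ?case .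
      qed
    qed
    define c where "c = 2 * Gamma \<alpha> * t powr (1 - \<alpha>)"
    have \<Gamma>: "1 \<le> Gamma \<alpha>" "Gamma \<alpha> \<le> 2" using Gamma_real_bounds alpha by auto
    have c0: "0 \<le> c" using \<Gamma> by (simp add: c_def)
    define D where "D = (\<lambda>y. u t y - u0 y)"
    have DS: "D \<in> S" using fem_lincomb[OF uS[of t] u0, of 1 "-1"] t by (simp add: D_def)
    define H where "H = C\<^sub>F * (H1_norm L u0)\<^sup>2"
    have H0: "0 \<le> H" using C1 by (simp add: H_def)
    note swap = integral_L2_inner_swap[of t ut w, OF utS wS utL2 wL2]
    have sw: "integrable ?M (\<lambda>s. L2_inner L (ut s) (w s))"
      "integrable (lebesgue_on {0<..<L}) (\<lambda>y. \<integral>s. ut s y * w s y \<partial>?M)"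
      "(\<integral>y. (\<integral>s. ut s y * w s y \<partial>?M) \<partial>lebesgue_on {0<..<L}) = (\<integral>s. L2_inner L (ut s) (w s) \<partial>?M)"
      using t by (auto intro!: swap)
    note k2 = integral_frac_kernel_square[OF alpha(1) less_imp_le[OF t(1)]]
    \<comment> \<open>The lower energy bound holds at each y. Integrated over \<Omega>, with time
      and space exchanged, it meets the quantity that the Galerkin equation bounds at almost every
      s.\<close>
    have "(L2_norm L D)\<^sup>2 = (\<integral>y. (D y)\<^sup>2 \<partial>lebesgue_on {0<..<L})"
      unfolding L2_norm_power2 L2_inner_def by (simp add: power2_eq_square)
    also have "\<dots> \<le> (\<integral>y. c * (\<integral>s. ut s y * w s y \<partial>?M) \<partial>lebesgue_on {0<..<L})"
    proof (rule integral_mono)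
      show "integrable (lebesgue_on {0<..<L}) (\<lambda>y. (D y)\<^sup>2)" by (rule L2_spaceD(2)[OF fem_L2[OF DS]])
      fix y assume "y \<in> space (lebesgue_on {0<..<L})"
      then have y: "y \<in> {0..L}" by simp
      show "(D y)\<^sup>2 \<le> c * (\<integral>s. ut s y * w s y \<partial>?M)"
        using frac_deriv_energy[OF \<open>0 < T\<close> alpha uc[OF y] wu[OF y] wz[OF y] _ utL2[OF y]] t ui[OF y]
        by (simp add: D_def c_def w_eq[OF y])
    qed (use sw in simp)
    also have "\<dots> = c * (\<integral>s. L2_inner L (ut s) (w s) \<partial>?M)" by (simp add: sw)
    also have "\<dots> \<le> c * (\<integral>s. 3/4 * (G s + (frac_kernel \<alpha> s)\<^sup>2 * H) \<partial>?M)"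
    proof (intro mult_left_mono integral_mono_AE)
      show "integrable ?M (\<lambda>s. 3/4 * (G s + (frac_kernel \<alpha> s)\<^sup>2 * H))" using Gi k2(1) by simp
      show "AE s in ?M. L2_inner L (ut s) (w s) \<le> 3/4 * (G s + (frac_kernel \<alpha> s)\<^sup>2 * H)"
        using data AE_space
      proof eventually_elim
        case (elim s)
        then have s: "s \<in> {0<..<T}" using t by simp
        have "L2_inner L (ut s) (w s) \<le> 3/4 * (L\<^sup>2 / 4 * (L2_norm L (g s))\<^sup>2 + (L2_norm L (gs s))\<^sup>2 + (frac_kernel \<alpha> s)\<^sup>2 * (C\<^sub>F * (H1_norm L u0)\<^sup>2))"
          by (rule galerkin_energy_bound[OF _ _ FL[OF s] _ _ utS[OF s] zS[OF s] wS[OF s] u0])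
             (use elim F_mono F_bound s in \<open>auto simp: w_def\<close>)
        then show ?case by (simp add: G_def H_def)
      qed
    qed (use sw c0 in auto)
    also have "\<dots> = c * (3/4) * ((\<integral>s. G s \<partial>?M) + t powr (2 * \<alpha> - 1) / ((2 * \<alpha> - 1) * (Gamma \<alpha>)\<^sup>2) * H)"
      using Gi k2 by simp
    \<comment> \<open>The factor Gamma(\<alpha>)^2 under the kernel term leaves 1/Gamma(\<alpha>),
      and t^(1-\<alpha>) t^(2\<alpha>-1) = t^\<alpha>.\<close>
    also have "\<dots> = (3/2 * Gamma \<alpha>) * (t powr (1 - \<alpha>) * (\<integral>s. G s \<partial>?M))
        + (3/2 / Gamma \<alpha>) * (t powr \<alpha> / (2 * \<alpha> - 1) * H)"
    proof -
      have "t powr \<alpha> = t powr (1 - \<alpha>) * t powr (2 * \<alpha> - 1)" by (simp flip: powr_add)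
      moreover have "2 * \<gamma> * A * (3/4) * (I + B / (m * \<gamma>\<^sup>2) * h) = (3/2 * \<gamma>) * (A * I) + (3/2 / \<gamma>) * (A * B / m * h)"
        if "\<gamma> \<noteq> 0" "m \<noteq> 0" for \<gamma> A I B m h :: real
        using that by (simp add: power2_eq_square field_simps)
      ultimately show ?thesis using \<Gamma> alpha unfolding c_def by simp
    qed
    \<comment> \<open>Both numerical factors are at most 3, by Gamma(\<alpha>) \<le> 2 and
      Gamma(\<alpha>) \<ge> 1 respectively, hence below 4 and so below (1-\<alpha>)^(-2).\<close>
    also have "\<dots> \<le> (1 / (1 - \<alpha>)\<^sup>2) * (t powr (1 - \<alpha>) * (\<integral>s. G s \<partial>?M)) + (1 / (1 - \<alpha>)\<^sup>2) * (t powr \<alpha> / (2 * \<alpha> - 1) * H)"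
    proof -
      have "(1 - \<alpha>)\<^sup>2 \<le> (1/2)\<^sup>2" using alpha by (intro power_mono) auto
      also have "(1/2 :: real)\<^sup>2 = 1/4" by (simp add: power2_eq_square)
      finally have "4 * (1 - \<alpha>)\<^sup>2 \<le> 1" by linarith
      moreover have "0 < (1 - \<alpha>)\<^sup>2" using alpha by simp
      ultimately have "4 \<le> 1 / (1 - \<alpha>)\<^sup>2" by (simp only: pos_le_divide_eq)
      moreover have "3/2 * Gamma \<alpha> \<le> 3" "3/2 / Gamma \<alpha> \<le> 3" using \<Gamma> by (auto simp: field_simps)
      ultimately show ?thesis
        using G0 H0 alpha by (intro add_mono mult_right_mono mult_nonneg_nonneg integral_nonneg) auto
    qed
    also have "\<dots> = t powr (1 - \<alpha>) / (1 - \<alpha>)\<^sup>2 * (\<integral>s. G s \<partial>?M) + C\<^sub>F * t powr \<alpha> / ((1 - \<alpha>)\<^sup>2 * (2 * \<alpha> - 1)) * (H1_norm L u0)\<^sup>2"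
      by (simp add: H_def)
    finally have "ennreal ((L2_norm L D)\<^sup>2) \<le> ennreal (t powr (1 - \<alpha>) / (1 - \<alpha>)\<^sup>2 * (\<integral>s. G s \<partial>?M) + C\<^sub>F * t powr \<alpha> / ((1 - \<alpha>)\<^sup>2 * (2 * \<alpha> - 1)) * (H1_norm L u0)\<^sup>2)"
      by (rule ennreal_leI)
    also have "\<dots> = ennreal (t powr (1 - \<alpha>) / (1 - \<alpha>)\<^sup>2) * ennreal (\<integral>s. G s \<partial>?M) + ennreal (C\<^sub>F * t powr \<alpha> / ((1 - \<alpha>)\<^sup>2 * (2 * \<alpha> - 1)) * (H1_norm L u0)\<^sup>2)"
    proof -
      have I0: "0 \<le> (\<integral>s. G s \<partial>?M)" using G0 by simp
      have "0 \<le> C\<^sub>F * t powr \<alpha> / ((1 - \<alpha>)\<^sup>2 * (2 * \<alpha> - 1)) * (H1_norm L u0)\<^sup>2" using C1 alpha by simp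
      with mult_nonneg_nonneg[OF less_imp_le[OF c1] I0] show ?thesis
        by (simp only: ennreal_plus ennreal_mult[OF less_imp_le[OF c1] I0])
    qed
    also have "ennreal (\<integral>s. G s \<partial>?M) = (\<integral>\<^sup>+s. ennreal (G s) \<partial>?M)"
      by (rule nn_integral_eq_integral[symmetric]) (use Gi G0 in auto)
    finally show ?thesis unfolding D_def G_def .
  qed
qed

end
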